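(* Let $d\in\mathbb{N}$. There exists a constant $C_d>0$ depending only on $d$ such that the following holds. Let $t\in\mathbb{N}_0$ and let $\mathcal{S}_d$ be an order-2 digital $(t,d)$-sequence over $\mathbb{F}_2$ with generating matrices $E_i=(e_{i,k,\ell})_{k,\ell\ge1}\in\mathbb{F}_2^{\mathbb{N}\times\mathbb{N}}$, $i\in\{1,\dots,d\}$, for which $e_{i,k,\ell}=0$ for all $k>2\ell$ and all $i\in\{1,\dots,d\}$. Then $$L_{2,N}^{\mathrm{per}}(\mathcal{S}_d)\le C_d\,2^t\,\frac{(\log N)^{d/2}}{N}\qquad\text{for all }N\in\mathbb{N}\setminus\{1\}.$$ This order of magnitude in $N$ is best possible, by Proĭnov's lower bound: there exists $c_d>0$ such that every sequence $\mathcal{S}_d$ in $[0,1)^d$ satisfies $L_{2,N}^{\mathrm{per}}(\mathcal{S}_d)\ge c_d(\log N)^{d/2}/N$ for infinitely many $N\in\mathbb{N}\setminus\{1\}$.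
   Context: **Periodic $L_2$-discrepancy.** For $x,y\in[0,1]$ put $B(x,y)=[x,y)$ if $x\le y$ and $B(x,y)=[0,y)\cup[x,1)$ if $x>y$; for $\boldsymbol{x},\boldsymbol{y}\in[0,1]^d$ put $B(\boldsymbol{x},\boldsymbol{y})=B(x_1,y_1)\times\dots\times B(x_d,y_d)$. For a sequence $\mathcal{S}_d=(\boldsymbol{x}_n)_{n\ge0}$ in $[0,1)^d$ and $N\in\mathbb{N}$, $$L_{2,N}^{\mathrm{per}}(\mathcal{S}_d)=\Big(\int_{[0,1]^{2d}}\Big|\frac{\#\{0\le n<N:\boldsymbol{x}_n\in B(\boldsymbol{x},\boldsymbol{y})\}}{N}-\lambda(B(\boldsymbol{x},\boldsymbol{y}))\Big|^2\,\mathrm{d}(\boldsymbol{x},\boldsymbol{y})\Big)^{1/2},$$ where $\lambda$ is Lebesgue measure. **Digital sequences over $\mathbb{F}_2$.** $\mathbb{F}_2=\{0,1\}$ is the field with two elements. Let $C_1,\dots,C_d\in\mathbb{F}_2^{\mathbb{N}\times\mathbb{N}}$, $C_j=(c_{j,k,\ell})_{k,\ell\ge1}$ ($k$ = row index, $\ell$ = column index), be such that for each $\ell$ there is $K(\ell)$ with $c_{j,k,\ell}=0$ for all $k>K(\ell)$. For $k\in\mathbb{N}_0$ with binary expansion $k=k_0+k_12+\dots+k_{m-1}2^{m-1}$ put $\vec k=(k_0,\dots,k_{m-1},0,0,\dots)^\top\in\mathbb{F}_2^{\mathbb{N}}$, compute over $\mathbb{F}_2$ the vectors $C_j\vec k=(x_{j,k,1},x_{j,k,2},\dots)^\top$,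 and put $x_{j,k}=\sum_{i\ge1}x_{j,k,i}2^{-i}\in[0,1)$ and $\boldsymbol{x}_k=(x_{1,k},\dots,x_{d,k})\in[0,1)^d$. The sequence $(\boldsymbol{x}_k)_{k\ge0}$ is the digital sequence over $\mathbb{F}_2$ with generating matrices $C_1,\dots,C_d$. **Order-$\alpha$ digital nets.** Let $n,m,\alpha\in\mathbb{N}$ with $m\ge\alpha n$, and $t\in\mathbb{N}_0$ with $0\le t\le\alpha n$. Matrices $C_1,\dots,C_d\in\mathbb{F}_2^{m\times n}$, where $\vec c_{j,i}$ denotes the $i$-th row of $C_j$, generate an order-$\alpha$ digital $(t,n,d)$-net over $\mathbb{F}_2$ if for all integers $\nu_1,\dots,\nu_d\ge0$ and all integers $1\le i_{j,\nu_j}<\dots<i_{j,1}\le m$ ($j=1,\dots,d$; no indices for $j$ if $\nu_j=0$) with $\sum_{j=1}^d\sum_{l=1}^{\min(\nu_j,\alpha)}i_{j,l}\le\alpha n-t$, the vectors $\vec c_{1,i_{1,\nu_1}},\dots,\vec c_{1,i_{1,1}},\dots,\vec c_{d,i_{d,\nu_d}},\dots,\vec c_{d,i_{d,1}}$ are linearly independent over $\mathbb{F}_2$. **Order-$\alpha$ digital sequences.** The digital sequence with generating matrices $C_1,\dots,C_d\in\mathbb{F}_2^{\mathbb{N}\times\mathbb{N}}$ is an order-$\alpha$ digital $(t,d)$-sequence over $\mathbb{F}_2$ if for all $n>t/\alpha$ the left upper $\alpha n\times n$ submatrices of $C_1,\dots,C_d$ generate an order-$\alpha$ digital $(t,n,d)$-net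 over $\mathbb{F}_2$. Here $\alpha=2$. *)

theory Defs
  imports "HOL-Analysis.Analysis" "HOL-Library.Z2"
begin

section \<open>Periodic \<open>L\<^sub>2\<close>-discrepancy\<close>

definition per_interval :: "real \<Rightarrow> real \<Rightarrow> real set" where
  "per_interval x y = (if x \<le> y then {x..<y} else {0..<y} \<union> {x..<1})"

definition per_box :: "real ^ 'd \<Rightarrow> real ^ 'd \<Rightarrow> (real ^ 'd) set" where
  "per_box x y = {z. \<forall>j. z $ j \<in> per_interval (x $ j) (y $ j)}"

definition per_L2_discrepancy :: "(nat \<Rightarrow> real ^ 'd) \<Rightarrow> nat \<Rightarrow> real" where
  "per_L2_discrepancy X N =
     sqrt (LINT (x, y) : cbox 0 1 \<times> cbox 0 1 | lborel.
       \<bar>real (card {n. n < N \<and> X n \<in> per_box x y}) / real N - measure lborel (per_box x y)\<bar>\<^sup>2)"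

section \<open>Digital sequences over \<open>\<F>\<^sub>2\<close>\<close>

text \<open>
  The field with two elements is the type \<^typ>\<open>bit\<close>. A matrix over it is a function
  \<^typ>\<open>nat \<Rightarrow> nat \<Rightarrow> bit\<close> (row index first, column index second), where both indices start
  at 1; entries with an index 0 are never inspected. Thus the left upper \<open>m \<times> n\<close> submatrix of
  an infinite matrix is represented by the same function, together with the numbers
  \<open>m\<close> and \<open>n\<close>. A \<open>d\<close>-tuple of matrices is a function on an index type \<open>'d\<close>
  with \<open>CARD('d) = d\<close>.
\<close>

type_synonym bit_matrix = "nat \<Rightarrow> nat \<Rightarrow> bit"

definition finite_columns :: "bit_matrix \<Rightarrow> bool" where
  "finite_columns C \<longleftrightarrow> (\<forall>l\<ge>1. \<exists>K. \<forall>k\<ge>1. k > K \<longrightarrow> C k l = 0)"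

definition digit_vec :: "nat \<Rightarrow> nat \<Rightarrow> bit" where
  "digit_vec k l = of_nat (k div 2 ^ (l - 1))"

text \<open>
  The sum below is finite for \<open>v = digit_vec k\<close>, since only finitely many binary digits
  of \<open>k\<close> are nonzero.
\<close>

definition mat_vec :: "bit_matrix \<Rightarrow> (nat \<Rightarrow> bit) \<Rightarrow> nat \<Rightarrow> bit" where
  "mat_vec C v i = (\<Sum>l | 1 \<le> l \<and> v l \<noteq> 0. C i l * v l)"

definition digital_sequence :: "('d \<Rightarrow> bit_matrix) \<Rightarrow> nat \<Rightarrow> real ^ 'd" where
  "digital_sequence C k =
     (\<chi> j. \<Sum>i. of_bit (mat_vec (C j) (digit_vec k) (Suc i)) / 2 ^ Suc i)"

section \<open>Digital nets and sequences of higher order\<close>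

text \<open>
  Linear independence over \<open>\<F>\<^sub>2\<close> of a finite family \<open>(v p)\<close>, \<open>p \<in> I\<close>, of row vectors with
  coordinates \<open>1, \<dots>, n\<close>. It is a property of the family rather than of the set of its
  members: a family with a repeated vector is dependent.
\<close>

definition independent_family :: "nat \<Rightarrow> 'p set \<Rightarrow> ('p \<Rightarrow> nat \<Rightarrow> bit) \<Rightarrow> bool" where
  "independent_family n I v \<longleftrightarrow>
     (\<forall>a. (\<forall>l\<in>{1..n}. (\<Sum>p\<in>I. a p * v p l) = 0) \<longrightarrow> (\<forall>p\<in>I. a p = 0))"

text \<open>
  In the following definition, \<open>i j 1 > i j 2 > \<dots> > i j (\<nu> j)\<close> are the indices of the rows
  selected from the matrix \<open>C j\<close>.
\<close>

definition order_digital_net ::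
  "nat \<Rightarrow> nat \<Rightarrow> nat \<Rightarrow> nat \<Rightarrow> ('d::finite \<Rightarrow> bit_matrix) \<Rightarrow> bool" where
  "order_digital_net \<alpha> t m n C \<longleftrightarrow>
     1 \<le> \<alpha> \<and> 1 \<le> n \<and> \<alpha> * n \<le> m \<and> t \<le> \<alpha> * n \<and>
     (\<forall>(\<nu> :: 'd \<Rightarrow> nat) (i :: 'd \<Rightarrow> nat \<Rightarrow> nat).
        (\<forall>j. \<forall>l\<in>{1..\<nu> j}. i j l \<in> {1..m}) \<and>
        (\<forall>j. \<forall>l\<in>{1..\<nu> j}. \<forall>l'\<in>{1..\<nu> j}. l < l' \<longrightarrow> i j l' < i j l) \<and>
        (\<Sum>j\<in>UNIV. \<Sum>l=1..min (\<nu> j) \<alpha>. i j l) \<le> \<alpha> * n - t \<longrightarrow>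
        independent_family n (SIGMA j:UNIV. {1..\<nu> j}) (\<lambda>(j, l). C j (i j l)))"

definition order_digital_sequence ::
  "nat \<Rightarrow> nat \<Rightarrow> ('d::finite \<Rightarrow> bit_matrix) \<Rightarrow> bool" where
  "order_digital_sequence \<alpha> t C \<longleftrightarrow>
     (\<forall>j. finite_columns (C j)) \<and>
     (\<forall>n. real n > real t / real \<alpha> \<longrightarrow> order_digital_net \<alpha> t (\<alpha> * n) n C)"

end

theory Submission
  imports Defs
begin

text \<open>
  Write \<open>N L\<close> for the unnormalised periodic discrepancy of the first \<open>N\<close> points. Expanding the
  square under the integral turns \<open>(N L)\<^sup>2\<close> into a double sum over pairs of points of the product
  kernel \<open>\<Prod>\<^sub>j (1/2 - \<delta>\<^sub>j + \<delta>\<^sub>j\<^sup>2)\<close>, \<open>\<delta>\<^sub>j = \<bar>x\<^sub>j - y\<^sub>j\<bar>\<close>, minus \<open>N\<^sup>2 / 3\<^sup>d\<close>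
  (\<open>discrepancy_kernel_formula\<close>). In one variable the kernel is \<open>1/3\<close> plus twice
  \<open>\<Sum>\<^sub>I 2\<^sup>a g\<^sub>I(x) g\<^sub>I(y)\<close>, where \<open>I\<close> runs over the dyadic intervals, \<open>2\<^sup>-\<^sup>a\<close> is the length of
  \<open>I\<close>, and \<open>g\<^sub>I\<close> is the integral of the hat function over \<open>I\<close> minus that hat function
  (\<open>kernel_part_tendsto\<close>). The constant parts cancel against \<open>N\<^sup>2 / 3\<^sup>d\<close>, so \<open>(N L)\<^sup>2\<close> is a
  series of nonnegative terms: over the nonempty sets \<open>v\<close> of coordinates and the dyadic boxes
  with sides \<open>(I\<^sub>j)\<close>, \<open>j \<in> v\<close>, it sums, with positive weights, the squares of the hat sums
  \<open>\<Sum>\<^sub>n \<Prod>\<^sub>j g\<^bsub>I\<^sub>j\<^esub>(x\<^bsub>n,j\<^esub>)\<close> (\<open>total_energy_tendsto\<close>). Both halves of the theorem are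
  estimates of these sums.

  Lower bound. This is Roth's argument with time as an additional coordinate. Returning from
  the centred hats \<open>g\<^sub>I\<close> to the hats themselves costs only a constant
  (\<open>hat_defect_energy\<close>). For a box of volume \<open>2\<^sup>-\<^sup>l\<close>, cut the times below \<open>2\<^sup>n\<close> into
  \<open>2\<^sup>n\<^sup>-\<^sup>l\<^sup>+\<^sup>1\<close> blocks. There are then twice as many pairs (box, block) as points, hence for at
  least half of the pairs no point falls into the box during the block; on such a block the local
  discrepancy of the box drifts linearly in time and is large in square mean
  (\<open>drift_lower_bound\<close>). Every shape of box contributes a constant to the time average of
  the energy, and there are of order \<open>n\<^sup>d\<close> shapes.

  Upper bound. The binary digits of \<open>x\<close> expand a hat into Walsh functions, and after the
  digits that locate the interval exactly two more digits enter (\<open>digit_term_series\<close>). A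
  product of such terms is a combination of characters, and the order-2 net property makes
  the sum of a character over a dyadic block of \<open>2\<^sup>m\<close> consecutive points vanish unless the
  two largest digit positions of each coordinate, added over all coordinates, exceed \<open>2m - t\<close>
  (\<open>walsh_sum_vanishes\<close>). The surviving terms carry exponentially small coefficients, so for
  \<open>m\<close> beyond the level \<open>l\<close> of the box the block sums decay geometrically (\<open>block_estimate\<close>), and
  every hat sum is at most a constant times \<open>2\<^sup>t\<^sup>-\<^sup>l\<close>, whatever \<open>N\<close> is (\<open>hat_sum_bound\<close>). For
  the shapes of level up to \<open>log\<^sub>2 N\<close> this gives a bounded contribution each; for finer shapes
  the number of points is the limiting factor and the contributions decay (\<open>energy_bound\<close>).
\<close>

section \<open>Dyadic cells and hat functions\<close>

definition cell :: "nat \<Rightarrow> real \<Rightarrow> nat" where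
  "cell a x = nat \<lfloor>2 ^ a * x\<rfloor>"

definition tent :: "real \<Rightarrow> real" where
  "tent y = min y (1 - y)"

definition hat_height :: "nat \<Rightarrow> real \<Rightarrow> real" where
  "hat_height a x = tent (frac (2 ^ a * x)) / 2 ^ a"

definition in_cell :: "nat \<times> nat \<Rightarrow> real \<Rightarrow> real" where
  "in_cell I x = of_bool (cell (fst I) x = snd I)"

definition hat :: "nat \<times> nat \<Rightarrow> real \<Rightarrow> real" where
  "hat I x = in_cell I x * hat_height (fst I) x"

text \<open>
  The interval with index \<open>(a, b)\<close> is \<open>[b / 2\<^sup>a, (b + 1) / 2\<^sup>a)\<close>; the integral of its hat over the
  unit interval is \<open>4\<^sup>-\<^sup>(\<^sup>a\<^sup>+\<^sup>1\<^sup>)\<close>. Up to sign, the centred hat at \<open>x\<close> is the unnormalised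
  Haar coefficient of the periodic sawtooth with its jump at \<open>x\<close>.
\<close>

definition centred_hat :: "nat \<times> nat \<Rightarrow> real \<Rightarrow> real" where
  "centred_hat I x = 1 / 4 ^ (fst I + 1) - hat I x"

definition dyadic :: "nat \<Rightarrow> (nat \<times> nat) set" where
  "dyadic A = (SIGMA a:{..<A}. {..<2 ^ a})"

lemma finite_dyadic [simp]: "finite (dyadic A)"
  by (simp add: dyadic_def)

lemma sum_dyadic: "(\<Sum>I\<in>dyadic A. f I) = (\<Sum>a<A. \<Sum>b<2 ^ a. f (a, b))"
  unfolding dyadic_def by (subst sum.Sigma) auto

lemma tent_bounds:
  assumes "0 \<le> y" "y < 1"
  shows "0 \<le> tent y" "tent y \<le> 1 / 2"
  using assms by (auto simp: tent_def min_def)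

lemma hat_height_bounds: "0 \<le> hat_height a x" "hat_height a x \<le> 1 / 2 / 2 ^ a"
  using tent_bounds[of "frac (2 ^ a * x)"] unfolding hat_height_def
  by (simp_all add: frac_lt_1 divide_right_mono del: divide_divide_eq_left)

lemma cell_less:
  assumes "0 \<le> x" "x < 1"
  shows "cell a x < 2 ^ a"
proof -
  have "\<lfloor>2 ^ a * x\<rfloor> < 2 ^ a"
    using assms by (simp add: floor_less_iff)
  then show ?thesis
    using assms by (simp add: cell_def nat_less_iff)
qed

text \<open>
  The position of a point inside its cell is \<open>frac (2\<^sup>a x)\<close>, and passing from level \<open>a\<close> to
  \<open>a + 1\<close> is one step of the doubling map. All expansions below are obtained by iterating an
  identity for one such step.
\<close>

lemma doubling_frac:
  "frac (2 ^ Suc a * x) = frac (2 * frac (2 ^ a * x :: real))"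
proof -
  have "2 ^ Suc a * x = 2 * frac (2 ^ a * x) + of_int (2 * \<lfloor>2 ^ a * x\<rfloor>)"
    by (simp add: frac_def)
  also have "frac \<dots> = frac (2 * frac (2 ^ a * x))"
    unfolding frac_def by (simp only: floor_add_int[symmetric] of_int_add)
  finally show ?thesis .
qed

lemma doubling_floor:
  "\<lfloor>2 ^ Suc a * x\<rfloor> = 2 * \<lfloor>2 ^ a * x\<rfloor> + \<lfloor>2 * frac (2 ^ a * x :: real)\<rfloor>"
proof -
  have "2 ^ Suc a * x = 2 * frac (2 ^ a * x) + of_int (2 * \<lfloor>2 ^ a * x\<rfloor>)"
    by (simp add: frac_def)
  then show ?thesis
    by (metis add.commute floor_add_int)
qed

lemma floor_double_frac:
  "\<lfloor>2 * frac (y :: real)\<rfloor> = (if frac y < 1 / 2 then 0 else 1)"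
  using frac_ge_0[of y] frac_lt_1[of y] by (auto simp: floor_eq_iff)

lemma cell_Suc:
  assumes "0 \<le> x"
  shows "cell (Suc a) x = 2 * cell a x + (if frac (2 ^ a * x) < 1 / 2 then 0 else 1)"
proof -
  have "0 \<le> \<lfloor>2 ^ a * x\<rfloor>"
    using assms by simp
  then show ?thesis
    unfolding cell_def doubling_floor floor_double_frac by (auto simp: nat_add_distrib nat_mult_distrib)
qed

section \<open>Hat expansion of the periodic kernel\<close>

text \<open>
  The covariance of the Brownian bridge. Its expansion into products of hats is the classical
  Faber--Schauder expansion; the periodic kernel differs from it only by parabolas in each
  variable, and these produce the centring of the hats.
\<close>

definition bridge :: "real \<Rightarrow> real \<Rightarrow> real" where
  "bridge x y = min x y - x * y"

lemma frac_double:
  assumes "0 \<le> u" "u < 1"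
  shows "frac (2 * u :: real) = (if u < 1 / 2 then 2 * u else 2 * u - 1)"
  using assms by (auto simp: frac_unique_iff)

lemma tent_if: "tent u = (if u < 1 / 2 then u else 1 - u)"
  by (auto simp: tent_def min_def)

text \<open>
  Self-similarity: two points in different halves of the interval contribute only through the
  tent of the top level, and inside one half the remainder is a scaled copy of the bridge.
\<close>

lemma bridge_doubling:
  assumes "0 \<le> u" "u < 1" "0 \<le> v" "v < 1"
  shows "bridge u v = tent u * tent v +
           of_bool ((u < 1 / 2) = (v < 1 / 2)) * (bridge (frac (2 * u)) (frac (2 * v)) / 2)"
  unfolding frac_double[OF assms(1,2)] frac_double[OF assms(3,4)] bridge_def tent_if
  by (cases "u < 1 / 2"; cases "v < 1 / 2"; cases "u \<le> v") (simp_all add: min_def field_simps)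

lemma parabola_doubling:
  assumes "0 \<le> u" "u < 1"
  shows "u * (1 - u) = tent u / 2 + frac (2 * u) * (1 - frac (2 * u)) / 4"
  unfolding frac_double[OF assms] tent_if by (cases "u < 1 / 2") (simp_all add: field_simps)

lemma bridge_expansion:
  assumes "0 \<le> x" "x < 1" "0 \<le> y" "y < 1"
  shows "bridge x y = (\<Sum>a<A. 2 ^ a * (of_bool (cell a x = cell a y) * hat_height a x * hat_height a y))
           + of_bool (cell A x = cell A y) * (bridge (frac (2 ^ A * x)) (frac (2 ^ A * y)) / 2 ^ A)"
proof (induction A)
  case 0
  then show ?case
    using assms by (simp add: cell_def frac_eq floor_eq_iff)
next
  case (Suc A)
  let ?u = "frac (2 ^ A * x)" and ?v = "frac (2 ^ A * y)"
  have cells: "cell (Suc A) x = cell (Suc A) y \<longleftrightarrow> cell A x = cell A y \<and> (?u < 1 / 2) = (?v < 1 / 2)"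
  proof -
    have "2 * m + (if P then 0 else 1) = 2 * n + (if Q then 0 else 1) \<longleftrightarrow> m = n \<and> P = Q"
      for m n :: nat and P Q :: bool
      by (cases P; cases Q; simp; presburger)
    then show ?thesis
      using assms by (simp only: cell_Suc)
  qed
  have "bridge ?u ?v = tent ?u * tent ?v + of_bool ((?u < 1 / 2) = (?v < 1 / 2)) *
           (bridge (frac (2 ^ Suc A * x)) (frac (2 ^ Suc A * y)) / 2)"
    unfolding doubling_frac by (rule bridge_doubling) (auto simp: frac_lt_1)
  then show ?case
    unfolding Suc.IH sum.lessThan_Suc cells
    by (cases "(?u < 1 / 2) = (?v < 1 / 2)") (simp_all add: hat_height_def add_divide_distrib)
qed

text \<open>
  The parabola is the series \<open>\<Sum>\<^sub>a 4\<^sup>-\<^sup>a tent(2\<^sup>a x mod 1)\<close>, up to the factor \<open>1/2\<close>. It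
  accounts for the mixed terms (constant times hat) in the product of two centred hats.
\<close>

lemma parabola_expansion:
  assumes "0 \<le> x" "x < 1"
  shows "x * (1 - x) = (\<Sum>a<A. hat_height a x / 2 ^ a) / 2
           + frac (2 ^ A * x) * (1 - frac (2 ^ A * x)) / 4 ^ A"
proof (induction A)
  case 0
  then show ?case
    using assms by (simp add: frac_eq)
next
  case (Suc A)
  let ?u = "frac (2 ^ A * x)"
  have *: "?u * (1 - ?u) = tent ?u / 2 + frac (2 ^ Suc A * x) * (1 - frac (2 ^ Suc A * x)) / 4"
    unfolding doubling_frac by (rule parabola_doubling) (auto simp: frac_lt_1)
  have "(4::real) ^ A = 2 ^ A * 2 ^ A"
    by (simp add: power_mult_distrib[symmetric])
  then show ?case
    unfolding Suc.IH sum.lessThan_Suc * by (simp add: hat_height_def field_simps)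
qed

definition kernel_part :: "nat \<Rightarrow> real \<Rightarrow> real \<Rightarrow> real" where
  "kernel_part A x y = (\<Sum>I\<in>dyadic A. 2 ^ fst I * (centred_hat I x * centred_hat I y))"

lemma sum_in_cell:
  assumes "0 \<le> x" "x < 1"
  shows "(\<Sum>b<2 ^ a. in_cell (a, b) x * f b) = (f (cell a x) :: real)"
  using cell_less[OF assms, of a] by (simp add: in_cell_def of_bool_def if_distrib[of "\<lambda>c. c * _"] sum.delta' cong: if_cong)

lemma kernel_part_eq:
  assumes "0 \<le> x" "x < 1" "0 \<le> y" "y < 1"
  shows "kernel_part A x y = (\<Sum>a<A. (1/4) ^ a) / 16
           - (\<Sum>a<A. hat_height a x / 2 ^ a) / 4 - (\<Sum>a<A. hat_height a y / 2 ^ a) / 4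
           + (\<Sum>a<A. 2 ^ a * (of_bool (cell a x = cell a y) * hat_height a x * hat_height a y))"
proof -
  have level: "(\<Sum>b<2 ^ a. 2 ^ a * (centred_hat (a, b) x * centred_hat (a, b) y)) =
      (1/4) ^ a / 16 - hat_height a x / 2 ^ a / 4 - hat_height a y / 2 ^ a / 4
      + 2 ^ a * (of_bool (cell a x = cell a y) * hat_height a x * hat_height a y)" for a
  proof -
    let ?q = "1 / 4 ^ (a + 1) :: real"
    have four: "(4::real) ^ a = 2 ^ a * 2 ^ a"
      by (simp add: power_mult_distrib[symmetric])
    have "(\<Sum>b<2 ^ a. centred_hat (a, b) x * centred_hat (a, b) y) =
        (\<Sum>b<2 ^ a. ?q * ?q - in_cell (a, b) x * (?q * hat_height a x) - in_cell (a, b) y * (?q * hat_height a y)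
           + in_cell (a, b) x * (in_cell (a, b) y * hat_height a x * hat_height a y))"
      by (intro sum.cong refl) (simp add: centred_hat_def hat_def algebra_simps)
    also have "\<dots> = 2 ^ a * (?q * ?q) - ?q * hat_height a x - ?q * hat_height a y
        + of_bool (cell a x = cell a y) * hat_height a x * hat_height a y"
      unfolding sum.distrib sum_subtractf sum_in_cell[OF assms(1,2)] sum_in_cell[OF assms(3,4)]
      by (simp only: in_cell_def fst_conv snd_conv sum_constant card_lessThan of_nat_power of_nat_numeral
          eq_commute[of "cell a y"] mult.assoc)
    finally have *: "(\<Sum>b<2 ^ a. centred_hat (a, b) x * centred_hat (a, b) y) =
        2 ^ a * (?q * ?q) - ?q * hat_height a x - ?q * hat_height a y
        + of_bool (cell a x = cell a y) * hat_height a x * hat_height a y" .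
    show ?thesis
      unfolding sum_distrib_left[symmetric] * by (simp add: four power_one_over algebra_simps)
  qed
  show ?thesis
    unfolding kernel_part_def sum_dyadic fst_conv level
    by (simp add: sum.distrib sum_subtractf sum_divide_distrib)
qed

text \<open>
  The measure of the set of those pairs \<open>(s, t)\<close> for which the periodic interval from \<open>s\<close> to \<open>t\<close>
  contains both \<open>x\<close> and \<open>y\<close>; this is \<open>1/3\<close> plus the Bernoulli polynomial \<open>B\<^sub>2\<close> at
  \<open>\<bar>x - y\<bar>\<close>.
\<close>

definition periodic_kernel :: "real \<Rightarrow> real \<Rightarrow> real" where
  "periodic_kernel x y = 1 / 2 - \<bar>x - y\<bar> + (x - y)\<^sup>2"

text \<open>
  This limit is what makes the dyadic analysis exact: the constant \<open>1/3\<close> is the mean of the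
  periodic kernel, and the rest is a positive combination of products \<open>g\<^sub>I(x) g\<^sub>I(y)\<close>. The
  remainders in the bridge and parabola expansions are bounded quantities divided by \<open>2\<^sup>A\<close> and
  \<open>4\<^sup>A\<close>.
\<close>

lemma kernel_part_tendsto:
  assumes "0 \<le> x" "x < 1" "0 \<le> y" "y < 1"
  shows "(\<lambda>A. 1 / 3 + 2 * kernel_part A x y) \<longlonglongrightarrow> periodic_kernel x y"
proof -
  have bdd: "(\<lambda>A. c A / q ^ A) \<longlonglongrightarrow> 0" if "\<And>A. \<bar>c A\<bar> \<le> 1" "1 < q" for c :: "nat \<Rightarrow> real" and q :: real
  proof (rule Lim_null_comparison)
    show "\<forall>\<^sub>F A in sequentially. norm (c A / q ^ A) \<le> inverse q ^ A"
      using that by (intro always_eventually) (auto simp: field_simps)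
    show "(\<lambda>A. inverse q ^ A) \<longlonglongrightarrow> 0"
      using that by (intro LIMSEQ_power_zero) (auto simp: field_simps)
  qed
  have parabola: "(\<lambda>A. \<Sum>a<A. hat_height a z / 2 ^ a) \<longlonglongrightarrow> 2 * (z * (1 - z))" if z: "0 \<le> z" "z < 1" for z
  proof -
    have "\<bar>frac (2 ^ A * z) * (1 - frac (2 ^ A * z))\<bar> \<le> 1" for A
      using frac_ge_0[of "2 ^ A * z"] frac_lt_1[of "2 ^ A * z"] by (simp add: abs_mult mult_le_one)
    then have "(\<lambda>A. 2 * (z * (1 - z)) - 2 * (frac (2 ^ A * z) * (1 - frac (2 ^ A * z)) / 4 ^ A))
        \<longlonglongrightarrow> 2 * (z * (1 - z)) - 2 * 0"
      by (intro tendsto_intros bdd) auto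
    moreover have "2 * (z * (1 - z)) - 2 * (frac (2 ^ A * z) * (1 - frac (2 ^ A * z)) / 4 ^ A)
        = (\<Sum>a<A. hat_height a z / 2 ^ a)" for A
      using parabola_expansion[OF z, of A] by simp
    ultimately show ?thesis
      by simp
  qed
  have br: "(\<lambda>A. \<Sum>a<A. 2 ^ a * (of_bool (cell a x = cell a y) * hat_height a x * hat_height a y)) \<longlonglongrightarrow> bridge x y"
  proof -
    let ?r = "\<lambda>A. of_bool (cell A x = cell A y) * (bridge (frac (2 ^ A * x)) (frac (2 ^ A * y)))"
    have "\<bar>bridge u v\<bar> \<le> 1" if "0 \<le> u" "u < 1" "0 \<le> v" "v < 1" for u v
    proof -
      have "0 \<le> min u v * (1 - max u v)" "min u v * (1 - max u v) \<le> 1"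
        using that by (auto intro!: mult_nonneg_nonneg mult_le_one)
      moreover have "bridge u v = min u v * (1 - max u v)"
        by (auto simp: bridge_def min_def max_def algebra_simps)
      ultimately show ?thesis by simp
    qed
    then have "\<bar>bridge (frac (2 ^ A * x)) (frac (2 ^ A * y))\<bar> \<le> 1" for A
      by (simp only: frac_ge_0 frac_lt_1)
    then have "\<bar>?r A\<bar> \<le> 1" for A
      by (cases "cell A x = cell A y") simp_all
    then have "(\<lambda>A. bridge x y - ?r A / 2 ^ A) \<longlonglongrightarrow> bridge x y - 0"
      by (intro tendsto_diff tendsto_const bdd[of ?r 2]) simp_all
    moreover have "bridge x y - ?r A / 2 ^ A = 
       (\<Sum>a<A. 2 ^ a * (of_bool (cell a x = cell a y) * hat_height a x * hat_height a y))" for A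
      unfolding bridge_expansion[OF assms, of A] times_divide_eq_right by (rule add_diff_cancel_right')
    ultimately show ?thesis
      by simp
  qed
  have geo: "(\<lambda>A. \<Sum>a<A. (1/4) ^ a) \<longlonglongrightarrow> 1 / (1 - 1/4 :: real)"
    using geometric_sums[of "1/4 :: real"] by (simp add: sums_def)
  have combine: "(\<lambda>A. 1 / 3 + 2 * (G A / 16 - X A / 4 - Y A / 4 + B A)) \<longlonglongrightarrow> 1 / 3 + 2 * (g / 16 - p / 4 - q / 4 + b)"
    if "G \<longlonglongrightarrow> g" "X \<longlonglongrightarrow> p" "Y \<longlonglongrightarrow> q" "B \<longlonglongrightarrow> b"
    for G X Y B :: "nat \<Rightarrow> real" and g p q b
    using that by (intro tendsto_intros) auto
  have "(\<lambda>A. 1 / 3 + 2 * kernel_part A x y) \<longlonglongrightarrow>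
      1 / 3 + 2 * (1 / (1 - 1/4) / 16 - 2 * (x * (1 - x)) / 4 - 2 * (y * (1 - y)) / 4 + bridge x y)"
    unfolding kernel_part_eq[OF assms] by (rule combine[OF geo parabola[OF assms(1,2)] parabola[OF assms(3,4)] br])
  also have "1 / 3 + 2 * (1 / (1 - 1/4) / 16 - 2 * (x * (1 - x)) / 4 - 2 * (y * (1 - y)) / 4 + bridge x y)
      = periodic_kernel x y"
    by (auto simp: periodic_kernel_def bridge_def min_def abs_if power2_eq_square field_simps)
  finally show ?thesis .
qed

section \<open>Integration over pairs of corners\<close>

text \<open>
  The measure \<open>lborel\<close> on \<open>real ^ 'd\<close> is the image of a product measure indexed by the basis
  vectors, so the product formula for integrals is transported along the bijection between the
  coordinates and the basis.
\<close>

lemma lborel_integral_prod_components: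
  fixes f :: "'d::finite \<Rightarrow> real \<Rightarrow> real"
  assumes f: "\<And>j. integrable lborel (f j)"
  shows "(\<integral>x. (\<Prod>j\<in>UNIV. f j (x $ j)) \<partial>(lborel :: (real ^ 'd) measure)) = (\<Prod>j\<in>UNIV. \<integral>y. f j y \<partial>lborel)"
proof -
  interpret product_sigma_finite "\<lambda>b :: real ^ 'd. lborel :: real measure" ..
  have basis: "(Basis :: (real ^ 'd) set) = range (\<lambda>j. axis j 1)"
    by (auto simp: Basis_vec_def)
  have inj: "inj (\<lambda>j :: 'd. axis j (1 :: real))"
    by (auto simp: inj_on_def axis_eq_axis)
  define idx where "idx = inv (\<lambda>j :: 'd. axis j (1 :: real))"
  have idx: "idx (axis j 1) = j" for j
    unfolding idx_def by (rule inv_f_f[OF inj])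
  have [measurable]: "f j \<in> borel_measurable borel" for j
    using f[of j] by auto
  have comp: "(\<Sum>b\<in>Basis. u b *\<^sub>R b) $ j = u (axis j 1)" for u :: "real ^ 'd \<Rightarrow> real" and j
    unfolding basis sum.reindex[OF inj]
    by (simp add: axis_def if_distrib[of "\<lambda>c. _ * c"] cong: if_cong)
  have "(\<integral>x. (\<Prod>j\<in>UNIV. f j (x $ j)) \<partial>(lborel :: (real ^ 'd) measure))
      = (\<integral>u. (\<Prod>j\<in>UNIV. f j ((\<Sum>b\<in>Basis. u b *\<^sub>R b) $ j)) \<partial>(\<Pi>\<^sub>M b\<in>(Basis :: (real ^ 'd) set). lborel))"
    unfolding lborel_eq[where 'a = "real ^ 'd"] by (subst integral_distr) simp_all
  also have "\<dots> = (\<integral>u. (\<Prod>b\<in>Basis. f (idx b) (u b)) \<partial>(\<Pi>\<^sub>M b\<in>(Basis :: (real ^ 'd) set). lborel))"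
    unfolding comp unfolding basis prod.reindex[OF inj] by (simp add: idx)
  also have "\<dots> = (\<Prod>b\<in>(Basis :: (real ^ 'd) set). \<integral>y. f (idx b) y \<partial>lborel)"
    by (rule product_integral_prod) (simp_all add: f)
  also have "\<dots> = (\<Prod>j\<in>UNIV. \<integral>y. f j y \<partial>lborel)"
    unfolding basis prod.reindex[OF inj] by (simp add: idx)
  finally show ?thesis .
qed

abbreviation unit_measure :: "real measure" where
  "unit_measure \<equiv> restrict_space lborel {0..1}"

lemma finite_unit_measure: "finite_measure unit_measure"
  by (rule finite_measureI) (simp add: emeasure_restrict_space space_restrict_space)

lemma unit_integral: "(\<integral>x. f x \<partial>unit_measure) = (\<integral>x. indicator {0..1} x * f x \<partial>lborel)"
  for f :: "real \<Rightarrow> real"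
  by (subst integral_restrict_space) simp_all

lemma integrable_supported_bounded:
  fixes f :: "'a::euclidean_space \<Rightarrow> real"
  assumes "f \<in> borel_measurable borel" "\<And>x. \<bar>f x\<bar> \<le> B" "\<And>x. x \<notin> cbox a b \<Longrightarrow> f x = 0"
  shows "integrable lborel f"
proof (rule integrableI_bounded_set[where A = "cbox a b" and B = B])
  show "emeasure lborel (cbox a b) < \<infinity>"
    by (simp add: emeasure_lborel_cbox_eq)
qed (use assms in auto)

text \<open>
  The two corners of a box are integrated one after the other, and in each of the two steps the
  integral factors over the coordinates. What remains is one double integral per
  coordinate.
\<close>

lemma square_integral_prod:
  fixes \<phi> :: "'d::finite \<Rightarrow> real \<Rightarrow> real \<Rightarrow> real"
  assumes meas [measurable]: "\<And>j. (\<lambda>p. \<phi> j (fst p) (snd p)) \<in> borel_measurable borel"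
    and bdd: "\<And>j x y. x \<in> {0..1} \<Longrightarrow> y \<in> {0..1} \<Longrightarrow> \<bar>\<phi> j x y\<bar> \<le> 1"
  shows "set_integrable lborel (cbox 0 1 \<times> cbox 0 1) (\<lambda>(x :: real ^ 'd, y). \<Prod>j\<in>UNIV. \<phi> j (x $ j) (y $ j))"
    and "(LINT (x :: real ^ 'd, y) : cbox 0 1 \<times> cbox 0 1 | lborel. \<Prod>j\<in>UNIV. \<phi> j (x $ j) (y $ j))
       = (\<Prod>j\<in>UNIV. \<integral>x. \<integral>y. \<phi> j x y \<partial>unit_measure \<partial>unit_measure)"
proof -
  \<comment> \<open>Extension by zero outside the unit square makes the domain of integration
      a product over the coordinates as well.\<close>
  define \<psi> where "\<psi> j x y = indicator {0..1} x * (indicator {0..1} y * \<phi> j x y)" for j and x y :: real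
  have [measurable]: "(\<lambda>p. \<psi> j (fst p) (snd p)) \<in> borel_measurable borel" for j
    unfolding \<psi>_def borel_prod[symmetric] using meas[of j, folded borel_prod] by measurable
  have \<psi>_bdd: "\<bar>\<psi> j x y\<bar> \<le> 1" for j x y
    using bdd[of x y j] by (auto simp: \<psi>_def indicator_def)
  have ind: "indicator (cbox 0 1 \<times> cbox 0 1) (x, y) * (\<Prod>j\<in>UNIV. \<phi> j (x $ j) (y $ j)) = (\<Prod>j\<in>UNIV. \<psi> j (x $ j) (y $ j))"
    for x y :: "real ^ 'd"
  proof (cases "x \<in> cbox 0 1 \<and> y \<in> cbox 0 1")
    case True
    then show ?thesis
      by (auto simp: \<psi>_def mem_box_cart intro!: prod.cong)
  next
    case False
    then obtain j where "x $ j \<notin> {0..1} \<or> y $ j \<notin> {0..1}"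
      by (auto simp: mem_box_cart)
    then have "\<psi> j (x $ j) (y $ j) = 0"
      by (auto simp: \<psi>_def)
    with False show ?thesis
      by (auto intro: prod_zero[symmetric])
  qed
  have ind': "indicator (cbox 0 1 \<times> cbox 0 1) p *\<^sub>R (case p of (x, y) \<Rightarrow> \<Prod>j\<in>UNIV. \<phi> j (x $ j) (y $ j))
      = (case p of (x, y) \<Rightarrow> \<Prod>j\<in>UNIV. \<psi> j (x $ j) (y $ j))" for p :: "(real ^ 'd) \<times> (real ^ 'd)"
    by (cases p) (simp add: ind)
  have comp [measurable]: "(\<lambda>p :: (real ^ 'd) \<times> (real ^ 'd). \<psi> j (fst p $ j) (snd p $ j)) \<in> borel_measurable borel" for j
  proof -
    have "(\<lambda>p :: (real ^ 'd) \<times> (real ^ 'd). (fst p $ j, snd p $ j)) \<in> borel_measurable borel"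
      by (intro borel_measurable_continuous_onI continuous_intros)
    from measurable_compose[OF this, of "\<lambda>p. \<psi> j (fst p) (snd p)" borel] show ?thesis
      by simp
  qed
  have int: "integrable lborel (\<lambda>(x :: real ^ 'd, y). \<Prod>j\<in>UNIV. \<psi> j (x $ j) (y $ j))"
  proof (rule integrable_supported_bounded[where B = 1 and a = "(0, 0)" and b = "(1, 1)"])
    show "(\<lambda>(x :: real ^ 'd, y). \<Prod>j\<in>UNIV. \<psi> j (x $ j) (y $ j)) \<in> borel_measurable borel"
      unfolding case_prod_beta by measurable
    show "\<bar>case p of (x :: real ^ 'd, y) \<Rightarrow> \<Prod>j\<in>UNIV. \<psi> j (x $ j) (y $ j)\<bar> \<le> 1" for p
      by (cases p) (auto simp: abs_prod intro!: prod_le_1 \<psi>_bdd)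
    show "(case p of (x :: real ^ 'd, y) \<Rightarrow> \<Prod>j\<in>UNIV. \<psi> j (x $ j) (y $ j)) = 0" if "p \<notin> cbox (0, 0) (1, 1)" for p
      using that ind'[of p] by (auto simp: cbox_Pair_eq indicator_def split: prod.splits if_splits)
  qed
  then show "set_integrable lborel (cbox 0 1 \<times> cbox 0 1) (\<lambda>(x :: real ^ 'd, y). \<Prod>j\<in>UNIV. \<phi> j (x $ j) (y $ j))"
    unfolding set_integrable_def ind' .
  have inner: "integrable lborel (\<psi> j x)" for j x
  proof (rule integrable_supported_bounded[where B = 1 and a = 0 and b = 1])
    have "(\<lambda>y. (x, y)) \<in> borel_measurable borel"
      by (intro borel_measurable_continuous_onI continuous_intros)
    from measurable_compose[OF this, of "\<lambda>p. \<psi> j (fst p) (snd p)" borel] show "\<psi> j x \<in> borel_measurable borel"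
      by simp
  qed (auto simp: \<psi>_bdd, auto simp: \<psi>_def)
  have pair_int: "integrable lborel (\<lambda>p. \<psi> j (fst p) (snd p))" for j
  proof (rule integrable_supported_bounded[where B = 1 and a = "(0, 0)" and b = "(1, 1)"])
    show "\<psi> j (fst p) (snd p) = 0" if "p \<notin> cbox (0, 0) (1, 1)" for p
      using that by (cases p) (auto simp: \<psi>_def cbox_Pair_eq indicator_def)
  qed (auto simp: \<psi>_bdd)
  have outer: "integrable lborel (\<lambda>x. \<integral>y. \<psi> j x y \<partial>lborel)" for j
    using lborel_pair.integrable_fst'[OF pair_int[of j, folded lborel_prod]] by simp
  have "(LINT (x :: real ^ 'd, y) : cbox 0 1 \<times> cbox 0 1 | lborel. \<Prod>j\<in>UNIV. \<phi> j (x $ j) (y $ j))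
      = (\<integral>p. (case p of (x :: real ^ 'd, y) \<Rightarrow> \<Prod>j\<in>UNIV. \<psi> j (x $ j) (y $ j)) \<partial>(lborel \<Otimes>\<^sub>M lborel))"
    unfolding set_lebesgue_integral_def ind' lborel_prod ..
  also have "\<dots> = (\<integral>x. \<integral>y. (\<Prod>j\<in>UNIV. \<psi> j (x $ j) (y $ j)) \<partial>lborel \<partial>(lborel :: (real ^ 'd) measure))"
    using lborel_pair.integral_fst'[OF int[folded lborel_prod]] by simp
  also have "\<dots> = (\<integral>x. (\<Prod>j\<in>UNIV. \<integral>y. \<psi> j (x $ j) y \<partial>lborel) \<partial>(lborel :: (real ^ 'd) measure))"
    by (subst lborel_integral_prod_components) (simp_all add: inner)
  also have "\<dots> = (\<Prod>j\<in>UNIV. \<integral>x. \<integral>y. \<psi> j x y \<partial>lborel \<partial>lborel)"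
    by (rule lborel_integral_prod_components) (rule outer)
  also have "\<dots> = (\<Prod>j\<in>UNIV. \<integral>x. \<integral>y. \<phi> j x y \<partial>unit_measure \<partial>unit_measure)"
    unfolding unit_integral \<psi>_def by simp
  finally show "(LINT (x :: real ^ 'd, y) : cbox 0 1 \<times> cbox 0 1 | lborel. \<Prod>j\<in>UNIV. \<phi> j (x $ j) (y $ j))
       = (\<Prod>j\<in>UNIV. \<integral>x. \<integral>y. \<phi> j x y \<partial>unit_measure \<partial>unit_measure)" .
qed

lemma unit_integral_FTC:
  assumes "0 \<le> c" "c \<le> 1" "\<And>x. (P has_real_derivative p x) (at x)" "continuous_on UNIV p"
  shows "(\<integral>y. of_bool (c < y) * p y \<partial>unit_measure) = P 1 - P c"
proof -
  have meas [measurable]: "p \<in> borel_measurable borel"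
    using assms(4) by (rule borel_measurable_continuous_onI)
  have "(\<integral>y. of_bool (c < y) * p y \<partial>unit_measure) = (\<integral>y. indicator {0..1} y * (of_bool (c < y) * p y) \<partial>lborel)"
    by (rule unit_integral)
  also have "\<dots> = (\<integral>y. p y * indicator {c..1} y \<partial>lborel)"
  proof (rule integral_cong_AE)
    show "AE y in lborel. indicator {0..1} y * (of_bool (c < y) * p y) = p y * indicator {c..1} y"
      using AE_lborel_singleton[of c]
    proof eventually_elim
      case (elim y)
      then show ?case
        using assms(1,2) by (auto simp: indicator_def)
    qed
  qed measurable
  also have "\<dots> = P 1 - P c"
    using assms by (intro integral_FTC_Icc_real) (auto intro: continuous_on_subset simp: continuous_on_eq_continuous_at)
  finally show ?thesis .
qed

text \<open>
  Both the indicator function of a periodic interval and its length have, as functions of the end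
  points \<open>x\<close>, \<open>y\<close>, the form \<open>u(y) - u(x) + [y < x]\<close>, the last term accounting for the
  intervals that wrap around. For such factors the double integral reduces to integrals in one
  variable.
\<close>

lemma square_integral_of_differences:
  fixes u v :: "real \<Rightarrow> real"
  assumes [measurable]: "u \<in> borel_measurable borel" "v \<in> borel_measurable borel"
    and bdd: "\<And>x. x \<in> {0..1} \<Longrightarrow> \<bar>u x\<bar> \<le> 1" "\<And>x. x \<in> {0..1} \<Longrightarrow> \<bar>v x\<bar> \<le> 1"
  shows "(\<integral>x. \<integral>y. (u y - u x + of_bool (y < x)) * (v y - v x + of_bool (y < x)) \<partial>unit_measure \<partial>unit_measure)
     = 2 * (\<integral>y. u y * v y \<partial>unit_measure) - 2 * ((\<integral>y. u y \<partial>unit_measure) * (\<integral>y. v y \<partial>unit_measure))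
       + (\<integral>y. u y * (1 - 2 * y) \<partial>unit_measure) + (\<integral>y. v y * (1 - 2 * y) \<partial>unit_measure) + 1 / 2"
proof -
  let ?M = "unit_measure"
  interpret finite_measure ?M
    by (rule finite_unit_measure)
  interpret MM: pair_sigma_finite ?M ?M ..
  interpret P: finite_measure "?M \<Otimes>\<^sub>M ?M"
    by (rule finite_measure_pair_measure; rule finite_unit_measure)
  have [measurable]: "u \<in> borel_measurable ?M" "v \<in> borel_measurable ?M" "(\<lambda>x. x) \<in> borel_measurable ?M"
    by (auto intro!: measurable_restrict_space1)
  have space: "space ?M = {0..1}"
    by (simp add: space_restrict_space)
  have int: "integrable ?M f" if "f \<in> borel_measurable ?M" "\<And>x. x \<in> {0..1} \<Longrightarrow> \<bar>f x\<bar> \<le> B"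
    for f :: "real \<Rightarrow> real" and B
    using that by (intro integrable_const_bound[where B = B]) (auto simp: space intro!: AE_I2)
  have intu: "integrable ?M u" and intv: "integrable ?M v"
    by (rule int[where B = 1]; use bdd in simp)+
  have prod_bdd: "\<bar>a * b\<bar> \<le> 1" if "\<bar>a\<bar> \<le> 1" "\<bar>b\<bar> \<le> 1" for a b :: real
    using that by (simp add: abs_mult mult_le_one)
  have intuv: "integrable ?M (\<lambda>y. u y * v y)"
    by (rule int[where B = 1]) (use bdd prod_bdd in auto)
  have intx: "integrable ?M (\<lambda>y. w y * y)" if [measurable]: "w \<in> borel_measurable ?M" and "\<And>x. x \<in> {0..1} \<Longrightarrow> \<bar>w x\<bar> \<le> 1" for w
    by (rule int[where B = 1]) (use that prod_bdd in auto)
  have total: "measure ?M (space ?M) = 1" "measure ?M {0..1} = 1"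
    by (simp_all add: measure_restrict_space space)
  have below: "(\<integral>y. of_bool (y < x) \<partial>?M) = x" and above: "(\<integral>y. of_bool (x < y) \<partial>?M) = 1 - x" if "x \<in> {0..1}" for x
  proof -
    have "indicator {0..1} y * of_bool (y < x) = (indicator {0..<x} y :: real)"
      "indicator {0..1} y * of_bool (x < y) = (indicator {x<..1} y :: real)" for y
      using that by (auto simp: indicator_def)
    then show "(\<integral>y. of_bool (y < x) \<partial>?M) = x" "(\<integral>y. of_bool (x < y) \<partial>?M) = 1 - x"
      using that unfolding unit_integral by simp_all
  qed
  define w where "w y = u y + v y" for y
  have [measurable]: "w \<in> borel_measurable ?M"
    unfolding w_def by measurable
  have wb: "\<bar>w y * of_bool P\<bar> \<le> 2" if "y \<in> {0..1}" for y P
    using bdd[OF that] by (auto simp: w_def)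
  have wint: "integrable ?M (\<lambda>y. w y * of_bool (y < x))" for x
    by (rule int[where B = 2]) (use wb in auto)
  define W where "W x = (\<integral>y. w y * of_bool (y < x) \<partial>?M)" for x
  have pint: "integrable (?M \<Otimes>\<^sub>M ?M) (\<lambda>(x, y). w y * of_bool (y < x))"
    by (rule P.integrable_const_bound[where B = 2]) (auto simp: space_pair_measure space wb intro!: AE_I2)
  have intW: "integrable ?M W"
    using MM.integrable_fst'[OF pint] unfolding W_def by simp
  have Weq: "(\<integral>x. W x \<partial>?M) = (\<integral>y. w y * (1 - y) \<partial>?M)"
  proof -
    have "(\<integral>x. W x \<partial>?M) = (\<integral>y. \<integral>x. w y * of_bool (y < x) \<partial>?M \<partial>?M)"
      unfolding W_def using MM.Fubini_integral[OF pint] by simp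
    also have "\<dots> = (\<integral>y. w y * (1 - y) \<partial>?M)"
      by (intro Bochner_Integration.integral_cong refl) (simp add: above space)
    finally show ?thesis .
  qed
  have inner: "(\<integral>y. (u y - u x + of_bool (y < x)) * (v y - v x + of_bool (y < x)) \<partial>?M)
      = (\<integral>y. u y * v y \<partial>?M) - u x * (\<integral>y. v y \<partial>?M) - v x * (\<integral>y. u y \<partial>?M) + u x * v x
        + W x - w x * x + x" if x: "x \<in> {0..1}" for x
  proof -
    have ib: "integrable ?M (\<lambda>y. of_bool (y < x) :: real)"
      by (rule int[where B = 1]) auto
    have "(\<integral>y. (u y - u x + of_bool (y < x)) * (v y - v x + of_bool (y < x)) \<partial>?M)
       = (\<integral>y. u y * v y - u x * v y - v x * u y + u x * v x + w y * of_bool (y < x)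
            - w x * of_bool (y < x) + of_bool (y < x) \<partial>?M)"
      by (intro Bochner_Integration.integral_cong refl) (simp add: w_def algebra_simps)
    also have "\<dots> = (\<integral>y. u y * v y \<partial>?M) - u x * (\<integral>y. v y \<partial>?M) - v x * (\<integral>y. u y \<partial>?M) + u x * v x
        + W x - w x * (\<integral>y. of_bool (y < x) \<partial>?M) + (\<integral>y. of_bool (y < x) \<partial>?M)"
      unfolding W_def by (simp add: intuv intu intv wint ib total space)
    finally show ?thesis
      by (simp only: below[OF x])
  qed
  have iw: "integrable ?M w"
    unfolding w_def using intu intv by simp
  have iwx: "integrable ?M (\<lambda>x. w x * x)"
    using intx[of u] intx[of v] bdd by (simp add: w_def algebra_simps)
  have ix: "integrable ?M (\<lambda>x. x)"
    by (rule int[where B = 1]) auto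
  have intx1: "(\<integral>x. x \<partial>?M) = 1 / 2"
  proof -
    have "(\<integral>x. x \<partial>?M) = (\<integral>x. of_bool (0 < x) * x \<partial>?M)"
      by (intro Bochner_Integration.integral_cong refl) (auto simp: space)
    also have "\<dots> = 1\<^sup>2 / 2 - 0\<^sup>2 / 2"
      by (rule unit_integral_FTC) (auto intro!: derivative_eq_intros)
    finally show ?thesis by simp
  qed
  have "(\<integral>x. \<integral>y. (u y - u x + of_bool (y < x)) * (v y - v x + of_bool (y < x)) \<partial>?M \<partial>?M)
     = (\<integral>x. (\<integral>y. u y * v y \<partial>?M) - u x * (\<integral>y. v y \<partial>?M) - v x * (\<integral>y. u y \<partial>?M) + u x * v x
        + W x - w x * x + x \<partial>?M)"
    by (intro Bochner_Integration.integral_cong refl) (simp add: inner space)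
  also have "\<dots> = (\<integral>y. u y * v y \<partial>?M) - (\<integral>y. u y \<partial>?M) * (\<integral>y. v y \<partial>?M)
       - (\<integral>y. v y \<partial>?M) * (\<integral>y. u y \<partial>?M) + (\<integral>y. u y * v y \<partial>?M) + (\<integral>x. W x \<partial>?M) - (\<integral>x. w x * x \<partial>?M) + (\<integral>x. x \<partial>?M)"
    by (simp add: intuv intu intv intW iwx ix total space)
  also have "\<dots> = 2 * (\<integral>y. u y * v y \<partial>?M) - 2 * ((\<integral>y. u y \<partial>?M) * (\<integral>y. v y \<partial>?M))
       + (\<integral>y. u y * (1 - 2 * y) \<partial>?M) + (\<integral>y. v y * (1 - 2 * y) \<partial>?M) + 1 / 2"
  proof -
    have split: "(\<integral>y. z y * (1 - 2 * y) \<partial>?M) = (\<integral>y. z y \<partial>?M) - 2 * (\<integral>y. z y * y \<partial>?M)"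
      if "integrable ?M z" "integrable ?M (\<lambda>y. z y * y)" for z
    proof -
      have "(\<integral>y. z y * (1 - 2 * y) \<partial>?M) = (\<integral>y. z y - 2 * (z y * y) \<partial>?M)"
        by (simp add: algebra_simps)
      then show ?thesis
        using that by simp
    qed
    have "(\<integral>y. w y * (1 - y) \<partial>?M) = (\<integral>y. u y + v y - (u y * y + v y * y) \<partial>?M)"
      by (simp add: w_def algebra_simps)
    moreover have "(\<integral>y. w y * y \<partial>?M) = (\<integral>y. u y * y + v y * y \<partial>?M)"
      by (simp add: w_def algebra_simps)
    ultimately show ?thesis
      unfolding Weq intx1 using split[of u] split[of v] intx[of u] intx[of v] bdd intu intv by simp
  qed
  finally show ?thesis .
qed

section \<open>The discrepancy as a kernel sum\<close>

text \<open>
  \<open>Some z\<close> stands for a point of the sequence and \<open>None\<close> for Lebesgue measure, so that the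
  counting part and the volume part of the discrepancy are treated uniformly.
\<close>

definition corner :: "real option \<Rightarrow> real \<Rightarrow> real" where
  "corner z y = (case z of Some z \<Rightarrow> of_bool (z < y) | None \<Rightarrow> y)"

definition box_factor :: "real option \<Rightarrow> real \<Rightarrow> real \<Rightarrow> real" where
  "box_factor z x y = corner z y - corner z x + of_bool (y < x)"

lemma corner_measurable [measurable]: "corner z \<in> borel_measurable borel"
  unfolding corner_def by (cases z) simp_all

text \<open>
  The value is \<open>1/3\<close> as soon as one of the factors is a length: integrating the
  periodic kernel in one variable over the unit interval gives \<open>1/3\<close>.
\<close>

lemma box_factor_integral:
  assumes "\<And>r. z = Some r \<Longrightarrow> 0 \<le> r \<and> r < 1" "\<And>r. z' = Some r \<Longrightarrow> 0 \<le> r \<and> r < 1"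
  shows "(\<integral>x. \<integral>y. box_factor z x y * box_factor z' x y \<partial>unit_measure \<partial>unit_measure)
    = (case (z, z') of (Some r, Some s) \<Rightarrow> periodic_kernel r s | _ \<Rightarrow> 1 / 3)"
proof -
  have one: "(\<integral>y. of_bool (c < y) \<partial>unit_measure) = 1 - c" if "0 \<le> c" "c \<le> 1" for c
    using unit_integral_FTC[OF that, of "\<lambda>x. x" "\<lambda>x. 1"] by (auto intro!: derivative_eq_intros)
  have id: "(\<integral>y. of_bool (c < y) * y \<partial>unit_measure) = 1 / 2 - c\<^sup>2 / 2" if "0 \<le> c" "c \<le> 1" for c
    by (subst unit_integral_FTC[OF that, of "\<lambda>x. x\<^sup>2 / 2"]) (auto intro!: derivative_eq_intros)
  have lin: "(\<integral>y. of_bool (c < y) * (1 - 2 * y) \<partial>unit_measure) = c\<^sup>2 - c" if "0 \<le> c" "c \<le> 1" for c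
    by (subst unit_integral_FTC[OF that, of "\<lambda>x. x - x\<^sup>2"]) (auto intro!: derivative_eq_intros continuous_intros)
  have pos: "(\<integral>y. p y \<partial>unit_measure) = (\<integral>y. of_bool (0 < y) * p y \<partial>unit_measure)" if "p 0 = 0" for p :: "real \<Rightarrow> real"
    by (intro Bochner_Integration.integral_cong refl) (use that in \<open>auto simp: space_restrict_space\<close>)
  have id0: "(\<integral>y. y \<partial>unit_measure) = 1 / 2"
    by (subst pos, simp, subst unit_integral_FTC[of 0 "\<lambda>x. x\<^sup>2 / 2"]) (auto intro!: derivative_eq_intros)
  have sq0: "(\<integral>y. y * y \<partial>unit_measure) = 1 / 3"
    by (subst pos, simp, subst unit_integral_FTC[of 0 "\<lambda>x. x ^ 3 / 3"])
       (auto intro!: derivative_eq_intros continuous_intros simp: power2_eq_square)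
  have lin0: "(\<integral>y. y * (1 - 2 * y) \<partial>unit_measure) = - 1 / 6"
    by (subst pos, simp, subst unit_integral_FTC[of 0 "\<lambda>x. x\<^sup>2 / 2 - 2 * x ^ 3 / 3"])
       (auto intro!: derivative_eq_intros continuous_intros simp: power2_eq_square algebra_simps)
  have both: "(\<integral>y. of_bool (r < y) * of_bool (s < y) \<partial>unit_measure) = 1 - max r s"
    if "0 \<le> r" "0 \<le> s" "r \<le> 1" "s \<le> 1" for r s
  proof -
    have "of_bool (r < y) * of_bool (s < y) = (of_bool (max r s < y) :: real)" for y
      by auto
    then have "(\<integral>y. of_bool (r < y) * of_bool (s < y) \<partial>unit_measure) = (\<integral>y. (of_bool (max r s < y) :: real) \<partial>unit_measure)"
      by (simp only:)
    also have "\<dots> = 1 - max r s"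
      by (rule one) (use that in auto)
    finally show ?thesis .
  qed
  have "(\<integral>x. \<integral>y. box_factor z x y * box_factor z' x y \<partial>unit_measure \<partial>unit_measure)
    = 2 * (\<integral>y. corner z y * corner z' y \<partial>unit_measure)
      - 2 * ((\<integral>y. corner z y \<partial>unit_measure) * (\<integral>y. corner z' y \<partial>unit_measure))
      + (\<integral>y. corner z y * (1 - 2 * y) \<partial>unit_measure) + (\<integral>y. corner z' y * (1 - 2 * y) \<partial>unit_measure) + 1 / 2"
    unfolding box_factor_def
    by (rule square_integral_of_differences[OF corner_measurable corner_measurable]) (auto simp: corner_def split: option.splits)
  also have "\<dots> = (case (z, z') of (Some r, Some s) \<Rightarrow> periodic_kernel r s | _ \<Rightarrow> 1 / 3)"
  proof (cases z; cases z')
    fix r s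
    assume "z = Some r" "z' = Some s"
    moreover from this have "0 \<le> r" "r \<le> 1" "0 \<le> s" "s \<le> 1"
      using assms by force+
    ultimately show ?thesis
      by (simp only: corner_def option.case prod.case one lin both)
         (auto simp: periodic_kernel_def max_def power2_eq_square algebra_simps)
  next
    fix r
    assume "z = Some r" "z' = None"
    moreover from this have "0 \<le> r" "r \<le> 1"
      using assms by force+
    ultimately show ?thesis
      by (simp only: corner_def option.case prod.case one lin id id0 lin0)
         (simp add: power2_eq_square field_simps)
  next
    fix r
    assume "z = None" "z' = Some r"
    moreover from this have "0 \<le> r" "r \<le> 1"
      using assms by force+
    ultimately show ?thesis
      by (simp only: corner_def option.case prod.case one lin id mult.commute[of _ "of_bool _"] id0 lin0)
         (simp add: power2_eq_square field_simps)
  next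
    assume "z = None" "z' = None"
    then show ?thesis
      by (simp add: corner_def id0 sq0 lin0)
  qed
  finally show ?thesis .
qed

lemma indicator_per_interval:
  assumes "0 \<le> z" "z < 1"
  shows "indicator (per_interval x y) z = box_factor (Some z) x y"
  using assms by (auto simp: per_interval_def box_factor_def corner_def indicator_def)

lemma measure_per_box:
  fixes x y :: "real ^ 'd::finite"
  assumes "x \<in> cbox 0 1" "y \<in> cbox 0 1"
  shows "measure lborel (per_box x y) = (\<Prod>j\<in>UNIV. box_factor None (x $ j) (y $ j))"
proof -
  have mi: "per_interval s t \<in> sets borel" for s t
    by (auto simp: per_interval_def)
  have fin: "emeasure lborel (per_interval s t) < \<infinity>" for s t
  proof (rule le_less_trans)
    show "emeasure lborel (per_interval s t) \<le> emeasure lborel (cbox (min s 0) (max t 1))"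
      by (intro emeasure_mono) (auto simp: per_interval_def)
  qed (simp add: emeasure_lborel_cbox_eq)
  have len: "measure lborel (per_interval s t) = box_factor None s t" if "0 \<le> s" "s \<le> 1" "0 \<le> t" "t \<le> 1" for s t
  proof (cases "s \<le> t")
    case False
    then have "measure lborel ({0..<t} \<union> {s..<1}) = measure lborel {0..<t} + measure lborel {s..<1}"
      using that by (intro measure_Union) auto
    with False that show ?thesis
      by (simp add: per_interval_def box_factor_def corner_def)
  qed (simp add: per_interval_def box_factor_def corner_def)
  have ind: "indicator (per_box x y) z = (\<Prod>j\<in>UNIV. indicator (per_interval (x $ j) (y $ j)) (z $ j) :: real)" for z
  proof (cases "z \<in> per_box x y")
    case False
    then obtain j where "z $ j \<notin> per_interval (x $ j) (y $ j)"
      by (auto simp: per_box_def)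
    then have "(\<Prod>j\<in>UNIV. indicator (per_interval (x $ j) (y $ j)) (z $ j) :: real) = 0"
      by (intro prod_zero bexI[of _ j]) auto
    then show ?thesis
      using False by simp
  qed (simp add: per_box_def)
  have "measure lborel (per_box x y) = (\<integral>z. indicator (per_box x y) z \<partial>lborel)"
    by simp
  also have "\<dots> = (\<Prod>j\<in>UNIV. measure lborel (per_interval (x $ j) (y $ j)))"
    unfolding ind by (subst lborel_integral_prod_components) (use mi fin in auto)
  also have "\<dots> = (\<Prod>j\<in>UNIV. box_factor None (x $ j) (y $ j))"
    using assms by (intro prod.cong refl len) (auto simp: mem_box_cart)
  finally show ?thesis .
qed

lemma count_per_box:
  fixes X :: "nat \<Rightarrow> real ^ 'd::finite"
  assumes X: "\<And>n j. X n $ j \<in> {0..<1}"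
  shows "real (card {n. n < N \<and> X n \<in> per_box x y}) = (\<Sum>n<N. \<Prod>j\<in>UNIV. box_factor (Some (X n $ j)) (x $ j) (y $ j))"
proof -
  have "(\<Prod>j\<in>UNIV. box_factor (Some (X n $ j)) (x $ j) (y $ j)) = of_bool (X n \<in> per_box x y)" for n
  proof (cases "X n \<in> per_box x y")
    case False
    then obtain j where "X n $ j \<notin> per_interval (x $ j) (y $ j)"
      by (auto simp: per_box_def)
    then have "box_factor (Some (X n $ j)) (x $ j) (y $ j) = 0"
      using X[of n j] by (simp add: indicator_per_interval[symmetric])
    then show ?thesis
      using False by auto
  next
    case True
    then have "box_factor (Some (X n $ j)) (x $ j) (y $ j) = 1" for j
      using X[of n j] by (simp add: indicator_per_interval[symmetric] per_box_def)
    with True show ?thesis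
      by simp
  qed
  then show ?thesis
    by (simp add: of_bool_def sum.If_cases Int_def)
qed

text \<open>
  The local discrepancy is the integral of the box indicator against the signed measure with mass
  \<open>1\<close> at each point and density \<open>-N\<close>. Its square is a double sum over pairs of parts of this
  measure, and each pair integrates to a product over the coordinates. The mixed and pure volume
  terms combine to \<open>- N\<^sup>2 / 3\<^sup>d\<close>.
\<close>

theorem discrepancy_kernel_formula:
  fixes X :: "nat \<Rightarrow> real ^ 'd::finite"
  assumes X: "\<And>n j. X n $ j \<in> {0..<1}" and N: "0 < N"
  shows "(real N * per_L2_discrepancy X N)\<^sup>2
    = (\<Sum>n<N. \<Sum>m<N. \<Prod>j\<in>UNIV. periodic_kernel (X n $ j) (X m $ j)) - (real N)\<^sup>2 / 3 ^ CARD('d)"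
proof -
  \<comment> \<open>Indices below N stand for the points, index N for the volume part with weight -N.\<close>
  define z where "z i j = (if i < N then Some (X i $ j) else None)" for i j
  define wt where "wt i = (if i < N then 1 else - real N)" for i
  define \<phi> where "\<phi> i k j x y = box_factor (z i j) x y * box_factor (z k j) x y" for i k j x y
  let ?S = "cbox 0 1 \<times> cbox 0 1 :: ((real ^ 'd) \<times> (real ^ 'd)) set"
  have local: "\<bar>real (card {n. n < N \<and> X n \<in> per_box x y}) / real N - measure lborel (per_box x y)\<bar>\<^sup>2
      = (\<Sum>i\<le>N. \<Sum>k\<le>N. wt i * wt k * (\<Prod>j\<in>UNIV. \<phi> i k j (x $ j) (y $ j))) / (real N)\<^sup>2"
    if "(x, y) \<in> ?S" for x y
  proof -
    let ?F = "\<lambda>i. \<Prod>j\<in>UNIV. box_factor (z i j) (x $ j) (y $ j)"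
    have "(\<Sum>i\<le>N. wt i * ?F i) = real (card {n. n < N \<and> X n \<in> per_box x y}) - real N * measure lborel (per_box x y)"
      using that unfolding lessThan_Suc_atMost[symmetric]
      by (simp add: count_per_box[OF X] measure_per_box z_def wt_def)
    moreover have "(\<Sum>i\<le>N. wt i * ?F i)\<^sup>2 = (\<Sum>i\<le>N. \<Sum>k\<le>N. wt i * wt k * (\<Prod>j\<in>UNIV. \<phi> i k j (x $ j) (y $ j)))"
      unfolding power2_eq_square sum_product \<phi>_def prod.distrib by (intro sum.cong refl) simp
    moreover have "\<bar>a / real N - b\<bar>\<^sup>2 = (a - real N * b)\<^sup>2 / (real N)\<^sup>2" for a b
      using N by (simp add: power_divide[symmetric] diff_divide_distrib)
    ultimately show ?thesis
      by (simp only:)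
  qed
  have \<phi>_meas: "(\<lambda>p. \<phi> i k j (fst p) (snd p)) \<in> borel_measurable borel" for i k j
    unfolding \<phi>_def box_factor_def borel_prod[symmetric] by measurable
  have bf: "\<bar>box_factor (z i j) x y\<bar> \<le> 1" if "x \<in> {0..1}" "y \<in> {0..1}" for i j x y
  proof (cases "i < N")
    case True
    then show ?thesis
      using X[of i j] by (simp add: z_def indicator_per_interval[symmetric])
  next
    case False
    then show ?thesis
      using that by (auto simp: z_def box_factor_def corner_def)
  qed
  have \<phi>_bdd: "\<bar>\<phi> i k j x y\<bar> \<le> 1" if "x \<in> {0..1}" "y \<in> {0..1}" for i k j x y
    unfolding \<phi>_def abs_mult by (intro mult_le_one bf that abs_ge_zero)
  have pairs: "set_integrable lborel ?S (\<lambda>(x, y). \<Prod>j\<in>UNIV. \<phi> i k j (x $ j) (y $ j))"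
    "(LINT (x, y) : ?S | lborel. \<Prod>j\<in>UNIV. \<phi> i k j (x $ j) (y $ j))
       = (\<Prod>j\<in>UNIV. \<integral>x. \<integral>y. \<phi> i k j x y \<partial>unit_measure \<partial>unit_measure)" for i k
    by (rule square_integral_prod(1)[of "\<phi> i k", OF \<phi>_meas \<phi>_bdd], assumption+)
       (rule square_integral_prod(2)[of "\<phi> i k", OF \<phi>_meas \<phi>_bdd], assumption+)
  define J where "J i k = (\<Prod>j\<in>UNIV. \<integral>x. \<integral>y. \<phi> i k j x y \<partial>unit_measure \<partial>unit_measure)" for i k
  have J: "J i k = (if i < N \<and> k < N then \<Prod>j\<in>UNIV. periodic_kernel (X i $ j) (X k $ j) else 1 / 3 ^ CARD('d))" for i k
  proof -
    have "(\<integral>x. \<integral>y. \<phi> i k j x y \<partial>unit_measure \<partial>unit_measure)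
        = (if i < N \<and> k < N then periodic_kernel (X i $ j) (X k $ j) else 1 / 3)" for j
      unfolding \<phi>_def using X[of i j] X[of k j]
      by (subst box_factor_integral) (auto simp: z_def split: if_splits)
    then show ?thesis
      unfolding J_def by (cases "i < N \<and> k < N") (simp_all only: if_True if_False, simp_all add: power_one_over)
  qed
  define T where "T ik p = wt (fst ik) * wt (snd ik) * (\<Prod>j\<in>UNIV. \<phi> (fst ik) (snd ik) j (fst p $ j) (snd p $ j))"
    for ik :: "nat \<times> nat" and p :: "(real ^ 'd) \<times> (real ^ 'd)"
  let ?I = "LINT (x, y) : ?S | lborel.
       \<bar>real (card {n. n < N \<and> X n \<in> per_box x y}) / real N - measure lborel (per_box x y)\<bar>\<^sup>2"
  have "?I = (LINT p : ?S | lborel. (\<Sum>ik\<in>{..N} \<times> {..N}. T ik p) / (real N)\<^sup>2)"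
    unfolding set_lebesgue_integral_def
  proof (intro Bochner_Integration.integral_cong refl)
    fix p :: "(real ^ 'd) \<times> (real ^ 'd)"
    show "indicator ?S p *\<^sub>R (case p of (x, y) \<Rightarrow>
       \<bar>real (card {n. n < N \<and> X n \<in> per_box x y}) / real N - measure lborel (per_box x y)\<bar>\<^sup>2)
       = indicator ?S p *\<^sub>R ((\<Sum>ik\<in>{..N} \<times> {..N}. T ik p) / (real N)\<^sup>2)"
      using local[of "fst p" "snd p"]
      by (cases "p \<in> ?S") (simp_all add: T_def sum.cartesian_product case_prod_beta)
  qed
  also have "\<dots> = (\<Sum>ik\<in>{..N} \<times> {..N}. LINT p : ?S | lborel. T ik p) / (real N)\<^sup>2"
  proof -
    have "set_integrable lborel ?S (T ik)" for ik
      using set_integrable_mult_right[OF pairs(1)[of "fst ik" "snd ik"], of "wt (fst ik) * wt (snd ik)"]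
      unfolding T_def case_prod_beta .
    moreover have "indicator ?S p *\<^sub>R ((\<Sum>ik\<in>{..N} \<times> {..N}. T ik p) / (real N)\<^sup>2)
        = (\<Sum>ik\<in>{..N} \<times> {..N}. indicator ?S p *\<^sub>R T ik p) / (real N)\<^sup>2" for p
      by (simp only: sum_distrib_left real_scaleR_def times_divide_eq_right)
    ultimately show ?thesis
      unfolding set_integrable_def set_lebesgue_integral_def
      by (simp only: integral_divide_zero Bochner_Integration.integral_sum)
  qed
  also have "(\<lambda>ik. LINT p : ?S | lborel. T ik p) = (\<lambda>(i, k). wt i * wt k * J i k)"
  proof
    fix ik :: "nat \<times> nat"
    have "(LINT p : ?S | lborel. T ik p) = wt (fst ik) * wt (snd ik) * (LINT (x, y) : ?S | lborel. \<Prod>j\<in>UNIV. \<phi> (fst ik) (snd ik) j (x $ j) (y $ j))"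
      unfolding T_def case_prod_beta by simp
    then show "(LINT p : ?S | lborel. T ik p) = (case ik of (i, k) \<Rightarrow> wt i * wt k * J i k)"
      by (simp add: pairs(2) J_def case_prod_beta)
  qed
  also have "(\<Sum>(i, k)\<in>{..N} \<times> {..N}. wt i * wt k * J i k) = (\<Sum>i\<le>N. \<Sum>k\<le>N. wt i * wt k * J i k)"
    by (simp add: sum.cartesian_product)
  also have "\<dots> = (\<Sum>n<N. \<Sum>m<N. \<Prod>j\<in>UNIV. periodic_kernel (X n $ j) (X m $ j)) - (real N)\<^sup>2 / 3 ^ CARD('d)"
    unfolding lessThan_Suc_atMost[symmetric] by (simp add: wt_def J sum.distrib sum_subtractf power2_eq_square)
  finally have I: "?I = ((\<Sum>n<N. \<Sum>m<N. \<Prod>j\<in>UNIV. periodic_kernel (X n $ j) (X m $ j)) - (real N)\<^sup>2 / 3 ^ CARD('d)) / (real N)\<^sup>2" .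
  have "0 \<le> ?I"
    unfolding set_lebesgue_integral_def by (intro integral_nonneg_AE AE_I2) (auto split: prod.splits)
  then have "(per_L2_discrepancy X N)\<^sup>2 = ?I"
    unfolding per_L2_discrepancy_def by simp
  then show ?thesis
    using N unfolding I power_mult_distrib by simp
qed

section \<open>The discrepancy as the energy of hat sums\<close>

definition hat_sum :: "(nat \<Rightarrow> real ^ 'd) \<Rightarrow> 'd set \<Rightarrow> nat \<Rightarrow> ('d \<Rightarrow> nat \<times> nat) \<Rightarrow> real" where
  "hat_sum X v N I = (\<Sum>n<N. \<Prod>j\<in>v. centred_hat (I j) (X n $ j))"

definition level :: "'d set \<Rightarrow> ('d \<Rightarrow> nat \<times> nat) \<Rightarrow> nat" where
  "level v I = (\<Sum>j\<in>v. fst (I j))"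

definition energy :: "(nat \<Rightarrow> real ^ 'd) \<Rightarrow> nat \<Rightarrow> nat \<Rightarrow> 'd set \<Rightarrow> real" where
  "energy X N A v = (\<Sum>I\<in>PiE v (\<lambda>_. dyadic A). 2 ^ level v I * (hat_sum X v N I)\<^sup>2)"

text \<open>
  The coefficients are those in the expansion of \<open>\<Prod>\<^sub>j (1/3 + 2 k\<^sub>j)\<close>, without the constant
  term.
\<close>

definition total_energy :: "(nat \<Rightarrow> real ^ 'd::finite) \<Rightarrow> nat \<Rightarrow> nat \<Rightarrow> real" where
  "total_energy X N A = (\<Sum>v\<in>Pow UNIV - {{}}. 2 ^ card v * (1 / 3) ^ card (UNIV - v) * energy X N A v)"

lemma energy_nonneg: "0 \<le> energy X N A v"
  unfolding energy_def by (intro sum_nonneg) simp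

lemma power_level: "c ^ level v I = (\<Prod>j\<in>v. c ^ fst (I j))" for c :: "'a::comm_semiring_1"
  by (simp add: level_def power_sum)

lemma sum_square_eq: "(\<Sum>n\<in>B. f n)\<^sup>2 = (\<Sum>n\<in>B. \<Sum>m\<in>B. f n * f m)" for f :: "'a \<Rightarrow> real"
  by (simp add: power2_eq_square sum_product)

text \<open>
  Opening the square and summing over all boxes at once factorises over the coordinates; this
  passage between box sums and kernels is used in both directions.
\<close>

lemma energy_kernel:
  fixes X :: "nat \<Rightarrow> real ^ 'd::finite"
  shows "energy X N A v = (\<Sum>n<N. \<Sum>m<N. \<Prod>j\<in>v. kernel_part A (X n $ j) (X m $ j))"
proof -
  have "energy X N A v = (\<Sum>I\<in>PiE v (\<lambda>_. dyadic A). \<Sum>n<N. \<Sum>m<N.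
      \<Prod>j\<in>v. 2 ^ fst (I j) * (centred_hat (I j) (X n $ j) * centred_hat (I j) (X m $ j)))"
    unfolding energy_def hat_sum_def sum_square_eq power_level prod.distrib by (simp add: sum_distrib_left)
  also have "\<dots> = (\<Sum>n<N. \<Sum>m<N. \<Sum>I\<in>PiE v (\<lambda>_. dyadic A).
      \<Prod>j\<in>v. 2 ^ fst (I j) * (centred_hat (I j) (X n $ j) * centred_hat (I j) (X m $ j)))"
    by (subst sum.swap, intro sum.cong refl, subst sum.swap, rule refl)
  also have "\<dots> = (\<Sum>n<N. \<Sum>m<N. \<Prod>j\<in>v. kernel_part A (X n $ j) (X m $ j))"
    unfolding kernel_part_def by (subst prod_sum_PiE) simp_all
  finally show ?thesis .
qed

text \<open>
  The subset \<open>v\<close> records in which coordinates the nonconstant part of the kernel is chosen. The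
  empty subset contributes \<open>N\<^sup>2 / 3\<^sup>d\<close>, exactly the term subtracted in the discrepancy
  formula.
\<close>

lemma total_energy_kernel:
  fixes X :: "nat \<Rightarrow> real ^ 'd::finite"
  shows "total_energy X N A = (\<Sum>n<N. \<Sum>m<N. \<Prod>j\<in>UNIV. (1 / 3 + 2 * kernel_part A (X n $ j) (X m $ j)))
      - (real N)\<^sup>2 / 3 ^ CARD('d)"
proof -
  let ?f = "\<lambda>v n m. (\<Prod>j\<in>v. 2 * kernel_part A (X n $ j) (X m $ j)) * (\<Prod>j\<in>UNIV - v. 1 / 3)"
  have "(\<Sum>n<N. \<Sum>m<N. \<Prod>j\<in>UNIV. (1 / 3 + 2 * kernel_part A (X n $ j) (X m $ j)))
      = (\<Sum>n<N. \<Sum>m<N. \<Sum>v\<in>Pow UNIV. ?f v n m)"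
    unfolding add.commute[of "1 / 3 :: real"] by (subst prod_add) simp_all
  also have "\<dots> = (\<Sum>v\<in>Pow UNIV. \<Sum>n<N. \<Sum>m<N. ?f v n m)"
    by (subst (2) sum.swap, subst sum.swap, rule refl)
  also have "\<dots> = (\<Sum>v\<in>Pow UNIV. 2 ^ card v * (1 / 3) ^ card (UNIV - v) * energy X N A v)"
    unfolding energy_kernel by (simp add: prod.distrib sum_distrib_left mult_ac)
  also have "\<dots> = (1 / 3) ^ CARD('d) * energy X N A {} + total_energy X N A"
    unfolding total_energy_def by (subst sum.remove[of _ "{}"]) simp_all
  also have "energy X N A {} = (real N)\<^sup>2"
    unfolding energy_kernel by (simp add: power2_eq_square)
  finally show ?thesis
    by (simp add: power_one_over field_simps)
qed

lemma total_energy_tendsto: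
  fixes X :: "nat \<Rightarrow> real ^ 'd::finite"
  assumes X: "\<And>n j. X n $ j \<in> {0..<1}" and N: "0 < N"
  shows "total_energy X N \<longlonglongrightarrow> (real N * per_L2_discrepancy X N)\<^sup>2"
proof -
  have "(\<lambda>A. total_energy X N A) \<longlonglongrightarrow> (\<Sum>n<N. \<Sum>m<N. \<Prod>j\<in>UNIV. periodic_kernel (X n $ j) (X m $ j)) - (real N)\<^sup>2 / 3 ^ CARD('d)"
    unfolding total_energy_kernel
    by (intro tendsto_diff tendsto_sum tendsto_prod tendsto_const kernel_part_tendsto) (use X in auto)
  then show ?thesis
    unfolding discrepancy_kernel_formula[OF assms] .
qed

lemma energy_mono:
  fixes X :: "nat \<Rightarrow> real ^ 'd::finite"
  assumes "A \<le> B"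
  shows "energy X N A v \<le> energy X N B v"
proof -
  have "dyadic A \<subseteq> dyadic B"
    using assms by (auto simp: dyadic_def)
  then show ?thesis
    unfolding energy_def by (intro sum_mono2 PiE_mono finite_PiE) auto
qed

text \<open>
  The energies increase with the resolution \<open>A\<close>, hence each of them is below the limit.
\<close>

lemma total_energy_le_discrepancy:
  fixes X :: "nat \<Rightarrow> real ^ 'd::finite"
  assumes "\<And>n j. X n $ j \<in> {0..<1}" "0 < N"
  shows "total_energy X N A \<le> (real N * per_L2_discrepancy X N)\<^sup>2"
proof (rule LIMSEQ_le_const[OF total_energy_tendsto[OF assms]])
  show "\<exists>B. \<forall>n\<ge>B. total_energy X N A \<le> total_energy X N n"
    unfolding total_energy_def by (intro exI[of _ A] allI impI sum_mono mult_left_mono energy_mono) auto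
qed

lemma discrepancy_le_if_total_energy_le:
  fixes X :: "nat \<Rightarrow> real ^ 'd::finite"
  assumes "\<And>n j. X n $ j \<in> {0..<1}" "0 < N" "\<And>A. total_energy X N A \<le> C"
  shows "(real N * per_L2_discrepancy X N)\<^sup>2 \<le> C"
  by (rule LIMSEQ_le_const2[OF total_energy_tendsto[OF assms(1,2)]]) (use assms(3) in auto)

lemma discrepancy_trivial_bound:
  fixes X :: "nat \<Rightarrow> real ^ 'd::finite"
  assumes X: "\<And>n j. X n $ j \<in> {0..<1}" and "0 < N"
  shows "(real N * per_L2_discrepancy X N)\<^sup>2 \<le> (real N)\<^sup>2"
proof -
  have k: "\<bar>periodic_kernel x y\<bar> \<le> 1" if "0 \<le> x" "x < 1" "0 \<le> y" "y < 1" for x y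
  proof -
    have "0 \<le> \<bar>x - y\<bar> * (1 - \<bar>x - y\<bar>)" "\<bar>x - y\<bar> * (1 - \<bar>x - y\<bar>) \<le> 1"
      using that by (auto intro!: mult_nonneg_nonneg mult_le_one)
    moreover have "periodic_kernel x y = 1 / 2 - \<bar>x - y\<bar> * (1 - \<bar>x - y\<bar>)"
      by (simp add: periodic_kernel_def power2_eq_square algebra_simps abs_mult[symmetric])
    ultimately show ?thesis
      by linarith
  qed
  have "(\<Prod>j\<in>UNIV. periodic_kernel (X n $ j) (X m $ j)) \<le> 1" for n m
  proof -
    have "\<bar>\<Prod>j\<in>UNIV. periodic_kernel (X n $ j) (X m $ j)\<bar> \<le> 1"
      unfolding abs_prod using X by (intro prod_le_1 conjI abs_ge_zero k) auto
    then show ?thesis by linarith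
  qed
  then have "(\<Sum>n<N. \<Sum>m<N. \<Prod>j\<in>UNIV. periodic_kernel (X n $ j) (X m $ j)) \<le> (\<Sum>n<N. \<Sum>m<N. 1)"
    by (intro sum_mono)
  also have "\<dots> = (real N)\<^sup>2"
    by (simp add: power2_eq_square)
  finally show ?thesis
    unfolding discrepancy_kernel_formula[OF assms]
    by (smt (verit) divide_nonneg_nonneg zero_le_power zero_le_power2)
qed

section \<open>Lower bound for arbitrary sequences\<close>

text \<open>
  The integration error, multiplied by \<open>N\<close>, of the hat over a dyadic box. In contrast to
  the centred hats, a hat over a box vanishes at all points outside the box.
\<close>

definition hat_defect :: "(nat \<Rightarrow> real ^ 'd::finite) \<Rightarrow> ('d \<Rightarrow> nat \<times> nat) \<Rightarrow> nat \<Rightarrow> real" where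
  "hat_defect X I N = (\<Sum>n<N. \<Prod>j\<in>UNIV. hat (I j) (X n $ j)) - real N * (\<Prod>j\<in>UNIV. 1 / 4 ^ (fst (I j) + 1))"

text \<open>
  A hat is its mean minus the centred hat. Expanding the product over the coordinates, the error is
  a sum over the nonempty sets \<open>v\<close> of hat sums over \<open>v\<close>, weighted by the means in the other
  coordinates. The means are square summable with the weights \<open>2\<^sup>a\<close>, with total at most \<open>1/12\<close>,
  so the Cauchy--Schwarz inequality over the at most \<open>2\<^sup>d\<close> sets \<open>v\<close> suffices.
\<close>

lemma hat_defect_energy:
  fixes X :: "nat \<Rightarrow> real ^ 'd::finite"
  shows "(\<Sum>I\<in>PiE UNIV (\<lambda>_. dyadic A). 2 ^ level UNIV I * (hat_defect X I N)\<^sup>2) \<le> 2 ^ CARD('d) * total_energy X N A"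
proof -
  let ?D = "PiE (UNIV :: 'd set) (\<lambda>_. dyadic A)"
  define u :: "nat \<times> nat \<Rightarrow> real" where "u i = 1 / 4 ^ (fst i + 1)" for i
  define Y where "Y v I = (\<Prod>j\<in>UNIV - v. u (I j)) * ((- 1) ^ card v * hat_sum X v N I)" for v and I :: "'d \<Rightarrow> nat \<times> nat"
  have defect: "hat_defect X I N = (\<Sum>v\<in>Pow UNIV - {{}}. Y v I)" for I
  proof -
    have "(\<Prod>j\<in>UNIV. hat (I j) (X n $ j)) = (\<Sum>v\<in>Pow UNIV. (\<Prod>j\<in>v. - centred_hat (I j) (X n $ j)) * (\<Prod>j\<in>UNIV - v. u (I j)))" for n
      by (subst prod_add[symmetric]) (simp_all add: u_def centred_hat_def)
    then have "(\<Sum>n<N. \<Prod>j\<in>UNIV. hat (I j) (X n $ j)) = (\<Sum>v\<in>Pow UNIV. \<Sum>n<N. (\<Prod>j\<in>v. - centred_hat (I j) (X n $ j)) * (\<Prod>j\<in>UNIV - v. u (I j)))"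
      by (simp only:) (rule sum.swap)
    also have "\<dots> = (\<Sum>v\<in>Pow UNIV. Y v I)"
      by (intro sum.cong refl) (simp add: Y_def hat_sum_def prod_uminus sum_distrib_left sum_distrib_right mult_ac)
    also have "\<dots> = Y {} I + (\<Sum>v\<in>Pow UNIV - {{}}. Y v I)"
      by (rule sum.remove) auto
    also have "Y {} I = real N * (\<Prod>j\<in>UNIV. u (I j))"
      by (simp add: Y_def hat_sum_def)
    finally show ?thesis
      by (simp add: hat_defect_def u_def)
  qed
  \<comment> \<open>The squared means of the hats, summed over one coordinate with the weights of the energy.\<close>
  define c where "c = (\<Sum>i\<in>dyadic A. 2 ^ fst i * (u i)\<^sup>2)"
  have c: "0 \<le> c" "c \<le> 1 / 3"
  proof -
    show "0 \<le> c"
      unfolding c_def by (intro sum_nonneg) simp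
    have "c = (\<Sum>a<A. (1 / 4) ^ a / 16)"
      unfolding c_def sum_dyadic u_def
    proof (rule sum.cong)
      fix a
      have "(4::real) ^ a = 2 ^ a * 2 ^ a"
        by (simp add: power_mult_distrib[symmetric])
      then show "(\<Sum>b<2 ^ a. 2 ^ fst (a, b :: nat) * (1 / 4 ^ (fst (a, b) + 1))\<^sup>2) = (1 / 4) ^ a / (16 :: real)"
        by (simp add: power2_eq_square power_one_over)
    qed simp
    also have "\<dots> = (1 - (1 / 4) ^ A) / 12"
      by (induction A) (simp_all add: divide_simps)
    also have "\<dots> \<le> 1 / 3"
    proof -
      have le: "(1 - x) / 12 \<le> 1 / 3" if "0 \<le> x" for x :: real
        using that by simp
      show ?thesis
        by (rule le) simp
    qed
    finally show "c \<le> 1 / 3" .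
  qed
  have Y: "(\<Sum>I\<in>?D. 2 ^ level UNIV I * (Y v I)\<^sup>2) = c ^ card (UNIV - v) * energy X N A v" for v
  proof -
    have square: "2 ^ level UNIV I * (Y v I)\<^sup>2 = (\<Sum>n<N. \<Sum>m<N. \<Prod>j\<in>UNIV.
        (if j \<in> v then 2 ^ fst (I j) * (centred_hat (I j) (X n $ j) * centred_hat (I j) (X m $ j)) else 2 ^ fst (I j) * (u (I j))\<^sup>2))" for I
    proof -
      have split: "(\<Prod>j\<in>UNIV. if j \<in> v then p j else q j) = (\<Prod>j\<in>UNIV - v. q j) * (\<Prod>j\<in>v. p j)" for p q :: "'d \<Rightarrow> real"
        by (subst prod.If_cases) (simp_all add: Compl_eq_Diff_UNIV mult.commute)
      have "level UNIV I = level (UNIV - v) I + level v I"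
        unfolding level_def by (rule sum.subset_diff) simp_all
      moreover have "(Y v I)\<^sup>2 = (\<Prod>j\<in>UNIV - v. u (I j))\<^sup>2 * (hat_sum X v N I)\<^sup>2"
        by (simp add: Y_def power_mult_distrib power2_eq_square[of "(- 1) ^ _"] minus_one_mult_self)
      ultimately have "2 ^ level UNIV I * (Y v I)\<^sup>2 = (2 ^ level (UNIV - v) I * (\<Prod>j\<in>UNIV - v. u (I j))\<^sup>2) * (2 ^ level v I * (hat_sum X v N I)\<^sup>2)"
        by (simp only: power_add mult_ac)
      also have "2 ^ level (UNIV - v) I * (\<Prod>j\<in>UNIV - v. u (I j))\<^sup>2 = (\<Prod>j\<in>UNIV - v. 2 ^ fst (I j) * (u (I j))\<^sup>2)"
        by (simp add: power_level prod.distrib prod_power_distrib)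
      also have "2 ^ level v I * (hat_sum X v N I)\<^sup>2 = (\<Sum>n<N. \<Sum>m<N. \<Prod>j\<in>v. 2 ^ fst (I j) * (centred_hat (I j) (X n $ j) * centred_hat (I j) (X m $ j)))"
        unfolding hat_sum_def sum_square_eq power_level prod.distrib by (simp add: sum_distrib_left)
      finally show ?thesis
        unfolding split by (simp add: sum_distrib_left)
    qed
    have "(\<Sum>I\<in>?D. 2 ^ level UNIV I * (Y v I)\<^sup>2) = (\<Sum>n<N. \<Sum>m<N. \<Sum>I\<in>?D. \<Prod>j\<in>UNIV.
        (if j \<in> v then 2 ^ fst (I j) * (centred_hat (I j) (X n $ j) * centred_hat (I j) (X m $ j)) else 2 ^ fst (I j) * (u (I j))\<^sup>2))"
      unfolding square by (subst sum.swap, intro sum.cong refl, subst sum.swap, rule refl)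
    also have "\<dots> = (\<Sum>n<N. \<Sum>m<N. \<Prod>j\<in>UNIV. if j \<in> v then kernel_part A (X n $ j) (X m $ j) else c)"
      unfolding kernel_part_def c_def
      by (subst prod_sum_PiE[symmetric], simp, simp, intro sum.cong prod.cong refl) (auto intro: sum.cong)
    also have "\<dots> = (\<Sum>n<N. \<Sum>m<N. c ^ card (UNIV - v) * (\<Prod>j\<in>v. kernel_part A (X n $ j) (X m $ j)))"
      by (subst prod.If_cases) (simp_all add: Compl_eq_Diff_UNIV mult.commute)
    finally show ?thesis
      unfolding energy_kernel by (simp add: sum_distrib_left)
  qed
  have "(\<Sum>I\<in>?D. 2 ^ level UNIV I * (hat_defect X I N)\<^sup>2)
      \<le> (\<Sum>I\<in>?D. \<Sum>v\<in>Pow UNIV - {{}}. 2 ^ CARD('d) * (2 ^ level UNIV I * (Y v I)\<^sup>2))"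
  proof (intro sum_mono)
    fix I
    have "(hat_defect X I N)\<^sup>2 \<le> real (card (Pow (UNIV :: 'd set) - {{}})) * (\<Sum>v\<in>Pow UNIV - {{}}. (Y v I)\<^sup>2)"
      unfolding defect using sum_squared_le_sum_of_squares[of "\<lambda>v. Y v I" "Pow (UNIV :: 'd set) - {{}}"] by (simp add: mult.commute)
    also have "\<dots> \<le> 2 ^ CARD('d) * (\<Sum>v\<in>Pow UNIV - {{}}. (Y v I)\<^sup>2)"
    proof (intro mult_right_mono sum_nonneg)
      have "card (Pow (UNIV :: 'd set) - {{}}) \<le> card (Pow (UNIV :: 'd set))"
        by (intro card_mono) auto
      then show "real (card (Pow (UNIV :: 'd set) - {{}})) \<le> 2 ^ CARD('d)"
        by (simp add: card_Pow)
    qed auto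
    finally have "2 ^ level UNIV I * (hat_defect X I N)\<^sup>2 \<le> 2 ^ level UNIV I * (2 ^ CARD('d) * (\<Sum>v\<in>Pow UNIV - {{}}. (Y v I)\<^sup>2))"
      by (intro mult_left_mono) auto
    then show "2 ^ level UNIV I * (hat_defect X I N)\<^sup>2 \<le> (\<Sum>v\<in>Pow UNIV - {{}}. 2 ^ CARD('d) * (2 ^ level UNIV I * (Y v I)\<^sup>2))"
      by (simp add: sum_distrib_left mult_ac)
  qed
  also have "\<dots> = (\<Sum>v\<in>Pow UNIV - {{}}. 2 ^ CARD('d) * (c ^ card (UNIV - v) * energy X N A v))"
    unfolding Y[symmetric] sum_distrib_left by (rule sum.swap)
  also have "\<dots> \<le> (\<Sum>v\<in>Pow UNIV - {{}}. 2 ^ CARD('d) * ((2 ^ card v * (1 / 3) ^ card (UNIV - v)) * energy X N A v))"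
  proof (intro sum_mono mult_left_mono mult_right_mono energy_nonneg)
    fix v :: "'d set"
    have "1 * c ^ card (UNIV - v) \<le> 2 ^ card v * (1 / 3) ^ card (UNIV - v)"
      using c by (intro mult_mono power_mono) auto
    then show "c ^ card (UNIV - v) \<le> 2 ^ card v * (1 / 3) ^ card (UNIV - v)"
      by simp
  qed simp
  finally show ?thesis
    unfolding total_energy_def by (simp add: sum_distrib_left)
qed

text \<open>
  A block of length \<open>2h\<close> in which no point hits the box sees \<open>D\<close> decrease by exactly \<open>u\<close> per step.
  Times at distance \<open>h\<close> then have values differing by \<open>h u\<close>, so one of them is large. A block
  that is hit \<open>r \<ge> 1\<close> times is estimated by \<open>1 - r \<le> 0\<close>; this keeps the bound linear in
  the number of hits, which makes the summation over the boxes an exact evaluation.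
\<close>

lemma drift_lower_bound:
  fixes T c :: "nat \<Rightarrow> real" and u :: real
  assumes c: "\<And>k. c k \<in> {0, 1}" and T: "\<And>k. c k = 0 \<Longrightarrow> T k = 0"
  defines "D \<equiv> \<lambda>N. (\<Sum>k<N. T k) - real N * u"
  shows "(real P - (\<Sum>k<P * (2 * h). c k)) * (real h * (real h * u)\<^sup>2 / 2) \<le> (\<Sum>N<P * (2 * h). (D N)\<^sup>2)"
proof -
  have block: "(1 - (\<Sum>k\<in>{b..<b + 2 * h}. c k)) * (real h * (real h * u)\<^sup>2 / 2)
      \<le> (\<Sum>N\<in>{b..<b + 2 * h}. (D N)\<^sup>2)" for b
  proof (cases "\<exists>k\<in>{b..<b + 2 * h}. c k = 1")
    case True
    then obtain k where k: "k \<in> {b..<b + 2 * h}" "c k = 1"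
      by blast
    have nn: "0 \<le> c k" for k
      using c[of k] by auto
    have "c k \<le> (\<Sum>k\<in>{b..<b + 2 * h}. c k)"
      by (rule member_le_sum) (use k nn in auto)
    then have "(1 - (\<Sum>k\<in>{b..<b + 2 * h}. c k)) * (real h * (real h * u)\<^sup>2 / 2) \<le> 0"
      using k by (intro mult_nonpos_nonneg) auto
    also have "0 \<le> (\<Sum>N\<in>{b..<b + 2 * h}. (D N)\<^sup>2)"
      by (intro sum_nonneg) auto
    finally show ?thesis .
  next
    case False
    have c0: "c k = 0" if "k \<in> {b..<b + 2 * h}" for k
      using c[of k] False that by auto
    have half: "(real h * u)\<^sup>2 / 2 \<le> (D (b + i))\<^sup>2 + (D (b + h + i))\<^sup>2" if "i < h" for i
    proof -
      have "(\<Sum>k<b + h + i. T k) = (\<Sum>k<b + i. T k) + (\<Sum>k\<in>{b + i..<b + h + i}. T k)"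
        unfolding lessThan_atLeast0 by (rule sum.atLeastLessThan_concat[symmetric]) simp_all
      moreover have "(\<Sum>k\<in>{b + i..<b + h + i}. T k) = 0"
        using that by (intro sum.neutral ballI T c0) auto
      ultimately have "D (b + i) - D (b + h + i) = real h * u"
        by (simp add: D_def algebra_simps)
      moreover have "(x - y)\<^sup>2 / 2 \<le> x\<^sup>2 + y\<^sup>2" for x y :: real
        using zero_le_power2[of "x + y"] by (simp add: power2_eq_square algebra_simps)
      ultimately show ?thesis
        by metis
    qed
    have split: "(\<Sum>N\<in>{b..<b + 2 * h}. f N) = (\<Sum>i<h. f (b + i) + f (b + h + i))" for f :: "nat \<Rightarrow> real"
    proof -
      have "(\<Sum>N\<in>{b..<b + 2 * h}. f N) = (\<Sum>N\<in>{b..<b + h}. f N) + (\<Sum>N\<in>{b + h..<b + 2 * h}. f N)"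
        by (rule sum.atLeastLessThan_concat[symmetric]) auto
      also have "(\<Sum>N\<in>{b..<b + h}. f N) = (\<Sum>i<h. f (b + i))"
        using sum.shift_bounds_nat_ivl[of f 0 b h] by (simp add: atLeast0LessThan add.commute)
      also have "(\<Sum>N\<in>{b + h..<b + 2 * h}. f N) = (\<Sum>i<h. f (b + h + i))"
        using sum.shift_bounds_nat_ivl[of f 0 "b + h" h] by (simp add: atLeast0LessThan add_ac mult_2)
      finally show ?thesis
        by (simp add: sum.distrib)
    qed
    have "real h * (real h * u)\<^sup>2 / 2 = (\<Sum>i<h. (real h * u)\<^sup>2 / 2)"
      by simp
    also have "\<dots> \<le> (\<Sum>N\<in>{b..<b + 2 * h}. (D N)\<^sup>2)"
      unfolding split by (intro sum_mono half) simp
    finally show ?thesis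
      using c0 by simp
  qed
  have "(real P - (\<Sum>k<P * (2 * h). c k)) * (real h * (real h * u)\<^sup>2 / 2)
     = (\<Sum>p<P. (1 - (\<Sum>k\<in>{p * (2 * h)..<p * (2 * h) + 2 * h}. c k)) * (real h * (real h * u)\<^sup>2 / 2))"
    unfolding sum.nat_group[symmetric, of c] sum_distrib_right[symmetric] by (simp add: sum_subtractf)
  also have "\<dots> \<le> (\<Sum>p<P. \<Sum>N\<in>{p * (2 * h)..<p * (2 * h) + 2 * h}. (D N)\<^sup>2)"
    by (intro sum_mono block)
  also have "\<dots> = (\<Sum>N<P * (2 * h). (D N)\<^sup>2)"
    by (rule sum.nat_group)
  finally show ?thesis .
qed

text \<open>
  The block length \<open>2h = 2\<^sup>l\<^sup>-\<^sup>1\<close> for a box of volume \<open>2\<^sup>-\<^sup>l\<close> is chosen such that the pairs of a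
  box of this shape and a block are twice as many as the \<open>2\<^sup>n\<close> points. With the weight \<open>2\<^sup>l\<close> the
  powers of \<open>2\<^sup>l\<close> cancel, and every shape counts with the same constant.
\<close>

lemma hat_defect_lower_bound:
  fixes X :: "nat \<Rightarrow> real ^ 'd::finite"
  assumes "2 \<le> level UNIV I" "level UNIV I \<le> n"
  shows "1 / (128 * 16 ^ CARD('d)) * (2 * 2 ^ n * (\<Prod>j\<in>UNIV. 1 / 2 ^ fst (I j)) - (\<Sum>k<2 ^ n. \<Prod>j\<in>UNIV. in_cell (I j) (X k $ j)))
     \<le> 2 ^ level UNIV I * (\<Sum>N<2 ^ n. (hat_defect X I N)\<^sup>2)"
proof -
  let ?l = "level UNIV I"
  define h :: nat where "h = 2 ^ (?l - 2)"
  define P :: nat where "P = 2 ^ (n - ?l + 1)"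
  define u :: real where "u = (\<Prod>j\<in>UNIV. 1 / 4 ^ (fst (I j) + 1))"
  define c where "c k = (\<Prod>j\<in>UNIV. in_cell (I j) (X k $ j))" for k
  define T where "T k = (\<Prod>j\<in>UNIV. hat (I j) (X k $ j))" for k
  have c01: "c k \<in> {0, 1}" for k
  proof (cases "\<exists>j. in_cell (I j) (X k $ j) = 0")
    case True
    then show ?thesis by (auto simp: c_def)
  next
    case False
    then have "in_cell (I j) (X k $ j) = 1" for j
      by (auto simp: in_cell_def)
    then show ?thesis by (simp add: c_def)
  qed
  have "P * (2 * h) = 2 ^ (n - ?l + 1 + (1 + (?l - 2)))"
    by (simp add: P_def h_def power_add)
  also have "n - ?l + 1 + (1 + (?l - 2)) = n"
    using assms by simp
  finally have Ph: "P * (2 * h) = 2 ^ n" .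
  have drift: "(real P - (\<Sum>k<P * (2 * h). c k)) * (real h * (real h * u)\<^sup>2 / 2)
      \<le> (\<Sum>N<P * (2 * h). ((\<Sum>k<N. T k) - real N * u)\<^sup>2)"
  proof (rule drift_lower_bound[OF c01])
    show "T k = 0" if "c k = 0" for k
      using that by (auto simp: c_def T_def hat_def)
  qed
  define L :: real where "L = 2 ^ ?l"
  have L: "0 < L" by (simp add: L_def)
  have "real P * L = 2 * 2 ^ (n - ?l + ?l)"
    by (simp add: P_def L_def power_add)
  then have P: "real P = 2 * 2 ^ n * (\<Prod>j\<in>UNIV. 1 / 2 ^ fst (I j))"
    using assms(2) L by (simp add: L_def prod_dividef power_level field_simps)
  have "?l = ?l - 2 + 2"
    using assms(1) by simp
  then have "L = 2 ^ (?l - 2 + 2)"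
    unfolding L_def by (rule arg_cong)
  then have h: "real h = L / 4"
    unfolding power_add by (simp add: h_def)
  have "(\<Prod>j\<in>(UNIV :: 'd set). (4 :: real) ^ (fst (I j) + 1)) = 4 ^ ?l * 4 ^ CARD('d)"
    by (simp add: prod.distrib power_level)
  moreover have "(4 :: real) ^ ?l = L * L"
    by (simp add: L_def power_mult_distrib[symmetric])
  ultimately have u: "u = 1 / (L * L * 4 ^ CARD('d))"
    by (simp add: u_def prod_dividef)
  have "(4 :: real) ^ CARD('d) * 4 ^ CARD('d) = 16 ^ CARD('d)"
    by (simp add: power_mult_distrib[symmetric])
  then have const: "L * (real h * (real h * u)\<^sup>2 / 2) = 1 / (128 * 16 ^ CARD('d))"
    unfolding h u using L by (simp add: power2_eq_square field_simps)
  have "1 / (128 * 16 ^ CARD('d)) * (real P - (\<Sum>k<2 ^ n. c k)) = L * ((real P - (\<Sum>k<P * (2 * h). c k)) * (real h * (real h * u)\<^sup>2 / 2))"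
    unfolding const[symmetric] Ph by (simp only: mult_ac)
  also have "\<dots> \<le> L * (\<Sum>N<P * (2 * h). ((\<Sum>k<N. T k) - real N * u)\<^sup>2)"
    using drift L by (intro mult_left_mono) auto
  finally show ?thesis
    unfolding Ph unfolding P c_def T_def u_def L_def hat_defect_def .
qed

text \<open>
  The shapes with all side levels in \<open>{2..m + 1}\<close> have level at most \<open>d (m + 1)\<close>, and there are
  \<open>m\<^sup>d\<close> of them. For each shape every point lies in exactly one box, which loses half of
  the pairs. Averaging over the times \<open>N\<close> gives one \<open>N\<close> with large energy.
\<close>

lemma discrepancy_lower_bound_scale:
  fixes X :: "nat \<Rightarrow> real ^ 'd::finite"
  assumes X: "\<And>n j. X n $ j \<in> {0..<1}" and m: "1 \<le> m"
  shows "\<exists>N<2 ^ (CARD('d) * (m + 1)). real m ^ CARD('d) / (128 * 32 ^ CARD('d)) \<le> (real N * per_L2_discrepancy X N)\<^sup>2"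
proof -
  define n where "n = CARD('d) * (m + 1)"
  define B :: "(nat \<times> nat) set" where "B = (SIGMA a:{2..m + 1}. {..<2 ^ a})"
  let ?B = "PiE (UNIV :: 'd set) (\<lambda>_. B)"
  define K :: real where "K = 1 / (128 * 16 ^ CARD('d))"
  have [simp]: "finite B"
    by (simp add: B_def)
  have sumB: "(\<Sum>i\<in>B. f i) = (\<Sum>a\<in>{2..m + 1}. \<Sum>b<2 ^ a. f (a, b))" for f :: "nat \<times> nat \<Rightarrow> real"
    unfolding B_def by (subst sum.Sigma) auto
  have volume: "(\<Sum>I\<in>?B. \<Prod>j\<in>UNIV. 1 / 2 ^ fst (I j)) = real m ^ CARD('d)"
  proof -
    have "(\<Sum>I\<in>?B. \<Prod>j\<in>UNIV. 1 / 2 ^ fst (I j)) = (\<Prod>j\<in>(UNIV :: 'd set). \<Sum>i\<in>B. 1 / 2 ^ fst i :: real)"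
      by (subst prod_sum_PiE) simp_all
    also have "(\<Sum>i\<in>B. 1 / 2 ^ fst i :: real) = real m"
      unfolding sumB by simp
    finally show ?thesis
      by simp
  qed
  have cells: "(\<Sum>I\<in>?B. \<Prod>j\<in>UNIV. in_cell (I j) (X k $ j)) = real m ^ CARD('d)" for k
  proof -
    have "(\<Sum>i\<in>B. in_cell i (X k $ j)) = real m" for j
    proof -
      have "(\<Sum>b<2 ^ a. in_cell (a, b) (X k $ j)) = 1" for a
        using sum_in_cell[of "X k $ j" a "\<lambda>_. 1"] X[of k j] by simp
      then show ?thesis
        unfolding sumB by simp
    qed
    then show ?thesis
      by (subst prod_sum_PiE[symmetric]) simp_all
  qed
  have lev: "2 \<le> level UNIV I" "level UNIV I \<le> n" if "I \<in> ?B" for I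
  proof -
    have I: "2 \<le> fst (I j)" "fst (I j) \<le> m + 1" for j
      using PiE_mem[OF that, of j] by (auto simp: B_def)
    have "fst (I undefined) \<le> level UNIV I"
      unfolding level_def by (rule member_le_sum) auto
    with I(1)[of undefined] show "2 \<le> level UNIV I"
      by linarith
    show "level UNIV I \<le> n"
      unfolding level_def n_def using sum_bounded_above[of UNIV "\<lambda>j. fst (I j)" "m + 1"] I(2) by simp
  qed
  have "K * (2 ^ n * real m ^ CARD('d)) = K * (2 * 2 ^ n * (\<Sum>I\<in>?B. \<Prod>j\<in>UNIV. 1 / 2 ^ fst (I j)) - (\<Sum>k<2 ^ n. \<Sum>I\<in>?B. \<Prod>j\<in>UNIV. in_cell (I j) (X k $ j)))"
    unfolding volume cells by simp
  also have "\<dots> = (\<Sum>I\<in>?B. K * (2 * 2 ^ n * (\<Prod>j\<in>UNIV. 1 / 2 ^ fst (I j)) - (\<Sum>k<2 ^ n. \<Prod>j\<in>UNIV. in_cell (I j) (X k $ j))))"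
    by (subst sum.swap) (simp only: sum_distrib_left sum_subtractf right_diff_distrib)
  also have "\<dots> \<le> (\<Sum>I\<in>?B. 2 ^ level UNIV I * (\<Sum>N<2 ^ n. (hat_defect X I N)\<^sup>2))"
    unfolding K_def by (intro sum_mono hat_defect_lower_bound lev)
  also have "\<dots> = (\<Sum>N<2 ^ n. \<Sum>I\<in>?B. 2 ^ level UNIV I * (hat_defect X I N)\<^sup>2)"
    by (subst sum.swap) (simp only: sum_distrib_left)
  finally have avg: "(\<Sum>N<2 ^ n :: nat. K * real m ^ CARD('d)) \<le> (\<Sum>N<2 ^ n. \<Sum>I\<in>?B. 2 ^ level UNIV I * (hat_defect X I N)\<^sup>2)"
    by (simp add: mult_ac)
  obtain N where N: "N < 2 ^ n" and W: "K * real m ^ CARD('d) \<le> (\<Sum>I\<in>?B. 2 ^ level UNIV I * (hat_defect X I N)\<^sup>2)"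
  proof (rule ccontr)
    assume "\<not> thesis"
    then have "(\<Sum>I\<in>?B. 2 ^ level UNIV I * (hat_defect X I N)\<^sup>2) < K * real m ^ CARD('d)" if "N < 2 ^ n" for N
      using that \<open>\<And>N. N < 2 ^ n \<Longrightarrow> _ N \<le> _ N \<Longrightarrow> thesis\<close> by (meson not_le)
    then have "(\<Sum>N<2 ^ n. \<Sum>I\<in>?B. 2 ^ level UNIV I * (hat_defect X I N)\<^sup>2) < (\<Sum>N<2 ^ n :: nat. K * real m ^ CARD('d))"
      by (intro sum_strict_mono) (auto simp: lessThan_empty_iff)
    with avg show False by linarith
  qed
  have "N \<noteq> 0"
  proof
    assume "N = 0"
    then have "K * real m ^ CARD('d) \<le> 0"
      using W by (simp add: hat_defect_def)
    moreover have "0 < K * real m ^ CARD('d)"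
      using m by (simp add: K_def)
    ultimately show False
      by linarith
  qed
  have "K * real m ^ CARD('d) \<le> (\<Sum>I\<in>PiE UNIV (\<lambda>_. dyadic (m + 2)). 2 ^ level UNIV I * (hat_defect X I N)\<^sup>2)"
  proof (rule order_trans[OF W sum_mono2])
    show "?B \<subseteq> PiE UNIV (\<lambda>_. dyadic (m + 2))"
      by (intro PiE_mono) (auto simp: B_def dyadic_def)
  qed (auto intro: finite_PiE)
  also have "\<dots> \<le> 2 ^ CARD('d) * total_energy X N (m + 2)"
    by (rule hat_defect_energy)
  also have "\<dots> \<le> 2 ^ CARD('d) * (real N * per_L2_discrepancy X N)\<^sup>2"
    using X \<open>N \<noteq> 0\<close> by (intro mult_left_mono total_energy_le_discrepancy) auto
  finally have "K * real m ^ CARD('d) / 2 ^ CARD('d) \<le> (real N * per_L2_discrepancy X N)\<^sup>2"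
    by (simp add: field_simps)
  moreover have "K * real m ^ CARD('d) / 2 ^ CARD('d) = real m ^ CARD('d) / (128 * 32 ^ CARD('d))"
  proof -
    have "(16 :: real) ^ CARD('d) * 2 ^ CARD('d) = 32 ^ CARD('d)"
      by (simp add: power_mult_distrib[symmetric])
    then show ?thesis
      by (simp add: K_def field_simps)
  qed
  ultimately show ?thesis
    using N by (auto simp: n_def)
qed

text \<open>
  The times \<open>N\<close> provided at the scales \<open>m\<close> are unbounded because \<open>N L \<le> N\<close>, and they satisfy
  \<open>ln N \<le> 2 d m\<close>.
\<close>

theorem lower_bound_infinitely_often:
  "\<exists>c>0. \<forall>X :: nat \<Rightarrow> real ^ 'd::finite. (\<forall>n j. X n $ j \<in> {0..<1}) \<longrightarrow>
     infinite {N. N \<ge> 2 \<and> per_L2_discrepancy X N \<ge> c * (ln (real N) powr (real CARD('d) / 2) / real N)}"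
proof -
  define d where "d = CARD('d)"
  have d: "1 \<le> d"
    by (simp add: d_def Suc_le_eq)
  define c where "c = sqrt (1 / (128 * 32 ^ d * real (2 * d) ^ d))"
  have "0 < c"
    using d by (simp add: c_def)
  moreover have "infinite {N. N \<ge> 2 \<and> per_L2_discrepancy X N \<ge> c * (ln (real N) powr (real CARD('d) / 2) / real N)}"
    if "\<forall>n j. X n $ j \<in> {0..<1}" for X :: "nat \<Rightarrow> real ^ 'd"
  proof -
    have X: "X n $ j \<in> {0..<1}" for n j
      using that by blast
    have "\<exists>N\<ge>b. N \<ge> 2 \<and> per_L2_discrepancy X N \<ge> c * (ln (real N) powr (real CARD('d) / 2) / real N)" for b
    proof -
      \<comment> \<open>The scale is chosen so large that the trivial bound forces N to exceed b + 2.\<close>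
      define m where "m = 128 * 32 ^ d * (b + 2)\<^sup>2"
      have m: "1 \<le> m"
        by (simp add: m_def Suc_le_eq)
      have "\<exists>N<2 ^ (d * (m + 1)). real m ^ d / (128 * 32 ^ d) \<le> (real N * per_L2_discrepancy X N)\<^sup>2"
        unfolding d_def by (rule discrepancy_lower_bound_scale[OF X m])
      then obtain N where N: "N < 2 ^ (d * (m + 1))" "real m ^ d / (128 * 32 ^ d) \<le> (real N * per_L2_discrepancy X N)\<^sup>2"
        by blast
      let ?L = "per_L2_discrepancy X N"
      have "real m \<le> real m ^ d"
        using m d by (intro self_le_power) auto
      then have "(real (b + 2))\<^sup>2 \<le> real m ^ d / (128 * 32 ^ d)"
        by (simp add: m_def field_simps)
      then have big: "(real (b + 2))\<^sup>2 \<le> (real N * ?L)\<^sup>2"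
        using N(2) by linarith
      have "N \<noteq> 0"
      proof
        assume "N = 0"
        with big have "(real (b + 2))\<^sup>2 \<le> 0"
          by simp
        then show False
          by (simp add: add_eq_0_iff_both_eq_0 del: of_nat_add)
      qed
      with X have "(real N * ?L)\<^sup>2 \<le> (real N)\<^sup>2"
        by (intro discrepancy_trivial_bound) auto
      with big have "(real (b + 2))\<^sup>2 \<le> (real N)\<^sup>2"
        by linarith
      then have Nb: "b + 2 \<le> N"
        by (simp add: power2_le_iff_abs_le)
      have "real N \<le> 2 ^ (d * (m + 1))"
        using N(1) by (metis less_imp_le of_nat_le_iff of_nat_numeral of_nat_power)
      then have "ln (real N) \<le> ln (2 ^ (d * (m + 1)))"
        using \<open>N \<noteq> 0\<close> by (subst ln_le_cancel_iff) auto
      also have "\<dots> = real (d * (m + 1)) * ln 2"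
        by (simp add: ln_realpow)
      also have "\<dots> \<le> real (d * (m + 1)) * 1"
        using ln_2_less_1 by (intro mult_left_mono) auto
      also have "\<dots> \<le> real (2 * d) * real m"
        using m d by simp
      finally have lnm: "ln (real N) \<le> real (2 * d) * real m" .
      have ln0: "0 < ln (real N)"
        using Nb by simp
      have L0: "0 \<le> ?L"
        unfolding per_L2_discrepancy_def by (intro real_sqrt_ge_zero) (auto simp: set_lebesgue_integral_def intro!: integral_nonneg_AE AE_I2 split: prod.splits)
      have "(c * ln (real N) powr (real d / 2))\<^sup>2 = c\<^sup>2 * ln (real N) ^ d"
        using ln0 by (simp add: power_mult_distrib powr_power powr_realpow)
      also have "\<dots> \<le> c\<^sup>2 * (real (2 * d) * real m) ^ d"
        using ln0 lnm by (intro mult_left_mono power_mono) auto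
      also have "\<dots> = real m ^ d / (128 * 32 ^ d)"
        using d by (simp add: c_def power_mult_distrib)
      also have "\<dots> \<le> (real N * ?L)\<^sup>2"
        by (rule N(2))
      finally have "c * ln (real N) powr (real d / 2) \<le> real N * ?L"
        by (rule power2_le_imp_le) (use L0 in simp)
      then have "c * (ln (real N) powr (real CARD('d) / 2) / real N) \<le> ?L"
        using \<open>N \<noteq> 0\<close> by (simp add: d_def field_simps)
      with Nb show ?thesis
        by (intro exI[of _ N]) auto
    qed
    then show ?thesis
      unfolding infinite_nat_iff_unbounded_le by blast
  qed
  ultimately show ?thesis
    by blast
qed

section \<open>Walsh functions and their order-2 weights\<close>

text \<open>
  Addition of bits is treated as addition in a field here, so the rewriting to bit operations
  is switched off.
\<close>

declare add_bit_eq_xor [simp del] mult_bit_eq_and [simp del]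

definition digit_sign :: "nat \<Rightarrow> real \<Rightarrow> real" where
  "digit_sign i x = (if odd \<lfloor>2 ^ i * x\<rfloor> then - 1 else 1)"

definition walsh :: "nat set \<Rightarrow> real \<Rightarrow> real" where
  "walsh S x = (\<Prod>i\<in>S. digit_sign i x)"

text \<open>
  The quantity \<open>i\<^sub>1 + i\<^sub>2\<close> of the definition of an order-2 net, for the set \<open>S\<close> of selected
  rows of one matrix; a single row counts with its index alone.
\<close>

definition top_two_sum :: "nat set \<Rightarrow> nat" where
  "top_two_sum S = (\<Sum>l = 1..min (card S) 2. rev (sorted_list_of_set S) ! (l - 1))"

lemma decreasing_enumeration:
  assumes "finite S"
  defines "e \<equiv> \<lambda>l. rev (sorted_list_of_set S) ! (l - 1)"
  shows "bij_betw e {1..card S} S"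
    and "\<And>l l'. l \<in> {1..card S} \<Longrightarrow> l' \<in> {1..card S} \<Longrightarrow> l < l' \<Longrightarrow> e l' < e l"
proof -
  let ?xs = "sorted_list_of_set S"
  have len: "length ?xs = card S"
    by simp
  have e: "e l = ?xs ! (card S - l)" if "l \<in> {1..card S}" for l
  proof -
    have "l - 1 < length ?xs" "Suc (l - 1) = l"
      using that by auto
    then show ?thesis
      by (simp only: e_def rev_nth len)
  qed
  show dec: "e l' < e l" if "l \<in> {1..card S}" "l' \<in> {1..card S}" "l < l'" for l l'
    using strict_sorted_list_of_set[of S] that unfolding sorted_wrt_iff_nth_less
    by (auto simp: e)
  have "inj_on e {1..card S}"
    by (rule linorder_inj_onI') (metis dec less_irrefl)
  moreover have "e ` {1..card S} = S"
  proof
    show "e ` {1..card S} \<subseteq> S"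
    proof clarify
      fix l assume "l \<in> {1..card S}"
      then have "e l \<in> set ?xs"
        unfolding e[OF \<open>l \<in> _\<close>] by (intro nth_mem) auto
      then show "e l \<in> S"
        using assms(1) by simp
    qed
    show "S \<subseteq> e ` {1..card S}"
    proof
      fix s assume "s \<in> S"
      then have "s \<in> set ?xs"
        using assms(1) by simp
      then obtain k where k: "k < card S" "?xs ! k = s"
        by (metis in_set_conv_nth len)
      then have "e (card S - k) = s" "card S - k \<in> {1..card S}"
        by (simp_all add: e)
      then show "s \<in> e ` {1..card S}"
        by blast
    qed
  qed
  ultimately show "bij_betw e {1..card S} S"
    by (simp add: bij_betw_def)
qed

lemma top_two_sum_le:
  assumes "finite S" and e: "\<And>i. i \<in> S \<Longrightarrow> i \<le> a" and b: "\<And>i k. i \<in> S \<Longrightarrow> k \<in> S \<Longrightarrow> i < k \<Longrightarrow> i \<le> b"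
  shows "top_two_sum S \<le> a + b"
proof -
  let ?e = "\<lambda>l. rev (sorted_list_of_set S) ! (l - 1)"
  note enum = decreasing_enumeration[OF assms(1)]
  consider "card S = 0" | "card S = 1" | "2 \<le> card S"
    by linarith
  then show ?thesis
  proof cases
    case 2
    then have "?e 1 \<in> S"
      using bij_betw_apply[OF enum(1), of 1] by simp
    with e 2 show ?thesis
      by (fastforce simp: top_two_sum_def)
  next
    case 3
    then have in_S: "?e 1 \<in> S" "?e 2 \<in> S"
      using bij_betw_apply[OF enum(1), of 1] bij_betw_apply[OF enum(1), of 2] by simp_all
    have "?e 2 < ?e 1"
      using 3 by (intro enum(2)) auto
    with in_S have "?e 1 \<le> a" "?e 2 \<le> b"
      using e b by blast+
    moreover have "{1..min (card S) 2} = {1, 2}"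
      using 3 by auto
    ultimately show ?thesis
      by (simp add: top_two_sum_def)
  qed (simp add: top_two_sum_def)
qed

lemma le_top_two_sum:
  assumes "finite S" "i \<in> S"
  shows "i \<le> top_two_sum S"
proof -
  let ?e = "\<lambda>l. rev (sorted_list_of_set S) ! (l - 1)"
  note enum = decreasing_enumeration[OF assms(1)]
  have "?e ` {1..card S} = S"
    using enum(1) by (rule bij_betw_imp_surj_on)
  then obtain l where l: "l \<in> {1..card S}" "i = ?e l"
    using assms(2) by blast
  have "?e l \<le> ?e 1"
  proof (cases "l = 1")
    case False
    then have "?e l < ?e 1"
      using l by (intro enum(2)) auto
    then show ?thesis by simp
  qed simp
  also have "\<dots> \<le> (\<Sum>l = 1..min (card S) 2. ?e l)"
    by (rule member_le_sum) (use l in auto)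
  finally show ?thesis
    using l by (simp add: top_two_sum_def)
qed

section \<open>Digits of a digital sequence\<close>

text \<open>
  A digit sequence with finitely many ones is the binary expansion that the floor function sees;
  in particular no carry from a tail of ones can occur.
\<close>

lemma digit_expansion_floor:
  fixes \<xi> :: "nat \<Rightarrow> bit"
  assumes K: "\<And>i. K < i \<Longrightarrow> \<xi> i = 0"
  defines "x \<equiv> \<Sum>i. of_bit (\<xi> (Suc i)) / 2 ^ Suc i :: real"
  shows "0 \<le> x" "x < 1" "1 \<le> n \<Longrightarrow> digit_sign n x = (if \<xi> n = 0 then 1 else - 1)"
proof -
  let ?s = "\<lambda>L. \<Sum>i<L. of_bit (\<xi> (Suc i)) / 2 ^ Suc i :: real"
  have x: "x = ?s L" if "K \<le> L" for L
    unfolding x_def by (rule suminf_finite) (use K that in auto)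
  \<comment> \<open>P n is the integer with binary digits \<xi> 1, ..., \<xi> n.\<close>
  define P :: "nat \<Rightarrow> int" where "P = rec_nat 0 (\<lambda>n p. 2 * p + of_bit (\<xi> (Suc n)))"
  have P: "P 0 = 0" "P (Suc n) = 2 * P n + of_bit (\<xi> (Suc n))" for n
    by (simp_all add: P_def)
  have bit: "0 \<le> (of_bit b :: real)" "(of_bit b :: real) \<le> 1" "of_int (of_bit b) = (of_bit b :: real)" for b
    by (cases b; simp)+
  have head: "2 ^ n * ?s n = P n" for n
    by (induction n) (simp_all add: P bit field_simps)
  have tail: "?s n \<le> ?s L \<and> ?s L \<le> ?s n + (1 / 2 ^ n - 1 / 2 ^ L)" if "n \<le> L" for n L
    using that
  proof (induction L rule: dec_induct)
    case (step L)
    have "of_bit (\<xi> (Suc L)) / 2 ^ Suc L \<le> (1 / 2 ^ Suc L :: real)"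
      using bit by (intro divide_right_mono) auto
    moreover have "0 \<le> of_bit (\<xi> (Suc L)) / (2 ^ Suc L :: real)"
      using bit by (intro divide_nonneg_nonneg) auto
    moreover have "1 / 2 ^ L = 1 / 2 ^ Suc L + (1 / 2 ^ Suc L :: real)"
      by simp
    ultimately show ?case
      using step.IH by (simp only: sum.lessThan_Suc) linarith
  qed simp
  have floor: "\<lfloor>2 ^ n * x\<rfloor> = P n" for n
  proof -
    let ?L = "max n K"
    have "?s n \<le> x" "x \<le> ?s n + (1 / 2 ^ n - 1 / 2 ^ ?L)"
      using tail[of n ?L] x[of ?L] by simp_all
    then have "2 ^ n * ?s n \<le> 2 ^ n * x" and "2 ^ n * x \<le> 2 ^ n * (?s n + (1 / 2 ^ n - 1 / 2 ^ ?L))"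
      by (intro mult_left_mono; simp)+
    moreover have "2 ^ n * (?s n + (1 / 2 ^ n - 1 / 2 ^ ?L)) = P n + 1 - 2 ^ n / 2 ^ ?L"
      unfolding distrib_left head right_diff_distrib by simp
    moreover have "0 < (2 ^ n / 2 ^ ?L :: real)"
      by simp
    ultimately have "real_of_int (P n) \<le> 2 ^ n * x" "2 ^ n * x < real_of_int (P n) + 1"
      unfolding head by linarith+
    then show ?thesis
      by (rule floor_unique)
  qed
  show "0 \<le> x" "x < 1"
    using floor[of 0] by (simp_all add: P floor_eq_iff)
  show "digit_sign n x = (if \<xi> n = 0 then 1 else - 1)" if n1: "1 \<le> n"
  proof -
    obtain k where n: "n = Suc k"
      using n1 by (cases n) auto
    have "odd (P n) \<longleftrightarrow> \<xi> n \<noteq> 0"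
      unfolding n P by (cases "\<xi> (Suc k)") simp_all
    then show ?thesis
      by (simp add: digit_sign_def floor)
  qed
qed

lemma of_nat_bit: "(of_nat n :: bit) = (if odd n then 1 else 0)"
  by (induction n) auto

lemma digit_vec_bit: "1 \<le> l \<Longrightarrow> digit_vec k l = (if bit k (l - 1) then 1 else 0)"
  by (simp add: digit_vec_def bit_iff_odd of_nat_bit)

lemma mat_vec_bounded:
  assumes "k < 2 ^ L"
  shows "mat_vec C (digit_vec k) i = (\<Sum>l\<in>{1..L}. C i l * digit_vec k l)"
  unfolding mat_vec_def
proof (rule sum.mono_neutral_cong_left)
  show "{l. 1 \<le> l \<and> digit_vec k l \<noteq> 0} \<subseteq> {1..L}"
  proof
    fix l assume l: "l \<in> {l. 1 \<le> l \<and> digit_vec k l \<noteq> 0}"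
    show "l \<in> {1..L}"
    proof (rule ccontr)
      assume "l \<notin> {1..L}"
      then have "(2::nat) ^ L \<le> 2 ^ (l - 1)"
        using l by (intro power_increasing) auto
      with assms have "k div 2 ^ (l - 1) = 0"
        by (intro div_less) linarith
      with l show False
        by (simp add: digit_vec_def)
    qed
  qed
qed auto

lemma digital_sequence_digits:
  fixes C :: "'d::finite \<Rightarrow> bit_matrix"
  assumes "finite_columns (C j)"
  shows "digital_sequence C k $ j \<in> {0..<1}"
    and "1 \<le> i \<Longrightarrow> digit_sign i (digital_sequence C k $ j) = (if mat_vec (C j) (digit_vec k) i = 0 then 1 else - 1)"
proof -
  obtain f where f: "\<And>l i. 1 \<le> l \<Longrightarrow> 1 \<le> i \<Longrightarrow> f l < i \<Longrightarrow> C j i l = 0"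
    using assms unfolding finite_columns_def by metis
  have "k < 2 ^ k"
    by (rule less_exp)
  define K where "K = (\<Sum>l\<in>{1..k}. f l)"
  have K: "mat_vec (C j) (digit_vec k) i = 0" if "K < i" for i
    unfolding mat_vec_bounded[OF \<open>k < 2 ^ k\<close>]
  proof (rule sum.neutral, rule ballI)
    fix l assume l: "l \<in> {1..k}"
    have "f l \<le> K"
      unfolding K_def using l by (intro member_le_sum) auto
    then show "C j i l * digit_vec k l = 0"
      using f[of l i] l that by simp
  qed
  show "digital_sequence C k $ j \<in> {0..<1}"
    "1 \<le> i \<Longrightarrow> digit_sign i (digital_sequence C k $ j) = (if mat_vec (C j) (digit_vec k) i = 0 then 1 else - 1)"
    using digit_expansion_floor[of K "mat_vec (C j) (digit_vec k)", OF K] by (simp_all add: digital_sequence_def)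
qed

section \<open>Character sums over dyadic blocks\<close>

definition bit_sign :: "bit \<Rightarrow> real" where
  "bit_sign b = (if b = 0 then 1 else - 1)"

lemma bit_sign_add: "bit_sign (a + b) = bit_sign a * bit_sign b"
  by (cases a; cases b) (simp_all add: bit_sign_def)

lemma bit_sign_sum: "bit_sign (\<Sum>i\<in>A. f i) = (\<Prod>i\<in>A. bit_sign (f i))"
  by (induction A rule: infinite_finite_induct) (simp_all add: bit_sign_add, simp_all add: bit_sign_def)

abbreviation block :: "nat \<Rightarrow> nat \<Rightarrow> nat set" where
  "block m q \<equiv> {k. k div 2 ^ m = q}"

lemma block_eq: "block m q = {q * 2 ^ m..<q * 2 ^ m + 2 ^ m}"
proof -
  have "k div 2 ^ m = q \<longleftrightarrow> q * 2 ^ m \<le> k \<and> k < q * 2 ^ m + 2 ^ m" for k :: nat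
  proof
    assume "k div 2 ^ m = q"
    then show "q * 2 ^ m \<le> k \<and> k < q * 2 ^ m + 2 ^ m"
      using dividend_less_div_times[of "2 ^ m" k] by auto
  next
    assume "q * 2 ^ m \<le> k \<and> k < q * 2 ^ m + 2 ^ m"
    then show "k div 2 ^ m = q"
      by (intro div_nat_eqI) (simp_all add: mult.commute)
  qed
  then show ?thesis
    by (intro set_eqI) (simp only: mem_Collect_eq atLeastLessThan_iff)
qed

lemma finite_block [simp]: "finite (block m q)" and card_block [simp]: "card (block m q) = 2 ^ m"
  unfolding block_eq by simp_all

lemma flip_bit_block:
  assumes "l < m"
  shows "flip_bit l k \<in> block m q \<longleftrightarrow> k \<in> block m q"
proof -
  have "flip_bit l k div 2 ^ m = k div 2 ^ m"
    unfolding drop_bit_eq_div[symmetric] by (rule bit_eqI) (use assms in \<open>auto simp: bit_simps\<close>)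
  then show ?thesis
    by simp
qed

text \<open>
  Flipping one binary digit of the index adds one column of the matrix to the digit vector of the
  point.
\<close>

lemma mat_vec_flip_bit:
  shows "mat_vec C (digit_vec (flip_bit r k)) i = mat_vec C (digit_vec k) i + C i (Suc r)"
proof -
  define L where "L = max (Suc r) (k + flip_bit r k)"
  have bound: "j < 2 ^ L" if "j \<le> L" for j
    using less_exp[of L] that by linarith
  have less: "k < 2 ^ L" "flip_bit r k < 2 ^ L"
    by (rule bound, simp add: L_def)+
  have digit: "digit_vec (flip_bit r k) l' = digit_vec k l' + of_bool (l' = Suc r)" if "1 \<le> l'" for l'
    using that by (cases "l' = Suc r") (auto simp: digit_vec_bit bit_simps)
  have "mat_vec C (digit_vec (flip_bit r k)) i = (\<Sum>l'\<in>{1..L}. C i l' * digit_vec k l' + C i l' * of_bool (l' = Suc r))"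
    unfolding mat_vec_bounded[OF less(2)] by (intro sum.cong refl) (simp add: digit distrib_left)
  also have "\<dots> = mat_vec C (digit_vec k) i + (\<Sum>l'\<in>{1..L}. C i l' * of_bool (l' = Suc r))"
    unfolding mat_vec_bounded[OF less(1)] by (rule sum.distrib)
  also have "(\<Sum>l'\<in>{1..L}. C i l' * of_bool (l' = Suc r)) = (\<Sum>l'\<in>{1..L}. if l' = Suc r then C i l' else 0)"
    by (intro sum.cong refl) simp
  also have "\<dots> = C i (Suc r)"
    by (simp add: L_def)
  finally show ?thesis .
qed

lemma walsh_digital_sequence:
  fixes E :: "'d::finite \<Rightarrow> bit_matrix"
  assumes "\<And>j. finite_columns (E j)" "\<And>j. S j \<subseteq> {1..}"
  shows "(\<Prod>j\<in>UNIV. walsh (S j) (digital_sequence E k $ j)) = bit_sign (\<Sum>j\<in>UNIV. \<Sum>i\<in>S j. mat_vec (E j) (digit_vec k) i)"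
  unfolding bit_sign_sum walsh_def
proof (intro prod.cong refl)
  fix j i assume "i \<in> S j"
  then have "1 \<le> i"
    using assms(2)[of j] by auto
  then show "digit_sign i (digital_sequence E k $ j) = bit_sign (mat_vec (E j) (digit_vec k) i)"
    by (simp add: digital_sequence_digits(2)[OF assms(1)] bit_sign_def)
qed

text \<open>
  If the selected rows are linearly independent as vectors of length \<open>m\<close>, their sum has a
  nonzero entry in some column \<open>l \<le> m\<close>. Flipping the \<open>l\<close>-th binary digit of the index is an
  involution of the block that reverses the sign of the character.
\<close>

lemma walsh_sum_vanishes:
  fixes E :: "'d::finite \<Rightarrow> bit_matrix"
  assumes E: "order_digital_sequence 2 t E"
    and S: "\<And>j. finite (S j)" "\<And>j. S j \<subseteq> {1..}" and nonempty: "S j\<^sub>0 \<noteq> {}"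
    and weight: "(\<Sum>j\<in>UNIV. top_two_sum (S j)) + t \<le> 2 * m"
  shows "(\<Sum>k\<in>block m q. \<Prod>j\<in>UNIV. walsh (S j) (digital_sequence E k $ j)) = 0"
proof -
  have cols: "finite_columns (E j)" for j
    using E by (simp add: order_digital_sequence_def)
  have le_weight: "i + t \<le> 2 * m" if "i \<in> S j" for i j
  proof -
    have "i \<le> top_two_sum (S j)"
      using S that by (intro le_top_two_sum)
    also have "\<dots> \<le> (\<Sum>j\<in>UNIV. top_two_sum (S j))"
      by (rule member_le_sum) auto
    finally show ?thesis
      using weight by simp
  qed
  have "t < 2 * m"
    using le_weight[of _ j\<^sub>0] S(2)[of j\<^sub>0] nonempty by fastforce
  then have net: "order_digital_net 2 t (2 * m) m E"
    using E by (auto simp: order_digital_sequence_def)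
  define \<nu> where "\<nu> j = card (S j)" for j
  define e where "e j l = rev (sorted_list_of_set (S j)) ! (l - 1)" for j l
  have bij: "bij_betw (e j) {1..\<nu> j} (S j)" for j
    unfolding e_def \<nu>_def by (rule decreasing_enumeration(1)[OF S(1)])
  have e_in: "e j l \<in> S j" if "l \<in> {1..\<nu> j}" for j l
    using bij_betw_apply[OF bij that] .
  have "independent_family m (SIGMA j:UNIV. {1..\<nu> j}) (\<lambda>(j, l). E j (e j l))"
  proof -
    have range: "\<forall>j. \<forall>l\<in>{1..\<nu> j}. e j l \<in> {1..2 * m}"
    proof (intro allI ballI)
      fix j l assume "l \<in> {1..\<nu> j}"
      then have "e j l \<in> S j"
        by (rule e_in)
      then show "e j l \<in> {1..2 * m}"
        using le_weight[of "e j l" j] S(2)[of j] by auto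
    qed
    have dec: "\<forall>j. \<forall>l\<in>{1..\<nu> j}. \<forall>l'\<in>{1..\<nu> j}. l < l' \<longrightarrow> e j l' < e j l"
      unfolding e_def \<nu>_def using decreasing_enumeration(2)[OF S(1)] by blast
    have sum: "(\<Sum>j\<in>UNIV. \<Sum>l = 1..min (\<nu> j) 2. e j l) \<le> 2 * m - t"
      using weight by (simp add: top_two_sum_def e_def \<nu>_def)
    show ?thesis
      by (rule net[unfolded order_digital_net_def, THEN conjunct2, THEN conjunct2, THEN conjunct2, THEN conjunct2,
            THEN spec[of _ \<nu>], THEN spec[of _ e], THEN mp])
        (intro conjI range dec sum)
  qed
  then have indep: "(\<forall>l\<in>{1..m}. (\<Sum>p\<in>(SIGMA j:UNIV. {1..\<nu> j}). 1 * (case p of (j, l) \<Rightarrow> E j (e j l)) l) = 0)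
      \<longrightarrow> (\<forall>p\<in>(SIGMA j:UNIV. {1..\<nu> j}). (1 :: bit) = 0)"
    unfolding independent_family_def by (rule spec)
  have "(j\<^sub>0, 1) \<in> (SIGMA j:UNIV. {1..\<nu> j})"
    using nonempty S(1)[of j\<^sub>0] by (simp add: \<nu>_def Suc_le_eq card_gt_0_iff)
  with indep obtain l where l: "l \<in> {1..m}"
    and "(\<Sum>p\<in>(SIGMA j:UNIV. {1..\<nu> j}). 1 * (case p of (j, l) \<Rightarrow> E j (e j l)) l) \<noteq> 0"
    by fastforce
  moreover have "(\<Sum>p\<in>(SIGMA j:UNIV. {1..\<nu> j}). 1 * (case p of (j, l) \<Rightarrow> E j (e j l)) l)
      = (\<Sum>j\<in>UNIV. \<Sum>l'\<in>{1..\<nu> j}. E j (e j l') l)"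
    by (subst sum.Sigma) (auto intro!: sum.cong)
  moreover have "(\<Sum>l'\<in>{1..\<nu> j}. E j (e j l') l) = (\<Sum>i\<in>S j. E j i l)" for j
    by (rule sum.reindex_bij_betw[OF bij])
  ultimately have flip: "(\<Sum>j\<in>UNIV. \<Sum>i\<in>S j. E j i l) = 1"
    by simp
  obtain r where r: "l = Suc r" "r < m"
    using l by (cases l) auto
  \<comment> \<open>The character at index k is the sign of H k.\<close>
  define H where "H k = (\<Sum>j\<in>UNIV. \<Sum>i\<in>S j. mat_vec (E j) (digit_vec k) i)" for k
  have H: "bit_sign (H (flip_bit r k)) = - bit_sign (H k)" for k
  proof -
    have "H (flip_bit r k) = H k + 1"
      using flip by (simp add: H_def mat_vec_flip_bit sum.distrib r)
    then show ?thesis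
      by (simp add: bit_sign_add) (simp add: bit_sign_def)
  qed
  have "(\<Sum>k\<in>block m q. bit_sign (H k)) = (\<Sum>k\<in>block m q. bit_sign (H (flip_bit r k)))"
  proof (rule sum.reindex_bij_witness[where i = "flip_bit r" and j = "flip_bit r"])
    have invol: "flip_bit r (flip_bit r k) = k" for k :: nat
      by (rule bit_eqI) (auto simp: bit_simps)
    show "flip_bit r (flip_bit r k) = k" "flip_bit r (flip_bit r k) = k" for k :: nat
      by (rule invol)+
    show "bit_sign (H (flip_bit r (flip_bit r k))) = bit_sign (H k)" for k
      by (simp only: invol)
    show "flip_bit r k \<in> block m q" "flip_bit r k \<in> block m q" if "k \<in> block m q" for k
      using that by (simp_all only: flip_bit_block[OF r(2)])
  qed
  then have "(\<Sum>k\<in>block m q. bit_sign (H k)) = 0"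
    by (simp only: H sum_negf)
  then show ?thesis
    unfolding walsh_digital_sequence[OF cols S(2)] H_def .
qed

section \<open>Walsh expansion of hat functions\<close>

text \<open>
  A point lies in a cell of level \<open>a\<close> if and only if its first \<open>a\<close> digits are the prescribed
  ones; the signs \<open>\<epsilon> i\<close> encode these digits.
\<close>

lemma in_cell_product:
  assumes "b < 2 ^ a"
  shows "\<exists>\<epsilon>. \<forall>x\<in>{0..<1}. in_cell (a, b) x = (\<Prod>i\<in>{1..a}. \<epsilon> i / 2 * digit_sign i x + 1 / 2)"
  using assms
proof (induction a arbitrary: b)
  case 0
  then show ?case
    by (intro exI[of _ "\<lambda>_. 0"]) (auto simp: in_cell_def cell_def floor_eq_iff)
next
  case (Suc a)
  have "b div 2 < 2 ^ a"
    using Suc.prems by auto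
  from Suc.IH[OF this] obtain \<epsilon> where \<epsilon>: "in_cell (a, b div 2) x = (\<Prod>i\<in>{1..a}. \<epsilon> i / 2 * digit_sign i x + 1 / 2)" if "x \<in> {0..<1}" for x
    by blast
  define \<epsilon>' where "\<epsilon>' = \<epsilon>(Suc a := if odd b then - 1 else 1)"
  have "in_cell (Suc a, b) x = (\<Prod>i\<in>{1..Suc a}. \<epsilon>' i / 2 * digit_sign i x + 1 / 2)" if x: "x \<in> {0..<1}" for x
  proof -
    have sign: "digit_sign (Suc a) x = (if frac (2 ^ a * x) < 1 / 2 then 1 else - 1)"
      unfolding digit_sign_def doubling_floor floor_double_frac by simp
    have "2 * m + (if P then 0 else 1) = b \<longleftrightarrow> m = b div 2 \<and> P = even b" for m P
      by (cases P; simp; presburger)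
    then have "in_cell (Suc a, b) x = of_bool (cell a x = b div 2 \<and> (frac (2 ^ a * x) < 1 / 2) = even b)"
      using x by (simp only: in_cell_def fst_conv snd_conv cell_Suc atLeastLessThan_iff)
    also have "\<dots> = in_cell (a, b div 2) x * (\<epsilon>' (Suc a) / 2 * digit_sign (Suc a) x + 1 / 2)"
      unfolding sign \<epsilon>'_def by (auto simp: in_cell_def)
    also have "in_cell (a, b div 2) x = (\<Prod>i\<in>{1..a}. \<epsilon>' i / 2 * digit_sign i x + 1 / 2)"
      unfolding \<epsilon>[OF x] by (intro prod.cong refl) (auto simp: \<epsilon>'_def)
    finally show ?thesis
      by (simp add: mult.commute)
  qed
  then show ?case
    by blast
qed

lemma in_cell_walsh:
  assumes "b < 2 ^ a"
  shows "\<exists>cf. cf {} = 1 / 2 ^ a \<and> (\<forall>x\<in>{0..<1}. in_cell (a, b) x = (\<Sum>S\<in>Pow {1..a}. cf S * walsh S x))"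
proof -
  obtain \<epsilon> where \<epsilon>: "in_cell (a, b) x = (\<Prod>i\<in>{1..a}. \<epsilon> i / 2 * digit_sign i x + 1 / 2)" if "x \<in> {0..<1}" for x
    using in_cell_product[OF assms] by blast
  define cf where "cf S = (\<Prod>i\<in>S. \<epsilon> i / 2) * (\<Prod>i\<in>{1..a} - S. 1 / 2)" for S
  have "in_cell (a, b) x = (\<Sum>S\<in>Pow {1..a}. cf S * walsh S x)" if "x \<in> {0..<1}" for x
    unfolding \<epsilon>[OF that] by (subst prod_add, simp) (simp only: cf_def walsh_def prod.distrib mult_ac)
  moreover have "cf {} = 1 / 2 ^ a"
    by (simp add: cf_def power_one_over)
  ultimately show ?thesis
    by blast
qed

text \<open>
  The function \<open>f\<close> is a Walsh polynomial with mean \<open>\<mu>\<close> all of whose other frequencies have order-2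
  weight at most \<open>w\<close>.
\<close>

definition walsh_span :: "nat \<Rightarrow> real \<Rightarrow> (real \<Rightarrow> real) \<Rightarrow> bool" where
  "walsh_span w \<mu> f \<longleftrightarrow> (\<exists>F cf. finite F \<and> {} \<notin> F \<and>
     (\<forall>S\<in>F. finite S \<and> S \<subseteq> {1..} \<and> top_two_sum S \<le> w) \<and>
     (\<forall>x\<in>{0..<1}. f x = \<mu> + (\<Sum>S\<in>F. cf S * walsh S x)))"

lemma walsh_spanI:
  assumes "finite F" "{} \<notin> F" "\<And>S. S \<in> F \<Longrightarrow> finite S \<and> S \<subseteq> {1..} \<and> top_two_sum S \<le> w"
    "\<And>x. x \<in> {0..<1} \<Longrightarrow> f x = \<mu> + (\<Sum>S\<in>F. cf S * walsh S x)"
  shows "walsh_span w \<mu> f"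
  using assms unfolding walsh_span_def by blast

lemma walsh_span_affine:
  assumes "walsh_span w \<mu> f" "w \<le> w'"
  shows "walsh_span w' (c + r * \<mu>) (\<lambda>x. c + r * f x)"
proof -
  obtain F cf where F: "finite F" "{} \<notin> F" "\<And>S. S \<in> F \<Longrightarrow> finite S \<and> S \<subseteq> {1..} \<and> top_two_sum S \<le> w"
    "\<And>x. x \<in> {0..<1} \<Longrightarrow> f x = \<mu> + (\<Sum>S\<in>F. cf S * walsh S x)"
    using assms(1) unfolding walsh_span_def by blast
  show ?thesis
  proof (rule walsh_spanI[OF F(1,2)])
    show "finite S \<and> S \<subseteq> {1..} \<and> top_two_sum S \<le> w'" if "S \<in> F" for S
      using F(3)[OF that] assms(2) by auto
    show "c + r * f x = c + r * \<mu> + (\<Sum>S\<in>F. (r * cf S) * walsh S x)" if "x \<in> {0..<1}" for x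
      unfolding F(4)[OF that] by (simp add: distrib_left sum_distrib_left mult.assoc)
  qed
qed

lemma walsh_span_in_cell:
  assumes "b < 2 ^ a"
  shows "walsh_span (2 * a) (1 / 2 ^ a) (in_cell (a, b))"
proof -
  obtain cf where cf: "cf {} = 1 / 2 ^ a" "\<And>x. x \<in> {0..<1} \<Longrightarrow> in_cell (a, b) x = (\<Sum>S\<in>Pow {1..a}. cf S * walsh S x)"
    using in_cell_walsh[OF assms] by blast
  show ?thesis
  proof (rule walsh_spanI[where F = "Pow {1..a} - {{}}"])
    show "finite S \<and> S \<subseteq> {1..} \<and> top_two_sum S \<le> 2 * a" if "S \<in> Pow {1..a} - {{}}" for S
    proof -
      have "S \<subseteq> {1..a}"
        using that by auto
      then have "finite S" "S \<subseteq> {1..}"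
        by (auto intro: finite_subset)
      moreover have "top_two_sum S \<le> a + a"
        by (rule top_two_sum_le[OF \<open>finite S\<close>]) (use \<open>S \<subseteq> {1..a}\<close> in auto)
      ultimately show ?thesis
        by simp
    qed
    show "in_cell (a, b) x = 1 / 2 ^ a + (\<Sum>S\<in>Pow {1..a} - {{}}. cf S * walsh S x)" if "x \<in> {0..<1}" for x
      unfolding cf(2)[OF that] by (subst sum.remove[of _ "{}"]) (simp_all add: cf(1) walsh_def)
  qed simp_all
qed

text \<open>
  Apart from the factor \<open>2\<^sup>-\<^sup>(\<^sup>a\<^sup>+\<^sup>1\<^sup>+\<^sup>c\<^sup>)\<close> these are the terms of the expansion of a centred hat.
  The term \<open>c = 1\<close> collects the mean and the cell indicator; it is the only one whose two
  digit signs would coincide and cancel.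
\<close>

definition digit_term :: "nat \<times> nat \<Rightarrow> nat \<Rightarrow> real \<Rightarrow> real" where
  "digit_term I c x = (if c = 1 then 1 / 2 ^ fst I - in_cell I x
     else in_cell I x * (digit_sign (fst I + 1) x * digit_sign (fst I + c) x))"

text \<open>
  The indicator of the cell involves the digits \<open>1, \<dots>, a\<close>; the two additional digits \<open>a + 1\<close> and
  \<open>a + c\<close> are then the largest ones. Both kinds of terms have mean zero.
\<close>

lemma walsh_span_digit_term:
  assumes "b < 2 ^ a" "1 \<le> c"
  shows "walsh_span (2 * a + c + 1) 0 (digit_term (a, b) c)"
proof (cases "c = 1")
  case True
  then have "digit_term (a, b) c = (\<lambda>x. 1 / 2 ^ a + (- 1) * in_cell (a, b) x)"
    by (simp add: digit_term_def fun_eq_iff)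
  then show ?thesis
    using walsh_span_affine[OF walsh_span_in_cell[OF assms(1)], of "2 * a + c + 1" "1 / 2 ^ a" "- 1"] by simp
next
  case False
  with assms have c: "2 \<le> c"
    by simp
  obtain cf where cf: "\<And>x. x \<in> {0..<1} \<Longrightarrow> in_cell (a, b) x = (\<Sum>S\<in>Pow {1..a}. cf S * walsh S x)"
    using in_cell_walsh[OF assms(1)] by blast
  let ?u = "\<lambda>S. insert (a + 1) (insert (a + c) S)"
  have restrict: "?u S \<inter> {1..a} = S" if "S \<in> Pow {1..a}" for S
    using that c by auto
  have freq: "finite (?u S) \<and> ?u S \<subseteq> {1..} \<and> top_two_sum (?u S) \<le> 2 * a + c + 1" if "S \<in> Pow {1..a}" for S
  proof -
    have S: "finite S" "\<And>i. i \<in> S \<Longrightarrow> 1 \<le> i \<and> i \<le> a"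
      using that by (auto intro: finite_subset)
    then have fin: "finite (?u S)"
      by simp
    have "top_two_sum (?u S) \<le> (a + c) + (a + 1)"
    proof (rule top_two_sum_le[OF fin])
      show "i \<le> a + c" if "i \<in> ?u S" for i
        using that S(2)[of i] c by auto
      show "i \<le> a + 1" if "i \<in> ?u S" "k \<in> ?u S" "i < k" for i k
        using that S(2)[of i] S(2)[of k] c by auto
    qed
    moreover have "?u S \<subseteq> {1..}"
      using S(2) c by auto
    ultimately show ?thesis
      using fin by simp
  qed
  show ?thesis
  proof (rule walsh_spanI[where F = "?u ` Pow {1..a}"])
    show "finite T \<and> T \<subseteq> {1..} \<and> top_two_sum T \<le> 2 * a + c + 1" if "T \<in> ?u ` Pow {1..a}" for T
      using that by (rule imageE) (simp only: freq)
    show "digit_term (a, b) c x = 0 + (\<Sum>T\<in>?u ` Pow {1..a}. cf (T \<inter> {1..a}) * walsh T x)" if "x \<in> {0..<1}" for x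
    proof -
      have "inj_on ?u (Pow {1..a})"
        by (rule inj_on_inverseI[where g = "\<lambda>T. T \<inter> {1..a}"]) (rule restrict)
      then have "(\<Sum>T\<in>?u ` Pow {1..a}. cf (T \<inter> {1..a}) * walsh T x) = (\<Sum>S\<in>Pow {1..a}. cf (?u S \<inter> {1..a}) * walsh (?u S) x)"
        by (simp only: sum.reindex o_def)
      also have "\<dots> = (\<Sum>S\<in>Pow {1..a}. cf S * walsh S x * (digit_sign (a + 1) x * digit_sign (a + c) x))"
      proof (rule sum.cong[OF refl])
        fix S assume S: "S \<in> Pow {1..a}"
        then have "finite S" "a + c \<notin> S" "a + 1 \<notin> insert (a + c) S"
          using c by (auto intro: finite_subset)
        then have "walsh (?u S) x = digit_sign (a + 1) x * (digit_sign (a + c) x * walsh S x)"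
          unfolding walsh_def by simp
        then show "cf (?u S \<inter> {1..a}) * walsh (?u S) x = cf S * walsh S x * (digit_sign (a + 1) x * digit_sign (a + c) x)"
          unfolding restrict[OF S] by (simp only: mult_ac)
      qed
      also have "\<dots> = in_cell (a, b) x * (digit_sign (a + 1) x * digit_sign (a + c) x)"
        unfolding cf[OF that] by (simp only: sum_distrib_right)
      finally show ?thesis
        using c by (simp add: digit_term_def)
    qed
  qed auto
qed

text \<open>
  On a dyadic block the coordinates of the points behave like independent variables, as long as
  the weights allow it: after expansion into characters only the constant one survives.
\<close>

lemma walsh_span_block_sum:
  fixes E :: "'d::finite \<Rightarrow> bit_matrix"
  assumes E: "order_digital_sequence 2 t E"
    and span: "\<And>j. j \<in> v \<Longrightarrow> walsh_span (w j) (\<mu> j) (f j)"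
    and weight: "(\<Sum>j\<in>v. w j) + t \<le> 2 * m"
  shows "(\<Sum>k\<in>block m q. \<Prod>j\<in>v. f j (digital_sequence E k $ j)) = 2 ^ m * (\<Prod>j\<in>v. \<mu> j)"
proof -
  have "\<forall>j\<in>v. \<exists>F cf. finite F \<and> {} \<notin> F \<and> (\<forall>S\<in>F. finite S \<and> S \<subseteq> {1..} \<and> top_two_sum S \<le> w j) \<and>
     (\<forall>x\<in>{0..<1}. f j x = \<mu> j + (\<Sum>S\<in>F. cf S * walsh S x))"
    using span unfolding walsh_span_def by blast
  from bchoice[OF this] obtain F where "\<forall>j\<in>v. \<exists>cf. finite (F j) \<and> {} \<notin> F j \<and>
     (\<forall>S\<in>F j. finite S \<and> S \<subseteq> {1..} \<and> top_two_sum S \<le> w j) \<and>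
     (\<forall>x\<in>{0..<1}. f j x = \<mu> j + (\<Sum>S\<in>F j. cf S * walsh S x))" ..
  from bchoice[OF this] obtain cf where Fcf: "\<forall>j\<in>v. finite (F j) \<and> {} \<notin> F j \<and>
     (\<forall>S\<in>F j. finite S \<and> S \<subseteq> {1..} \<and> top_two_sum S \<le> w j) \<and>
     (\<forall>x\<in>{0..<1}. f j x = \<mu> j + (\<Sum>S\<in>F j. cf j S * walsh S x))" ..
  have F: "finite (F j)" "{} \<notin> F j" "\<And>S. S \<in> F j \<Longrightarrow> finite S \<and> S \<subseteq> {1..} \<and> top_two_sum S \<le> w j"
    "\<And>x. x \<in> {0..<1} \<Longrightarrow> f j x = \<mu> j + (\<Sum>S\<in>F j. cf j S * walsh S x)" if "j \<in> v" for j
    using bspec[OF Fcf that] by blast+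
  define cf' where "cf' j S = (if S = {} then \<mu> j else cf j S)" for j S
  let ?F = "\<lambda>j. insert {} (F j)"
  let ?x = "\<lambda>k j. digital_sequence E k $ j"
  have x: "?x k j \<in> {0..<1}" for k j
    using E by (intro digital_sequence_digits(1)) (simp add: order_digital_sequence_def)
  have f: "f j x = (\<Sum>S\<in>?F j. cf' j S * walsh S x)" if "j \<in> v" "x \<in> {0..<1}" for j x
  proof -
    have "(\<Sum>S\<in>F j. cf j S * walsh S x) = (\<Sum>S\<in>F j. cf' j S * walsh S x)"
      using F(2)[OF that(1)] by (intro sum.cong refl) (auto simp: cf'_def)
    then show ?thesis
      using F(1,2)[OF that(1)] F(4)[OF that] by (simp add: cf'_def walsh_def)
  qed
  \<comment> \<open>The selection of the constant character in every coordinate.\<close>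
  define e where "e = (\<lambda>j\<in>v. {} :: nat set)"
  have e: "e \<in> PiE v ?F"
    by (auto simp: e_def)
  have vanish: "(\<Sum>k\<in>block m q. \<Prod>j\<in>v. walsh (g j) (?x k j)) = 0" if g: "g \<in> PiE v ?F" "g \<noteq> e" for g
  proof -
    define S where "S j = (if j \<in> v then g j else {})" for j
    have gF: "g j \<in> ?F j" if "j \<in> v" for j
      using g(1) that by (rule PiE_mem)
    obtain j0 where j0: "j0 \<in> v" "g j0 \<noteq> {}"
    proof (rule ccontr)
      assume "\<not> thesis"
      then have "g j = {}" if "j \<in> v" for j
        using that \<open>\<And>j0. j0 \<in> v \<Longrightarrow> g j0 \<noteq> {} \<Longrightarrow> thesis\<close> by blast
      then have "g = e"
        using g(1) by (auto simp: e_def PiE_def extensional_def fun_eq_iff)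
      with g(2) show False ..
    qed
    have S: "finite (S j) \<and> S j \<subseteq> {1..} \<and> top_two_sum (S j) \<le> (if j \<in> v then w j else 0)" for j
      using gF[of j] F(3)[of j "g j"] by (auto simp: S_def top_two_sum_def)
    have "(\<Prod>j\<in>UNIV. walsh (S j) (?x k j)) = (\<Prod>j\<in>v. walsh (g j) (?x k j))" for k
      by (rule prod.mono_neutral_cong_right) (auto simp: S_def walsh_def)
    moreover have "(\<Sum>k\<in>block m q. \<Prod>j\<in>UNIV. walsh (S j) (?x k j)) = 0"
    proof (rule walsh_sum_vanishes[OF E])
      show "S j0 \<noteq> {}"
        using j0 by (simp add: S_def)
      have "(\<Sum>j\<in>UNIV. top_two_sum (S j)) \<le> (\<Sum>j\<in>UNIV. if j \<in> v then w j else 0)"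
        using S by (intro sum_mono) blast
      also have "\<dots> = (\<Sum>j\<in>v. w j)"
        by (rule sum.mono_neutral_cong_right) auto
      finally show "(\<Sum>j\<in>UNIV. top_two_sum (S j)) + t \<le> 2 * m"
        using weight by linarith
    qed (use S in blast)+
    ultimately show ?thesis
      by (simp only:)
  qed
  have "(\<Sum>k\<in>block m q. \<Prod>j\<in>v. f j (?x k j)) = (\<Sum>k\<in>block m q. \<Prod>j\<in>v. \<Sum>S\<in>?F j. cf' j S * walsh S (?x k j))"
    by (intro sum.cong prod.cong refl f x)
  also have "\<dots> = (\<Sum>k\<in>block m q. \<Sum>g\<in>PiE v ?F. \<Prod>j\<in>v. cf' j (g j) * walsh (g j) (?x k j))"
    using F(1) by (subst prod_sum_PiE) auto
  also have "\<dots> = (\<Sum>g\<in>PiE v ?F. \<Sum>k\<in>block m q. \<Prod>j\<in>v. cf' j (g j) * walsh (g j) (?x k j))"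
    by (rule sum.swap)
  also have "\<dots> = (\<Sum>g\<in>PiE v ?F. (\<Prod>j\<in>v. cf' j (g j)) * (\<Sum>k\<in>block m q. \<Prod>j\<in>v. walsh (g j) (?x k j)))"
    by (simp only: prod.distrib sum_distrib_left)
  also have "\<dots> = (\<Sum>g\<in>{e}. (\<Prod>j\<in>v. cf' j (g j)) * (\<Sum>k\<in>block m q. \<Prod>j\<in>v. walsh (g j) (?x k j)))"
  proof (rule sum.mono_neutral_right)
    show "finite (PiE v ?F)"
      using F(1) by (intro finite_PiE) auto
    show "\<forall>g\<in>PiE v ?F - {e}. (\<Prod>j\<in>v. cf' j (g j)) * (\<Sum>k\<in>block m q. \<Prod>j\<in>v. walsh (g j) (?x k j)) = 0"
      using vanish by auto
  qed (use e in simp)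
  also have "\<dots> = (\<Prod>j\<in>v. \<mu> j) * 2 ^ m"
    by (simp add: e_def cf'_def walsh_def)
  finally show ?thesis
    by (simp only: mult.commute)
qed

lemma digit_sign_frac:
  assumes "1 \<le> c"
  shows "digit_sign c (frac (2 ^ a * x)) = digit_sign (a + c) x"
proof -
  have "2 ^ c * frac (2 ^ a * x) = 2 ^ (a + c) * x - of_int (2 ^ c * \<lfloor>2 ^ a * x\<rfloor>)"
    by (simp add: frac_def power_add algebra_simps)
  then have "\<lfloor>2 ^ c * frac (2 ^ a * x)\<rfloor> = \<lfloor>2 ^ (a + c) * x\<rfloor> - 2 ^ c * \<lfloor>2 ^ a * x\<rfloor>"
    by (simp only: floor_diff_of_int)
  then show ?thesis
    using assms by (simp add: digit_sign_def)
qed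

lemma digit_sign_series:
  assumes "0 \<le> y" "y < 1"
  shows "(\<lambda>Q. \<Sum>c = 1..Q. digit_sign c y / 2 ^ c) \<longlonglongrightarrow> 1 - 2 * y"
proof -
  have partial: "(\<Sum>c = 1..Q. digit_sign c y / 2 ^ c) = 1 - 2 * y + (2 * frac (2 ^ Q * y) - 1) / 2 ^ Q" for Q
  proof (induction Q)
    case 0
    then show ?case
      using assms by (simp add: frac_eq)
  next
    case (Suc Q)
    let ?u = "frac (2 ^ Q * y)"
    have "digit_sign (Suc Q) y = (if ?u < 1 / 2 then 1 else - 1)"
      unfolding digit_sign_def doubling_floor floor_double_frac by simp
    moreover have "frac (2 ^ Suc Q * y) = (if ?u < 1 / 2 then 2 * ?u else 2 * ?u - 1)"
      unfolding doubling_frac by (rule frac_double) (auto simp: frac_lt_1)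
    ultimately show ?case
      using Suc.IH by (auto simp: field_simps)
  qed
  have "(\<lambda>Q. (2 * frac (2 ^ Q * y) - 1) / 2 ^ Q) \<longlonglongrightarrow> 0"
  proof (rule Lim_null_comparison)
    show "\<forall>\<^sub>F Q in sequentially. norm ((2 * frac (2 ^ Q * y) - 1) / 2 ^ Q) \<le> (1 / 2) ^ Q"
    proof (rule always_eventually, rule allI)
      fix Q
      have "\<bar>2 * frac (2 ^ Q * y) - 1\<bar> \<le> 1"
        using frac_ge_0[of "2 ^ Q * y"] frac_lt_1[of "2 ^ Q * y"] by linarith
      then show "norm ((2 * frac (2 ^ Q * y) - 1) / 2 ^ Q) \<le> (1 / 2) ^ Q"
        by (simp add: power_one_over divide_right_mono)
    qed
    show "(\<lambda>Q. (1 / 2 :: real) ^ Q) \<longlonglongrightarrow> 0"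
      by (rule LIMSEQ_power_zero) simp
  qed
  then have "(\<lambda>Q. 1 - 2 * y + (2 * frac (2 ^ Q * y) - 1) / 2 ^ Q) \<longlonglongrightarrow> 1 - 2 * y + 0"
    by (intro tendsto_add tendsto_const)
  then show ?thesis
    unfolding partial by simp
qed

text \<open>
  On the half where the leading digit sign is \<open>s\<close>, the tent is \<open>(1 - s (1 - 2 y)) / 2\<close>, and
  \<open>1 - 2 y\<close> is the series of the digit signs of \<open>y\<close>. Thus every further digit sign occurs multiplied
  by the first one.
\<close>

lemma digit_term_series:
  assumes "x \<in> {0..<1}"
  shows "(\<lambda>Q. \<Sum>c = 1..Q. digit_term I c x / 2 ^ (fst I + 1 + c)) \<longlonglongrightarrow> centred_hat I x"
proof -
  let ?a = "fst I" and ?y = "frac (2 ^ fst I * x)"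
  let ?s = "digit_sign 1 ?y"
  have y: "0 \<le> ?y" "?y < 1"
    by (auto simp: frac_lt_1)
  have s: "?s = (if ?y < 1 / 2 then 1 else - 1)"
    using doubling_floor[of 0 ?y] floor_double_frac[of ?y] y by (simp add: digit_sign_def frac_eq)
  have head: "(\<Sum>c = 1..Suc Q. f c) = f 1 + (\<Sum>c = 2..Suc Q. f c)" for f :: "nat \<Rightarrow> real" and Q
    by (subst sum.atLeast_Suc_atMost) (simp_all add: numeral_2_eq_2)
  have eq: "(\<Sum>c = 1..Suc Q. digit_term I c x / 2 ^ (?a + 1 + c))
      = (1 / 2 ^ ?a - in_cell I x) / 2 ^ (?a + 2) + in_cell I x / 2 ^ (?a + 1) * (?s * ((\<Sum>c = 1..Suc Q. digit_sign c ?y / 2 ^ c) - ?s / 2))" for Q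
  proof -
    have "(\<Sum>c = 2..Suc Q. digit_term I c x / 2 ^ (?a + 1 + c)) = (\<Sum>c = 2..Suc Q. in_cell I x / 2 ^ (?a + 1) * (?s * (digit_sign c ?y / 2 ^ c)))"
      by (intro sum.cong refl) (simp add: digit_term_def digit_sign_frac power_add)
    also have "\<dots> = in_cell I x / 2 ^ (?a + 1) * (?s * (\<Sum>c = 2..Suc Q. digit_sign c ?y / 2 ^ c))"
      by (simp only: sum_distrib_left)
    also have "(\<Sum>c = 2..Suc Q. digit_sign c ?y / 2 ^ c) = (\<Sum>c = 1..Suc Q. digit_sign c ?y / 2 ^ c) - ?s / 2"
      unfolding head[of "\<lambda>c. digit_sign c ?y / 2 ^ c"] by simp
    finally show ?thesis
      unfolding head[of "\<lambda>c. digit_term I c x / 2 ^ (?a + 1 + c)"] by (simp add: digit_term_def)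
  qed
  have "(\<lambda>Q. (1 / 2 ^ ?a - in_cell I x) / 2 ^ (?a + 2) + in_cell I x / 2 ^ (?a + 1) * (?s * ((\<Sum>c = 1..Suc Q. digit_sign c ?y / 2 ^ c) - ?s / 2)))
      \<longlonglongrightarrow> (1 / 2 ^ ?a - in_cell I x) / 2 ^ (?a + 2) + in_cell I x / 2 ^ (?a + 1) * (?s * ((1 - 2 * ?y) - ?s / 2))"
    by (intro tendsto_add tendsto_mult tendsto_diff tendsto_const LIMSEQ_Suc[OF digit_sign_series[OF y]])
  also have "(1 / 2 ^ ?a - in_cell I x) / 2 ^ (?a + 2) + in_cell I x / 2 ^ (?a + 1) * (?s * ((1 - 2 * ?y) - ?s / 2)) = centred_hat I x"
  proof -
    have "(4 :: real) ^ ?a = 2 ^ ?a * 2 ^ ?a"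
      by (simp add: power_mult_distrib[symmetric])
    then show ?thesis
      unfolding s by (simp add: centred_hat_def hat_def hat_height_def tent_if field_simps)
  qed
  finally show ?thesis
    unfolding eq[symmetric] by (rule LIMSEQ_imp_Suc)
qed

section \<open>Hat sums along order-2 digital sequences\<close>

lemma in_cell_nonneg: "0 \<le> in_cell I x"
  by (simp add: in_cell_def)

text \<open>
  Read without the mean terms, this says that a box of level \<open>l\<close> contains its fair share
  \<open>2\<^sup>m\<^sup>-\<^sup>l\<close> of the points of every block of length \<open>2\<^sup>m\<close>, \<open>2 m \<ge> 2 l + t\<close>. The product with the
  mean added in each coordinate covers all projections of the box at once.
\<close>

lemma cell_count:
  fixes E :: "'d::finite \<Rightarrow> bit_matrix"
  assumes E: "order_digital_sequence 2 t E" and I: "\<And>j. j \<in> v \<Longrightarrow> snd (I j) < 2 ^ fst (I j)"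
    and m: "2 * level v I + t \<le> 2 * m"
  shows "(\<Sum>k\<in>block m q. \<Prod>j\<in>v. 1 / 2 ^ fst (I j) + in_cell (I j) (digital_sequence E k $ j))
    = 2 ^ m * (2 ^ card v / 2 ^ level v I)"
proof -
  have "(\<Sum>k\<in>block m q. \<Prod>j\<in>v. 1 / 2 ^ fst (I j) + in_cell (I j) (digital_sequence E k $ j))
      = 2 ^ m * (\<Prod>j\<in>v. 2 / 2 ^ fst (I j))"
  proof (rule walsh_span_block_sum[OF E])
    show "walsh_span (2 * fst (I j)) (2 / 2 ^ fst (I j)) (\<lambda>x. 1 / 2 ^ fst (I j) + in_cell (I j) x)" if "j \<in> v" for j
      using walsh_span_affine[OF walsh_span_in_cell[OF I[OF that]] order_refl, of "1 / 2 ^ fst (I j)" 1] by simp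
    show "(\<Sum>j\<in>v. 2 * fst (I j)) + t \<le> 2 * m"
      using m by (simp add: level_def sum_distrib_left)
  qed
  then show ?thesis
    by (simp add: prod_dividef power_level)
qed

lemma abs_digit_term_le:
  "\<bar>digit_term I c x\<bar> \<le> 1 / 2 ^ fst I + in_cell I x"
  by (auto simp: digit_term_def in_cell_def digit_sign_def)

lemma abs_centred_hat_le:
  "\<bar>centred_hat I x\<bar> \<le> (1 / 2 ^ fst I) * (1 / 2 ^ fst I + in_cell I x)"
proof -
  have "(4 :: real) ^ fst I = 2 ^ fst I * 2 ^ fst I"
    by (simp add: power_mult_distrib[symmetric])
  then have "\<bar>1 / 4 ^ (fst I + 1) :: real\<bar> \<le> 1 / 2 ^ fst I * (1 / 2 ^ fst I)"
    by (simp add: field_simps)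
  moreover have "\<bar>hat I x\<bar> \<le> in_cell I x * (1 / 2 ^ fst I)"
    unfolding hat_def abs_mult using hat_height_bounds[of "fst I" x] in_cell_nonneg[of I x]
    by (intro mult_mono) auto
  moreover have "\<bar>centred_hat I x\<bar> \<le> \<bar>1 / 4 ^ (fst I + 1)\<bar> + \<bar>hat I x\<bar>"
    unfolding centred_hat_def by (rule abs_triangle_ineq4)
  moreover have "1 / 2 ^ fst I * (1 / 2 ^ fst I + in_cell I x) = 1 / 2 ^ fst I * (1 / 2 ^ fst I) + in_cell I x * (1 / 2 ^ fst I)"
    by (simp only: distrib_left mult.commute)
  ultimately show ?thesis
    by linarith
qed

text \<open>
  The estimate by absolute values. It serves for the incomplete last block, whose length is
  comparable to the resolution of the box.
\<close>

lemma partial_block_estimate: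
  fixes E :: "'d::finite \<Rightarrow> bit_matrix"
  assumes E: "order_digital_sequence 2 t E" and I: "\<And>j. j \<in> v \<Longrightarrow> snd (I j) < 2 ^ fst (I j)"
    and m: "2 * level v I + t \<le> 2 * m" and K: "K \<subseteq> block m q"
  shows "\<bar>\<Sum>k\<in>K. \<Prod>j\<in>v. centred_hat (I j) (digital_sequence E k $ j)\<bar> \<le> 2 ^ card v * (2 ^ m / 4 ^ level v I)"
proof -
  let ?c = "\<lambda>k j. 1 / 2 ^ fst (I j) + in_cell (I j) (digital_sequence E k $ j)"
  have "\<bar>\<Sum>k\<in>K. \<Prod>j\<in>v. centred_hat (I j) (digital_sequence E k $ j)\<bar>
      \<le> (\<Sum>k\<in>K. \<bar>\<Prod>j\<in>v. centred_hat (I j) (digital_sequence E k $ j)\<bar>)"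
    by (rule sum_abs)
  also have "\<dots> \<le> (\<Sum>k\<in>block m q. \<bar>\<Prod>j\<in>v. centred_hat (I j) (digital_sequence E k $ j)\<bar>)"
    using K by (intro sum_mono2) auto
  also have "\<dots> \<le> (\<Sum>k\<in>block m q. \<Prod>j\<in>v. (1 / 2 ^ fst (I j)) * ?c k j)"
    unfolding abs_prod by (intro sum_mono prod_mono conjI abs_centred_hat_le) simp
  also have "\<dots> = (1 / 2 ^ level v I) * (\<Sum>k\<in>block m q. \<Prod>j\<in>v. ?c k j)"
    unfolding prod.distrib by (simp add: sum_distrib_left prod_dividef power_level)
  also have "\<dots> = 2 ^ card v * (2 ^ m / 4 ^ level v I)"
  proof -
    have "(4 :: real) ^ level v I = 2 ^ level v I * 2 ^ level v I"
      by (simp add: power_mult_distrib[symmetric])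
    moreover have "(\<Sum>k\<in>block m q. \<Prod>j\<in>v. ?c k j) = 2 ^ m * (2 ^ card v / 2 ^ level v I)"
      by (rule cell_count[OF E I m])
    ultimately show ?thesis
      by (simp only:) (simp add: field_simps)
  qed
  finally show ?thesis .
qed

text \<open>
  A choice \<open>c\<close> of terms with \<open>\<Sum> (2 a\<^sub>j + c\<^sub>j + 1) + t \<le> 2 m\<close> contributes nothing. Every other choice has
  \<open>\<Sum> (c\<^sub>j + 1) \<ge> R\<close> with \<open>R = 2 m - t - 2 l\<close>, and its coefficient is \<open>2\<^sup>-\<^sup>\<Sigma>\<^sup>c\<close>. Inserting the factor
  \<open>(3/2)\<^bsup>\<Sum>(c\<^sub>j + 1) - R\<^esup> \<ge> 1\<close> makes the sum over the choices a product of geometric series. The base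
  \<open>3/2\<close> may be any number between \<open>\<surd>2\<close> and \<open>2\<close>: below \<open>2\<close> for these series to
  converge, above \<open>\<surd>2\<close> for the bounds to decay from one block length to the next.
\<close>

lemma block_estimate:
  fixes E :: "'d::finite \<Rightarrow> bit_matrix"
  assumes E: "order_digital_sequence 2 t E" and I: "\<And>j. j \<in> v \<Longrightarrow> snd (I j) < 2 ^ fst (I j)"
    and m: "2 * level v I + t \<le> 2 * m" and v: "v \<noteq> {}"
  shows "\<bar>\<Sum>k\<in>block m q. \<Prod>j\<in>v. centred_hat (I j) (digital_sequence E k $ j)\<bar>
    \<le> (9 / 2) ^ card v * (2 ^ m / 4 ^ level v I) * (2 / 3) ^ (2 * m - t - 2 * level v I)"
proof -
  let ?x = "\<lambda>k j. digital_sequence E k $ j"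
  let ?R = "2 * m - t - 2 * level v I"
  let ?B = "2 ^ m / 4 ^ level v I * (2 / 3) ^ ?R :: real"
  have x: "?x k j \<in> {0..<1}" for k j
    using E by (intro digital_sequence_digits(1)) (simp add: order_digital_sequence_def)
  define T where "T c = (\<Sum>k\<in>block m q. \<Prod>j\<in>v. digit_term (I j) (c j) (?x k j) / 2 ^ (fst (I j) + 1 + c j))" for c
  have four: "(4 :: real) ^ level v I = 2 ^ level v I * 2 ^ level v I"
    by (simp add: power_mult_distrib[symmetric])
  have single: "\<bar>T c\<bar> \<le> ?B * (\<Prod>j\<in>v. (3 / 2) ^ (c j + 1) / 2 ^ c j)" if c: "\<And>j. j \<in> v \<Longrightarrow> 1 \<le> c j" for c
  proof -
    let ?p = "\<Prod>j\<in>v. 1 / 2 ^ (fst (I j) + 1 + c j) :: real"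
    have T: "T c = ?p * (\<Sum>k\<in>block m q. \<Prod>j\<in>v. digit_term (I j) (c j) (?x k j))"
      by (simp add: T_def prod_dividef sum_divide_distrib)
    show ?thesis
    proof (cases "(\<Sum>j\<in>v. 2 * fst (I j) + c j + 1) + t \<le> 2 * m")
      case True
      have "(\<Sum>k\<in>block m q. \<Prod>j\<in>v. digit_term (I j) (c j) (?x k j)) = 2 ^ m * (\<Prod>j\<in>v. 0)"
      proof (rule walsh_span_block_sum[OF E _ True])
        show "walsh_span (2 * fst (I j) + c j + 1) 0 (digit_term (I j) (c j))" if "j \<in> v" for j
          using walsh_span_digit_term[OF I[OF that] c[OF that]] by simp
      qed
      then have "T c = 0"
        using v by (simp add: T card_gt_0_iff)
      then show ?thesis
        by (simp add: prod_nonneg)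
    next
      case False
      let ?w = "\<Sum>j\<in>v. c j + 1"
      have "(\<Sum>j\<in>v. 2 * fst (I j) + c j + 1) = 2 * level v I + ?w"
        unfolding level_def sum_distrib_left sum.distrib[symmetric] by (intro sum.cong) simp_all
      with False have R: "?R \<le> ?w"
        by linarith
      have "(1 :: real) = (2 / 3) ^ ?R * (3 / 2) ^ ?R"
        by (simp add: power_mult_distrib[symmetric])
      also have "\<dots> \<le> (2 / 3) ^ ?R * (3 / 2) ^ ?w"
        using R by (intro mult_left_mono power_increasing) auto
      finally have one: "1 \<le> (2 / 3) ^ ?R * (\<Prod>j\<in>v. (3 / 2 :: real) ^ (c j + 1))"
        by (simp only: power_sum)
      have "\<bar>T c\<bar> = ?p * \<bar>\<Sum>k\<in>block m q. \<Prod>j\<in>v. digit_term (I j) (c j) (?x k j)\<bar>"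
        unfolding T abs_mult by (simp add: prod_nonneg)
      also have "\<dots> \<le> ?p * (\<Sum>k\<in>block m q. \<Prod>j\<in>v. 1 / 2 ^ fst (I j) + in_cell (I j) (?x k j))"
      proof (intro mult_left_mono order_trans[OF sum_abs] sum_mono)
        show "\<bar>\<Prod>j\<in>v. digit_term (I j) (c j) (?x k j)\<bar> \<le> (\<Prod>j\<in>v. 1 / 2 ^ fst (I j) + in_cell (I j) (?x k j))" for k
          unfolding abs_prod by (intro prod_mono conjI abs_digit_term_le) simp
      qed (simp add: prod_nonneg)
      also have "\<dots> = (2 ^ m / 4 ^ level v I) * (\<Prod>j\<in>v. 1 / 2 ^ c j) * 1"
      proof -
        have "(\<Sum>k\<in>block m q. \<Prod>j\<in>v. 1 / 2 ^ fst (I j) + in_cell (I j) (?x k j)) = 2 ^ m * (2 ^ card v / 2 ^ level v I)"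
          by (rule cell_count[OF E I m])
        moreover have "?p = (\<Prod>j\<in>v. (1 / 2 ^ fst (I j)) * (1 / 2) * (1 / 2 ^ c j))"
          by (simp add: power_add mult_ac)
        moreover have "\<dots> = (1 / 2 ^ level v I) * (1 / 2 ^ card v) * (\<Prod>j\<in>v. 1 / 2 ^ c j)"
          unfolding prod.distrib by (simp add: prod_dividef power_level power_one_over)
        ultimately show ?thesis
          by (simp only: four) (simp add: field_simps)
      qed
      also have "\<dots> \<le> (2 ^ m / 4 ^ level v I) * (\<Prod>j\<in>v. 1 / 2 ^ c j) * ((2 / 3) ^ ?R * (\<Prod>j\<in>v. (3 / 2 :: real) ^ (c j + 1)))"
        by (intro mult_left_mono one) (simp add: prod_nonneg)
      also have "\<dots> = ?B * (\<Prod>j\<in>v. (3 / 2) ^ (c j + 1) / 2 ^ c j)"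
      proof -
        have "(\<Prod>j\<in>v. (3 / 2 :: real) ^ (c j + 1) / 2 ^ c j) = (\<Prod>j\<in>v. 1 / 2 ^ c j) * (\<Prod>j\<in>v. (3 / 2) ^ (c j + 1))"
          unfolding prod.distrib[symmetric] by (simp add: mult_ac)
        then show ?thesis
          by (simp only: mult_ac)
      qed
      finally show ?thesis .
    qed
  qed
  have geo: "(\<Sum>c = 1..Q. (3 / 2) ^ (c + 1) / 2 ^ c) \<le> (9 / 2 :: real)" for Q
  proof -
    have "(\<Sum>c = 1..Q. (3 / 2) ^ (c + 1) / 2 ^ c) = (9 / 2 :: real) * (1 - (3 / 4) ^ Q)"
      by (induction Q) (simp_all add: field_simps power_divide power_mult_distrib[symmetric])
    also have "\<dots> \<le> 9 / 2"
      by simp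
    finally show ?thesis .
  qed
  have partial: "\<bar>\<Sum>k\<in>block m q. \<Prod>j\<in>v. \<Sum>c = 1..Q. digit_term (I j) c (?x k j) / 2 ^ (fst (I j) + 1 + c)\<bar> \<le> ?B * (9 / 2) ^ card v" for Q
  proof -
    have "(\<Sum>k\<in>block m q. \<Prod>j\<in>v. \<Sum>c = 1..Q. digit_term (I j) c (?x k j) / 2 ^ (fst (I j) + 1 + c))
        = (\<Sum>k\<in>block m q. \<Sum>c\<in>PiE v (\<lambda>_. {1..Q}). \<Prod>j\<in>v. digit_term (I j) (c j) (?x k j) / 2 ^ (fst (I j) + 1 + c j))"
      by (subst prod_sum_PiE) simp_all
    also have "\<dots> = (\<Sum>c\<in>PiE v (\<lambda>_. {1..Q}). T c)"
      unfolding T_def by (rule sum.swap)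
    finally have "\<bar>\<Sum>k\<in>block m q. \<Prod>j\<in>v. \<Sum>c = 1..Q. digit_term (I j) c (?x k j) / 2 ^ (fst (I j) + 1 + c)\<bar>
        \<le> (\<Sum>c\<in>PiE v (\<lambda>_. {1..Q}). \<bar>T c\<bar>)"
      by (simp only: sum_abs)
    also have "\<dots> \<le> (\<Sum>c\<in>PiE v (\<lambda>_. {1..Q}). ?B * (\<Prod>j\<in>v. (3 / 2) ^ (c j + 1) / 2 ^ c j))"
    proof (intro sum_mono single)
      fix c j assume "c \<in> PiE v (\<lambda>_. {1..Q})" "j \<in> v"
      then have "c j \<in> {1..Q}"
        by (rule PiE_mem)
      then show "1 \<le> c j"
        by simp
    qed
    also have "\<dots> = ?B * (\<Sum>c\<in>PiE v (\<lambda>_. {1..Q}). \<Prod>j\<in>v. (3 / 2) ^ (c j + 1) / 2 ^ c j)"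
      by (simp only: sum_distrib_left)
    also have "(\<Sum>c\<in>PiE v (\<lambda>_. {1..Q}). \<Prod>j\<in>v. (3 / 2) ^ (c j + 1) / 2 ^ c j) = (\<Prod>j\<in>v. \<Sum>c = 1..Q. (3 / 2 :: real) ^ (c + 1) / 2 ^ c)"
      by (subst prod_sum_PiE) simp_all
    also have "?B * (\<Prod>j\<in>v. \<Sum>c = 1..Q. (3 / 2 :: real) ^ (c + 1) / 2 ^ c) \<le> ?B * (\<Prod>j\<in>v. 9 / 2)"
      by (intro mult_left_mono prod_mono conjI geo sum_nonneg) auto
    finally show ?thesis
      by (simp only: prod_constant)
  qed
  have "(\<lambda>Q. \<bar>\<Sum>k\<in>block m q. \<Prod>j\<in>v. \<Sum>c = 1..Q. digit_term (I j) c (?x k j) / 2 ^ (fst (I j) + 1 + c)\<bar>)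
      \<longlonglongrightarrow> \<bar>\<Sum>k\<in>block m q. \<Prod>j\<in>v. centred_hat (I j) (?x k j)\<bar>"
    by (intro tendsto_rabs tendsto_sum tendsto_prod digit_term_series x)
  then have "\<bar>\<Sum>k\<in>block m q. \<Prod>j\<in>v. centred_hat (I j) (?x k j)\<bar> \<le> ?B * (9 / 2) ^ card v"
    by (rule LIMSEQ_le_const2) (use partial in blast)
  then show ?thesis
    by (simp only: mult_ac)
qed

text \<open>
  The integers below \<open>N\<close> split, according to the binary expansion of \<open>N\<close>, into at most one block of each
  length \<open>2\<^sup>p\<^sup>+\<^sup>r\<close> and a remainder shorter than \<open>2\<^sup>p\<close>.
\<close>

lemma initial_sum_le_dyadic_blocks:
  fixes f :: "nat \<Rightarrow> real"
  assumes partial: "\<And>q K. K \<subseteq> block p q \<Longrightarrow> \<bar>\<Sum>k\<in>K. f k\<bar> \<le> B"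
    and full: "\<And>q r. \<bar>\<Sum>k\<in>block (p + r) q. f k\<bar> \<le> C * (8 / 9) ^ r"
  shows "\<bar>\<Sum>k<N. f k\<bar> \<le> B + 9 * C"
proof -
  \<comment> \<open>F r is the sum over the part of the integers below N that consists of complete
      blocks of length 2 ^ (p + r).\<close>
  define F where "F r = (\<Sum>k<N div 2 ^ (p + r) * 2 ^ (p + r). f k)" for r
  have step: "\<bar>F r\<bar> \<le> C * (8 / 9) ^ r + \<bar>F (Suc r)\<bar>" for r
  proof -
    let ?s = "p + r"
    let ?b = "N div 2 ^ Suc ?s * 2"
    have C0: "0 \<le> C * (8 / 9) ^ r"
      using full[where q = 0 and r = r] abs_ge_zero order_trans by blast
    have Suc: "F (Suc r) = (\<Sum>k<?b * 2 ^ ?s. f k)"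
      by (simp add: F_def mult.assoc)
    have "N div 2 ^ Suc ?s = N div 2 ^ ?s div 2"
      by (simp only: power_Suc2 div_mult2_eq)
    then consider "N div 2 ^ ?s = ?b" | "N div 2 ^ ?s = ?b + 1"
      by linarith
    then show ?thesis
    proof cases
      case 1
      then have "F r = F (Suc r)"
        unfolding Suc by (simp only: F_def)
      then show ?thesis
        using C0 by simp
    next
      case 2
      have "F r = (\<Sum>k<?b * 2 ^ ?s + 2 ^ ?s. f k)"
        unfolding F_def 2 by (simp only: distrib_right mult_1)
      also have "\<dots> = F (Suc r) + (\<Sum>k\<in>block ?s ?b. f k)"
        unfolding Suc block_eq lessThan_atLeast0 by (rule sum.atLeastLessThan_concat[symmetric]) simp_all
      finally show ?thesis
        using full[where q = ?b and r = r] by linarith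
    qed
  qed
  have "\<bar>F 0\<bar> \<le> (\<Sum>r<R. C * (8 / 9) ^ r) + \<bar>F R\<bar>" for R
  proof (induction R)
    case (Suc R)
    then show ?case
      using step[of R] by simp
  qed simp
  then have "\<bar>F 0\<bar> \<le> (\<Sum>r<N. C * (8 / 9) ^ r) + \<bar>F N\<bar>" .
  moreover have "F N = 0"
  proof -
    have "N < 2 ^ (p + N)"
      by (rule less_le_trans[OF less_exp power_increasing]) auto
    then show ?thesis
      by (simp add: F_def)
  qed
  moreover have "(\<Sum>r<N. C * (8 / 9) ^ r) \<le> 9 * C"
  proof -
    have C0: "0 \<le> C"
      using full[where q = 0 and r = 0] by simp
    have "(\<Sum>r<N. C * (8 / 9) ^ r) = 9 * C * (1 - (8 / 9) ^ N)"
      by (induction N) (simp_all add: algebra_simps)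
    also have "\<dots> \<le> 9 * C * 1"
      using C0 by (intro mult_left_mono) auto
    finally show ?thesis
      by simp
  qed
  moreover have "\<bar>\<Sum>k\<in>{N div 2 ^ p * 2 ^ p..<N}. f k\<bar> \<le> B"
  proof (rule partial)
    have "N < 2 ^ p + N div 2 ^ p * 2 ^ p"
      by (rule dividend_less_div_times) simp
    then show "{N div 2 ^ p * 2 ^ p..<N} \<subseteq> block p (N div 2 ^ p)"
      unfolding block_eq ivl_subset by (simp only: add.commute order_refl less_imp_le simp_thms)
  qed
  moreover have "(\<Sum>k<N. f k) = F 0 + (\<Sum>k\<in>{N div 2 ^ p * 2 ^ p..<N}. f k)"
    unfolding F_def add_0_right lessThan_atLeast0 by (rule sum.atLeastLessThan_concat[symmetric]) simp_all
  ultimately show ?thesis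
    by linarith
qed

text \<open>
  The splitting length \<open>2\<^sup>p\<close> is the smallest for which the block estimates apply,
  \<open>p = l + \<lceil>t/2\<rceil>\<close>. From one block length to the next the bound changes by the factor
  \<open>2 (2/3)\<^sup>2 = 8/9\<close>.
\<close>

lemma hat_sum_bound:
  fixes E :: "'d::finite \<Rightarrow> bit_matrix"
  assumes E: "order_digital_sequence 2 t E" and I: "\<And>j. j \<in> v \<Longrightarrow> snd (I j) < 2 ^ fst (I j)" and v: "v \<noteq> {}"
  shows "\<bar>hat_sum (digital_sequence E) v N I\<bar> \<le> 10 * (9 / 2) ^ card v * 2 ^ t / 2 ^ level v I"
proof -
  define p where "p = level v I + (t + 1) div 2"
  have p: "2 * level v I + t \<le> 2 * p"
    by (simp add: p_def)
  define C :: real where "C = (9 / 2) ^ card v * (2 ^ p / 4 ^ level v I)"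
  have "\<bar>hat_sum (digital_sequence E) v N I\<bar> \<le> 2 ^ card v * (2 ^ p / 4 ^ level v I) + 9 * C"
    unfolding hat_sum_def
  proof (rule initial_sum_le_dyadic_blocks)
    show "\<bar>\<Sum>k\<in>K. \<Prod>j\<in>v. centred_hat (I j) (digital_sequence E k $ j)\<bar> \<le> 2 ^ card v * (2 ^ p / 4 ^ level v I)"
      if "K \<subseteq> block p q" for q K
      by (rule partial_block_estimate[OF E I p that])
    show "\<bar>\<Sum>k\<in>block (p + r) q. \<Prod>j\<in>v. centred_hat (I j) (digital_sequence E k $ j)\<bar> \<le> C * (8 / 9) ^ r" for q r
    proof -
      have "\<bar>\<Sum>k\<in>block (p + r) q. \<Prod>j\<in>v. centred_hat (I j) (digital_sequence E k $ j)\<bar>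
          \<le> (9 / 2) ^ card v * (2 ^ (p + r) / 4 ^ level v I) * (2 / 3) ^ (2 * (p + r) - t - 2 * level v I)"
        using p by (intro block_estimate[OF E I _ v]) auto
      also have "\<dots> \<le> (9 / 2) ^ card v * (2 ^ (p + r) / 4 ^ level v I) * (2 / 3) ^ (2 * r)"
        using p by (intro mult_left_mono power_decreasing) auto
      also have "\<dots> = C * (8 / 9) ^ r"
      proof -
        have "(8 / 9 :: real) ^ r = (2 * (2 / 3)\<^sup>2) ^ r"
          by (simp add: power2_eq_square)
        also have "\<dots> = 2 ^ r * (2 / 3) ^ (2 * r)"
          unfolding power_mult_distrib power_mult ..
        finally show ?thesis
          by (simp add: C_def power_add)
      qed
      finally show ?thesis .
    qed
  qed
  also have "\<dots> \<le> C + 9 * C"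
    unfolding C_def by (intro add_mono mult_right_mono power_mono order_refl) auto
  also have "\<dots> = 10 * (9 / 2) ^ card v * (2 ^ ((t + 1) div 2) / 2 ^ level v I)"
  proof -
    have "(4 :: real) ^ level v I = 2 ^ level v I * 2 ^ level v I"
      by (simp add: power_mult_distrib[symmetric])
    then show ?thesis
      by (simp add: C_def p_def power_add)
  qed
  also have "\<dots> \<le> 10 * (9 / 2) ^ card v * (2 ^ t / 2 ^ level v I)"
    by (intro mult_left_mono divide_right_mono power_increasing) auto
  finally show ?thesis
    by simp
qed

section \<open>Energy of order-2 digital sequences\<close>

lemma sum_abs_centred_hat:
  assumes "x \<in> {0..<1}"
  shows "(\<Sum>b<2 ^ a. \<bar>centred_hat (a, b) x\<bar>) \<le> 1 / 2 ^ a"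
proof -
  have four: "(4 :: real) ^ a = 2 ^ a * 2 ^ a"
    by (simp add: power_mult_distrib[symmetric])
  have "(\<Sum>b<2 ^ a. \<bar>centred_hat (a, b) x\<bar>) \<le> (\<Sum>b<2 ^ a. 1 / 4 ^ (a + 1) + in_cell (a, b) x * hat_height a x)"
  proof (rule sum_mono)
    fix b
    have "0 \<le> hat (a, b) x"
      using hat_height_bounds[of a x] in_cell_nonneg[of "(a, b)" x] by (simp add: hat_def)
    moreover have "0 \<le> (1 / 4 ^ (a + 1) :: real)"
      by simp
    ultimately show "\<bar>centred_hat (a, b) x\<bar> \<le> 1 / 4 ^ (a + 1) + in_cell (a, b) x * hat_height a x"
      unfolding centred_hat_def by (simp only: hat_def fst_conv)
  qed
  also have "\<dots> = 2 ^ a * (1 / 4 ^ (a + 1)) + hat_height a x"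
    unfolding sum.distrib using assms by (subst sum_in_cell) auto
  also have "\<dots> \<le> 2 ^ a * (1 / 4 ^ (a + 1)) + 1 / 2 / 2 ^ a"
    by (intro add_left_mono hat_height_bounds)
  also have "\<dots> \<le> 1 / 2 ^ a"
    by (simp add: four field_simps)
  finally show ?thesis .
qed

lemma sum_inverse_powers_beyond:
  "(\<Sum>a<A. 1 / 2 ^ (a - n)) \<le> real n + 2"
proof -
  have "(\<Sum>a<A. 1 / 2 ^ (a - n)) \<le> real (min A n) + 2 - 2 / 2 ^ (A - n)"
  proof (induction A)
    case (Suc A)
    show ?case
    proof (cases "A < n")
      case True
      then show ?thesis
        using Suc.IH by (simp add: min_def)
    next
      case False
      then have "Suc A - n = Suc (A - n)" "min (Suc A) n = n" "min A n = n"
        by auto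
      then show ?thesis
        using Suc.IH by simp
    qed
  qed simp
  also have "\<dots> \<le> real n + 2"
  proof -
    have "real (min A n) \<le> real n" "0 \<le> (2 / 2 ^ (A - n) :: real)"
      by simp_all
    then show ?thesis
      by linarith
  qed
  finally show ?thesis .
qed

text \<open>
  For a box of level at least \<open>n\<close> this compares the total level with the excesses of the individual
  sides over \<open>n\<close>; it turns the decay in the total level into decay in each coordinate separately.
\<close>

lemma level_excess:
  assumes "finite v" "n \<le> level v I"
  shows "n + (\<Sum>j\<in>v. fst (I j) - n) \<le> level v I"
proof (cases "\<exists>j\<in>v. n \<le> fst (I j)")
  case True
  then obtain j where j: "j \<in> v" "n \<le> fst (I j)"
    by blast
  have "n + (\<Sum>i\<in>v. fst (I i) - n) = n + (fst (I j) - n) + (\<Sum>i\<in>v - {j}. fst (I i) - n)"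
    using assms(1) j(1) by (simp add: sum.remove)
  also have "\<dots> \<le> fst (I j) + (\<Sum>i\<in>v - {j}. fst (I i))"
    using j(2) by (intro add_mono sum_mono) auto
  also have "\<dots> = level v I"
    using assms(1) j(1) by (simp add: level_def sum.remove)
  finally show ?thesis .
next
  case False
  then have "(\<Sum>j\<in>v. fst (I j) - n) = 0"
    by (intro sum.neutral) (auto simp: not_le)
  then show ?thesis
    using assms(2) by simp
qed

text \<open>
  Boxes of level \<open>l \<le> n\<close>: there are \<open>2\<^sup>l\<close> of each shape and each contributes at most
  \<open>2\<^sup>l (K / 2\<^sup>l)\<^sup>2\<close>, where \<open>K = 10 (9/2)\<^bsup>card v\<^esup> 2\<^sup>t\<close>, a total of \<open>K\<^sup>2\<close> per shape. Boxes of level \<open>l > n\<close>: one of the two factors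
  of the square is estimated by \<open>K / 2\<^sup>l\<close> and the other one by the sum of the absolute values over
  all points, which for one shape adds up to at most \<open>N / 2\<^sup>l\<close>. In both cases the bound is
  dominated by a product of weights over the coordinates, so the sum over all boxes factorises.
\<close>

lemma energy_bound:
  fixes E :: "'d::finite \<Rightarrow> bit_matrix"
  assumes E: "order_digital_sequence 2 t E" and v: "v \<noteq> {}" and N: "N \<le> 2 ^ n"
  shows "energy (digital_sequence E) N A v \<le> 2 * (10 * (9 / 2) ^ card v * 2 ^ t)\<^sup>2 * (real n + 2) ^ card v"
proof -
  let ?X = "digital_sequence E"
  let ?D = "PiE v (\<lambda>_. dyadic A)"
  define K :: real where "K = 10 * (9 / 2) ^ card v * 2 ^ t"
  have "1 * 1 * 1 \<le> K"
    unfolding K_def by (intro mult_mono) auto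
  then have K: "1 \<le> K" "K \<le> K\<^sup>2"
    by (simp_all add: power2_eq_square)
  have x: "?X k $ j \<in> {0..<1}" for k j
    using E by (intro digital_sequence_digits(1)) (simp add: order_digital_sequence_def)
  \<comment> \<open>The product of the first weights dominates the boxes of level at most n, the product of the
      second ones the finer boxes.\<close>
  define head_wt :: "nat \<times> nat \<Rightarrow> real" where "head_wt i = of_bool (fst i \<le> n) / 2 ^ fst i" for i
  define tail_wt where "tail_wt k j i = 2 ^ fst i / 2 ^ (fst i - n) * \<bar>centred_hat i (?X k $ j)\<bar>" for k j i
  have tail_wt0: "0 \<le> tail_wt k j i" for k j i
    by (simp add: tail_wt_def)
  have head_wt0: "0 \<le> head_wt i" for i
    by (simp add: head_wt_def)
  have term_bound: "2 ^ level v I * (hat_sum ?X v N I)\<^sup>2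
      \<le> K\<^sup>2 * (\<Prod>j\<in>v. head_wt (I j)) + K / 2 ^ n * (\<Sum>k<N. \<Prod>j\<in>v. tail_wt k j (I j))" if I: "I \<in> ?D" for I
  proof -
    let ?L = "2 ^ level v I :: real"
    have "snd (I j) < 2 ^ fst (I j)" if "j \<in> v" for j
      using PiE_mem[OF I that] by (auto simp: dyadic_def)
    then have S: "\<bar>hat_sum ?X v N I\<bar> \<le> K / ?L"
      unfolding K_def by (intro hat_sum_bound[OF E _ v])
    have c0: "0 \<le> K\<^sup>2 * (\<Prod>j\<in>v. head_wt (I j))"
      using head_wt0 by (intro mult_nonneg_nonneg prod_nonneg) auto
    have f0: "0 \<le> K / 2 ^ n * (\<Sum>k<N. \<Prod>j\<in>v. tail_wt k j (I j))"
      using tail_wt0 K by (intro mult_nonneg_nonneg sum_nonneg prod_nonneg) auto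
    show ?thesis
    proof (cases "level v I \<le> n")
      case True
      have "fst (I j) \<le> n" if "j \<in> v" for j
      proof -
        have "fst (I j) \<le> level v I"
          unfolding level_def using that by (intro member_le_sum) auto
        with True show ?thesis by simp
      qed
      then have "(\<Prod>j\<in>v. head_wt (I j)) = (\<Prod>j\<in>v. 1 / 2 ^ fst (I j))"
        by (intro prod.cong) (auto simp: head_wt_def)
      also have "\<dots> = 1 / ?L"
        by (simp add: prod_dividef power_level)
      finally have head_wt: "(\<Prod>j\<in>v. head_wt (I j)) = 1 / ?L" .
      have "(hat_sum ?X v N I)\<^sup>2 \<le> (K / ?L)\<^sup>2"
        using S by (metis abs_ge_zero power2_abs power_mono)
      then have "?L * (hat_sum ?X v N I)\<^sup>2 \<le> ?L * (K / ?L)\<^sup>2"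
        by (intro mult_left_mono) auto
      also have "\<dots> = K\<^sup>2 * (1 / ?L)"
        by (simp add: power2_eq_square)
      finally show ?thesis
        using f0 unfolding head_wt by linarith
    next
      case False
      have excess: "2 ^ n * (\<Prod>j\<in>v. \<bar>centred_hat (I j) (?X k $ j)\<bar>) \<le> (\<Prod>j\<in>v. tail_wt k j (I j))" for k
      proof -
        have "2 ^ n * 2 ^ (\<Sum>j\<in>v. fst (I j) - n) \<le> ?L"
          unfolding power_add[symmetric] using False by (intro power_increasing level_excess) auto
        then have "2 ^ n \<le> ?L / 2 ^ (\<Sum>j\<in>v. fst (I j) - n)"
          by (simp add: field_simps)
        then have "2 ^ n * (\<Prod>j\<in>v. \<bar>centred_hat (I j) (?X k $ j)\<bar>)
            \<le> ?L / 2 ^ (\<Sum>j\<in>v. fst (I j) - n) * (\<Prod>j\<in>v. \<bar>centred_hat (I j) (?X k $ j)\<bar>)"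
          by (intro mult_right_mono prod_nonneg) auto
        also have "\<dots> = (\<Prod>j\<in>v. tail_wt k j (I j))"
          unfolding tail_wt_def prod.distrib by (simp add: prod_dividef power_level power_sum)
        finally show ?thesis .
      qed
      have "\<bar>hat_sum ?X v N I\<bar> \<le> (\<Sum>k<N. \<Prod>j\<in>v. \<bar>centred_hat (I j) (?X k $ j)\<bar>)"
        unfolding hat_sum_def abs_prod[symmetric] by (rule sum_abs)
      also have "\<dots> = (\<Sum>k<N. 2 ^ n * (\<Prod>j\<in>v. \<bar>centred_hat (I j) (?X k $ j)\<bar>)) / 2 ^ n"
        by (simp add: sum_distrib_left[symmetric])
      also have "\<dots> \<le> (\<Sum>k<N. \<Prod>j\<in>v. tail_wt k j (I j)) / 2 ^ n"
        by (intro divide_right_mono sum_mono excess) simp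
      finally have tail_wt: "\<bar>hat_sum ?X v N I\<bar> \<le> (\<Sum>k<N. \<Prod>j\<in>v. tail_wt k j (I j)) / 2 ^ n" .
      have "?L * (hat_sum ?X v N I)\<^sup>2 = ?L * (\<bar>hat_sum ?X v N I\<bar> * \<bar>hat_sum ?X v N I\<bar>)"
        by (simp add: power2_eq_square)
      also have "\<dots> \<le> ?L * ((K / ?L) * ((\<Sum>k<N. \<Prod>j\<in>v. tail_wt k j (I j)) / 2 ^ n))"
        using K by (intro mult_left_mono mult_mono S tail_wt) auto
      also have "\<dots> = K / 2 ^ n * (\<Sum>k<N. \<Prod>j\<in>v. tail_wt k j (I j))"
        by simp
      finally show ?thesis
        using c0 by linarith
    qed
  qed
  have sum_head_wt: "(\<Sum>I\<in>?D. \<Prod>j\<in>v. head_wt (I j)) \<le> (real n + 2) ^ card v"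
  proof -
    have "(\<Sum>i\<in>dyadic A. head_wt i) = (\<Sum>a<A. of_bool (a \<le> n))"
      unfolding sum_dyadic by (simp add: head_wt_def)
    also have "\<dots> = real (card ({..<A} \<inter> {..n}))"
      by (simp add: sum.If_cases of_bool_def atMost_def)
    also have "card ({..<A} \<inter> {..n}) \<le> card {..n}"
      by (intro card_mono) auto
    finally have "(\<Sum>i\<in>dyadic A. head_wt i) \<le> real n + 2"
      by simp
    then have "(\<Prod>j\<in>v. \<Sum>i\<in>dyadic A. head_wt i) \<le> (\<Prod>j\<in>v. real n + 2)"
      using head_wt0 by (intro prod_mono conjI sum_nonneg) auto
    then show ?thesis
      by (subst (asm) prod_sum_PiE) simp_all
  qed
  have sum_tail_wt: "(\<Sum>I\<in>?D. \<Prod>j\<in>v. tail_wt k j (I j)) \<le> (real n + 2) ^ card v" for k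
  proof -
    have "(\<Sum>i\<in>dyadic A. tail_wt k j i) \<le> real n + 2" for j
    proof -
      have "(\<Sum>i\<in>dyadic A. tail_wt k j i) = (\<Sum>a<A. 2 ^ a / 2 ^ (a - n) * (\<Sum>b<2 ^ a. \<bar>centred_hat (a, b) (?X k $ j)\<bar>))"
        unfolding sum_dyadic by (simp add: tail_wt_def sum_distrib_left)
      also have "\<dots> \<le> (\<Sum>a<A. 2 ^ a / 2 ^ (a - n) * (1 / 2 ^ a))"
        by (intro sum_mono mult_left_mono sum_abs_centred_hat x) simp
      also have "\<dots> = (\<Sum>a<A. 1 / 2 ^ (a - n))"
        by simp
      also have "\<dots> \<le> real n + 2"
        by (rule sum_inverse_powers_beyond)
      finally show ?thesis .
    qed
    then have "(\<Prod>j\<in>v. \<Sum>i\<in>dyadic A. tail_wt k j i) \<le> (\<Prod>j\<in>v. real n + 2)"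
      using tail_wt0 by (intro prod_mono conjI sum_nonneg) auto
    then show ?thesis
      by (subst (asm) prod_sum_PiE) simp_all
  qed
  have "energy ?X N A v \<le> (\<Sum>I\<in>?D. K\<^sup>2 * (\<Prod>j\<in>v. head_wt (I j)) + K / 2 ^ n * (\<Sum>k<N. \<Prod>j\<in>v. tail_wt k j (I j)))"
    unfolding energy_def by (intro sum_mono term_bound)
  also have "\<dots> = K\<^sup>2 * (\<Sum>I\<in>?D. \<Prod>j\<in>v. head_wt (I j)) + K / 2 ^ n * (\<Sum>k<N. \<Sum>I\<in>?D. \<Prod>j\<in>v. tail_wt k j (I j))"
    by (simp only: sum.distrib sum_distrib_left[symmetric] sum.swap[of "\<lambda>I k. \<Prod>j\<in>v. tail_wt k j (I j)" "{..<N}" ?D])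
  also have "\<dots> \<le> K\<^sup>2 * (real n + 2) ^ card v + K / 2 ^ n * (\<Sum>k<N. (real n + 2) ^ card v)"
    using K by (intro add_mono mult_left_mono sum_mono sum_head_wt sum_tail_wt) auto
  also have "\<dots> = K\<^sup>2 * (real n + 2) ^ card v + K * (real N / 2 ^ n) * (real n + 2) ^ card v"
    by simp
  also have "\<dots> \<le> K\<^sup>2 * (real n + 2) ^ card v + K * 1 * (real n + 2) ^ card v"
  proof (intro add_left_mono mult_right_mono mult_left_mono)
    have "real N \<le> 2 ^ n"
      using N by (metis of_nat_le_iff of_nat_numeral of_nat_power)
    then show "real N / 2 ^ n \<le> 1"
      by simp
  qed (use K in auto)
  also have "\<dots> \<le> K\<^sup>2 * (real n + 2) ^ card v + K\<^sup>2 * (real n + 2) ^ card v"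
    using K by (intro add_left_mono mult_right_mono) auto
  finally show ?thesis
    unfolding K_def by (simp add: mult_ac)
qed

text \<open>
  The energy bound is applied with the least \<open>n\<close> such that \<open>N \<le> 2\<^sup>n\<close>; then \<open>n + 2 \<le> 6 ln N\<close>.
\<close>

theorem upper_bound_order_2:
  fixes E :: "'d::finite \<Rightarrow> bit_matrix"
  assumes E: "order_digital_sequence 2 t E" and N: "2 \<le> N"
  shows "per_L2_discrepancy (digital_sequence E) N
    \<le> sqrt (2 * 4 ^ CARD('d) * (10 * (9 / 2) ^ CARD('d))\<^sup>2 * 6 ^ CARD('d)) * 2 ^ t * (ln (real N) powr (real CARD('d) / 2) / real N)"
proof -
  let ?X = "digital_sequence E" and ?d = "CARD('d)"
  have x: "?X k $ j \<in> {0..<1}" for k j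
    using E by (intro digital_sequence_digits(1)) (simp add: order_digital_sequence_def)
  define n where "n = (LEAST n. N \<le> 2 ^ n)"
  have "N \<le> 2 ^ N"
    by (simp add: less_imp_le)
  then have Nn: "N \<le> 2 ^ n"
    unfolding n_def by (rule LeastI)
  have n0: "n \<noteq> 0"
    using Nn N by (intro notI) simp
  have "\<not> N \<le> 2 ^ (n - 1)"
    unfolding n_def by (rule not_less_Least) (use n0 n_def in simp)
  then have "2 ^ (n - 1) \<le> real N"
    by (metis nat_le_linear of_nat_le_iff of_nat_numeral of_nat_power)
  then have "ln (2 ^ (n - 1)) \<le> ln (real N)"
    using N by (subst ln_le_cancel_iff) auto
  then have "ln 2 * real (n - 1) \<le> ln (real N)"
    by (simp add: ln_realpow mult.commute)
  moreover have "2 / 3 * real (n - 1) \<le> ln 2 * real (n - 1)"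
    using ln2_ge_two_thirds by (intro mult_right_mono) auto
  moreover have "2 / 3 \<le> ln (real N)"
  proof -
    have "ln 2 \<le> ln (real N)"
      using N by (subst ln_le_cancel_iff) auto
    then show ?thesis
      using ln2_ge_two_thirds by linarith
  qed
  moreover have "real n + 2 = real (n - 1) + 3"
    using n0 by simp
  ultimately have ln: "real n + 2 \<le> 6 * ln (real N)" "0 < ln (real N)"
    by linarith+
  define K :: real where "K = 10 * (9 / 2) ^ ?d"
  define M where "M = 2 * (K * 2 ^ t)\<^sup>2 * (real n + 2) ^ ?d"
  have energy: "energy ?X N A v \<le> M" if "v \<noteq> {}" for A v
  proof -
    have v: "card v \<le> ?d"
      by (rule card_mono) auto
    have "energy ?X N A v \<le> 2 * (10 * (9 / 2) ^ card v * 2 ^ t)\<^sup>2 * (real n + 2) ^ card v"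
      by (rule energy_bound[OF E that Nn])
    also have "\<dots> \<le> M"
      unfolding M_def K_def using v
      by (intro mult_mono power_mono power_increasing mult_left_mono mult_right_mono) auto
    finally show ?thesis .
  qed
  have M0: "0 \<le> M"
    by (simp add: M_def)
  have "total_energy ?X N A \<le> 4 ^ ?d * M" for A
  proof -
    have "total_energy ?X N A \<le> (\<Sum>v\<in>Pow (UNIV :: 'd set) - {{}}. 2 ^ ?d * M)"
      unfolding total_energy_def
    proof (rule sum_mono)
      fix v :: "'d set"
      assume "v \<in> Pow UNIV - {{}}"
      then have v: "energy ?X N A v \<le> M"
        by (intro energy) auto
      have "card v \<le> ?d"
        by (rule card_mono) auto
      then have "2 ^ card v * (1 / 3) ^ card (UNIV - v) \<le> 2 ^ ?d * (1 :: real)"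
        by (intro mult_mono power_increasing power_le_one) auto
      with v show "2 ^ card v * (1 / 3) ^ card (UNIV - v) * energy ?X N A v \<le> 2 ^ ?d * M"
        by (intro mult_mono energy_nonneg) auto
    qed
    also have "\<dots> \<le> (\<Sum>v\<in>Pow (UNIV :: 'd set). 2 ^ ?d * M)"
      using M0 by (intro sum_mono2) auto
    also have "\<dots> = 2 ^ ?d * 2 ^ ?d * M"
      by (simp add: card_Pow)
    also have "(2 :: real) ^ ?d * 2 ^ ?d = 4 ^ ?d"
      by (simp add: power_mult_distrib[symmetric])
    finally show ?thesis .
  qed
  then have "(real N * per_L2_discrepancy ?X N)\<^sup>2 \<le> 4 ^ ?d * M"
    using N x by (intro discrepancy_le_if_total_energy_le) auto
  also have "\<dots> \<le> 4 ^ ?d * (2 * (K * 2 ^ t)\<^sup>2 * (6 * ln (real N)) ^ ?d)"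
    unfolding M_def using ln by (intro mult_left_mono power_mono) auto
  also have "\<dots> = (sqrt (2 * 4 ^ ?d * K\<^sup>2 * 6 ^ ?d) * 2 ^ t * ln (real N) powr (real ?d / 2))\<^sup>2"
  proof -
    have "(ln (real N) powr (real ?d / 2))\<^sup>2 = ln (real N) ^ ?d"
      using ln(2) by (simp add: powr_power powr_realpow)
    then show ?thesis
      by (simp add: power_mult_distrib)
  qed
  finally have "real N * per_L2_discrepancy ?X N \<le> sqrt (2 * 4 ^ ?d * K\<^sup>2 * 6 ^ ?d) * 2 ^ t * ln (real N) powr (real ?d / 2)"
    by (rule power2_le_imp_le) simp
  then show ?thesis
    using N unfolding K_def by (simp add: field_simps)
qed

theorem corollary14:
  shows "(\<exists>C>0. \<forall>(t :: nat) (E :: 'd::finite \<Rightarrow> bit_matrix).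
            order_digital_sequence 2 t E \<and>
            (\<forall>j. \<forall>k\<ge>1. \<forall>l\<ge>1. k > 2 * l \<longrightarrow> E j k l = 0) \<longrightarrow>
            (\<forall>N\<ge>2. per_L2_discrepancy (digital_sequence E) N
                 \<le> C * 2 ^ t * (ln (real N) powr (real CARD('d) / 2) / real N)))
       \<and> (\<exists>c>0. \<forall>X :: nat \<Rightarrow> real ^ 'd.
            (\<forall>n j. X n $ j \<in> {0..<1}) \<longrightarrow>
            infinite {N. N \<ge> 2 \<and>
              per_L2_discrepancy X N \<ge> c * (ln (real N) powr (real CARD('d) / 2) / real N)})"
proof (rule conjI)
  define C :: real where "C = sqrt (2 * 4 ^ CARD('d) * (10 * (9 / 2) ^ CARD('d))\<^sup>2 * 6 ^ CARD('d))"
  have "0 < C"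
    by (simp add: C_def)
  moreover have "per_L2_discrepancy (digital_sequence E) N
      \<le> C * 2 ^ t * (ln (real N) powr (real CARD('d) / 2) / real N)"
    if "order_digital_sequence 2 t E" "2 \<le> N" for t N and E :: "'d \<Rightarrow> bit_matrix"
    unfolding C_def by (rule upper_bound_order_2[OF that])
  ultimately show "\<exists>C>0. \<forall>(t :: nat) (E :: 'd \<Rightarrow> bit_matrix).
      order_digital_sequence 2 t E \<and>
      (\<forall>j. \<forall>k\<ge>1. \<forall>l\<ge>1. k > 2 * l \<longrightarrow> E j k l = 0) \<longrightarrow>
      (\<forall>N\<ge>2. per_L2_discrepancy (digital_sequence E) N
           \<le> C * 2 ^ t * (ln (real N) powr (real CARD('d) / 2) / real N))"
    by blast
qed (rule lower_bound_infinitely_often)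

end
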